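(* Let $\Omega$ be a bounded Lipschitz domain in $\mathbb{R}^n$, and let $\mathcal{O}\Subset\Omega$ be a non-empty open subset with Lipschitz boundary, compactly contained in $\Omega$. Then for $0<a<1$ the set $$X_{\mathcal{O}}=\{v|_{\mathcal{O}}:\ v\in H^a(\Omega),\ (-\Delta)^a_\Omega v=0\ \text{in }\mathcal{O}\}$$ is dense in $L^2(\mathcal{O})$.
   Context: All functions are real valued. $H^a(\Omega)$ is the space of restrictions to $\Omega$ of elements of the $L^2$-based Sobolev space $H^a(\mathbb{R}^n)$. The regional fractional Laplacian is $(-\Delta)^a_\Omega u(x)=C_{n,a}\,\mathrm{p.v.}\int_\Omega\frac{u(x)-u(y)}{|x-y|^{n+2a}}dy$ for smooth $u$ on $\overline\Omega$ (with a constant $C_{n,a}>0$), extended to $u\in H^a(\Omega)$ weakly by $$\langle(-\Delta)^a_\Omega u,\psi\rangle=\frac{C_{n,a}}{2}\int_\Omega\int_\Omega\frac{(u(x)-u(y))(\psi(x)-\psi(y))}{|x-y|^{n+2a}}dy\,dx.$$ That $(-\Delta)^a_\Omega v=0$ in $\mathcal{O}$ means this pairing vanishes for all $\psi\in C_c^\infty(\mathcal{O})$. *)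

theory Defs
  imports "HOL-Analysis.Analysis"
begin

section \<open>Lipschitz domains\<close>

text \<open>Near every boundary point the set is, in a suitable orthonormal frame whose last axis is
  \<open>e\<close>, the strict epigraph of a Lipschitz function of the remaining coordinates; the hyperplane
  orthogonal to \<open>e\<close> plays the role of \<open>\<real>\<^sup>n\<^sup>-\<^sup>1\<close>. In dimension 1 it is \<open>{0}\<close>.\<close>

definition lipschitz_boundary :: "'a::euclidean_space set \<Rightarrow> bool" where
  "lipschitz_boundary S \<longleftrightarrow>
     (\<forall>p\<in>frontier S. \<exists>r e L \<phi>. r > 0 \<and> norm e = 1 \<and> L-lipschitz_on {y. y \<bullet> e = 0} \<phi> \<and>
        S \<inter> ball p r = {x \<in> ball p r. \<phi> (x - (x \<bullet> e) *\<^sub>R e) < x \<bullet> e})"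

definition bounded_lipschitz_domain :: "'a::euclidean_space set \<Rightarrow> bool" where
  "bounded_lipschitz_domain \<Omega> \<longleftrightarrow>
     open \<Omega> \<and> connected \<Omega> \<and> \<Omega> \<noteq> {} \<and> bounded \<Omega> \<and> lipschitz_boundary \<Omega>"

definition compactly_contained :: "'a::euclidean_space set \<Rightarrow> 'a set \<Rightarrow> bool" where
  "compactly_contained U \<Omega> \<longleftrightarrow> compact (closure U) \<and> closure U \<subseteq> \<Omega>"

section \<open>Function spaces\<close>

text \<open>Elements of \<open>L\<^sup>2\<close> are represented by functions, without passing to classes modulo null
  sets; values outside \<open>S\<close> are irrelevant.\<close>

definition L2_on :: "'a::euclidean_space set \<Rightarrow> ('a \<Rightarrow> real) set" where
  "L2_on S = {f. f \<in> borel_measurable (lebesgue_on S) \<and>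
                 integrable (lebesgue_on S) (\<lambda>x. (f x)\<^sup>2)}"

definition L2_norm_on :: "'a::euclidean_space set \<Rightarrow> ('a \<Rightarrow> real) \<Rightarrow> real" where
  "L2_norm_on S f = sqrt (LINT x|lebesgue_on S. (f x)\<^sup>2)"

definition dense_in_L2_on :: "'a::euclidean_space set \<Rightarrow> ('a \<Rightarrow> real) set \<Rightarrow> bool" where
  "dense_in_L2_on S X \<longleftrightarrow>
     X \<subseteq> L2_on S \<and> (\<forall>f\<in>L2_on S. \<forall>\<epsilon>>0. \<exists>g\<in>X. L2_norm_on S (\<lambda>x. f x - g x) < \<epsilon>)"

text \<open>\<open>H\<^sup>a(\<real>\<^sup>n)\<close> for \<open>0 < a < 1\<close>: square integrable functions with finite Gagliardo seminorm.
  On the diagonal the quotient is \<open>0 / 0 = 0\<close>, which does not affect the integral.\<close>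

definition sobolev :: "real \<Rightarrow> ('a::euclidean_space \<Rightarrow> real) set" where
  "sobolev a = {u \<in> L2_on UNIV.
     (\<integral>\<^sup>+x. \<integral>\<^sup>+y. ennreal ((u x - u y)\<^sup>2 / norm (x - y) powr (real DIM('a) + 2 * a))
        \<partial>lebesgue \<partial>lebesgue) < \<infinity>}"

definition sobolev_on :: "real \<Rightarrow> 'a::euclidean_space set \<Rightarrow> ('a \<Rightarrow> real) set" where
  "sobolev_on a \<Omega> = (\<lambda>u. restrict u \<Omega>) ` sobolev a"

primrec C_k :: "nat \<Rightarrow> ('a::euclidean_space \<Rightarrow> real) \<Rightarrow> bool" where
  "C_k 0 f \<longleftrightarrow> continuous_on UNIV f"
| "C_k (Suc k) f \<longleftrightarrow>
     (\<forall>x. f differentiable (at x)) \<and> (\<forall>v. C_k k (\<lambda>x. frechet_derivative f (at x) v))"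

definition test_functions :: "'a::euclidean_space set \<Rightarrow> ('a \<Rightarrow> real) set" where
  "test_functions U = {\<psi>. (\<forall>k. C_k k \<psi>) \<and>
     compact (closure {x. \<psi> x \<noteq> 0}) \<and> closure {x. \<psi> x \<noteq> 0} \<subseteq> U}"

section \<open>The regional fractional Laplacian\<close>

text \<open>The weak pairing of \<open>(-\<Delta>)\<^sup>a\<^sub>\<Omega> u\<close> with \<open>\<psi>\<close>; \<open>C\<close> is the normalising constant of the
  operator.\<close>

definition regional_pairing ::
  "real \<Rightarrow> real \<Rightarrow> 'a::euclidean_space set \<Rightarrow> ('a \<Rightarrow> real) \<Rightarrow> ('a \<Rightarrow> real) \<Rightarrow> real" where
  "regional_pairing C a \<Omega> u \<psi> =
     C / 2 * (LINT x|lebesgue_on \<Omega>. LINT y|lebesgue_on \<Omega>.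
       (u x - u y) * (\<psi> x - \<psi> y) / norm (x - y) powr (real DIM('a) + 2 * a))"

definition regional_harmonic_in ::
  "real \<Rightarrow> real \<Rightarrow> 'a::euclidean_space set \<Rightarrow> 'a set \<Rightarrow> ('a \<Rightarrow> real) \<Rightarrow> bool" where
  "regional_harmonic_in C a \<Omega> U v \<longleftrightarrow>
     (\<forall>\<psi>\<in>test_functions U. regional_pairing C a \<Omega> v \<psi> = 0)"

definition regional_solution_restrictions ::
  "real \<Rightarrow> real \<Rightarrow> 'a::euclidean_space set \<Rightarrow> 'a set \<Rightarrow> ('a \<Rightarrow> real) set" where
  "regional_solution_restrictions C a \<Omega> U =
     {restrict v U | v. v \<in> sobolev_on a \<Omega> \<and> regional_harmonic_in C a \<Omega> U v}"

end

theory Submission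
  imports Defs
begin

text \<open>Write \<open>s = n + 2 a\<close>, let \<open>E(u, h)\<close> be the integral of
  \<open>(u(x) - u(y)) (h(x) - h(y)) \<bar>x - y\<bar>\<^sup>-\<^sup>s\<close> over \<open>\<Omega> \<times> \<Omega>\<close>, and let \<open>V\<close> consist of the functions of finite
  energy \<open>E(u, u)\<close> that vanish outside \<open>U\<close>. A nonempty bounded open set is not closed, so \<open>\<Omega>\<close> minus
  the closure of \<open>U\<close> contains a closed ball; let \<open>B\<close> be its interior. For a Lipschitz function \<open>\<phi>\<close>
  supported in \<open>B\<close>, let \<open>w \<in> V\<close> solve \<open>E(w, h) = - E(\<phi>, h)\<close> for all \<open>h \<in> V\<close>. Then \<open>v = w + \<phi>\<close> is
  harmonic in \<open>U\<close> and equals \<open>w\<close> there, so it suffices that these \<open>w\<close> are dense in \<open>L\<^sup>2(U)\<close>.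

  The supports of \<open>\<phi>\<close> and \<open>h\<close> are disjoint, hence \<open>- E(\<phi>, h)\<close> is twice the integral of \<open>T\<phi> h\<close>,
  where \<open>T\<phi>(x)\<close> is the integral of \<open>\<phi>(y) \<bar>x - y\<bar>\<^sup>-\<^sup>s\<close> (\<open>energy_exterior\<close>). The exterior datum \<open>\<phi>\<close>
  thus acts like the right-hand side \<open>2 T\<phi>\<close>, and three facts give the density.

  \<^item> The functions \<open>T\<phi>\<close> are uniformly dense in the continuous functions on the closure of \<open>U\<close>
    (\<open>potentials_uniformly_dense\<close>). This is the nonlocal effect: it takes the place of unique
    continuation for the fractional Laplacian. Their uniform closure contains
    \<open>x \<mapsto> \<bar>x - y\<bar>\<^sup>-\<^sup>s\<close> for every \<open>y \<in> B\<close> and is stable under differentiation in \<open>y\<close>.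
    Laplacians turn the exponent \<open>-s\<close> into \<open>-s - 2k\<close>; Weierstrass approximation in one
    variable then yields the Gaussians \<open>exp (- l \<bar>x - y\<bar>\<^sup>2)\<close>; and since \<open>B\<close> is convex, a product
    of two such Gaussians is a multiple of a third, so Stone and Weierstrass apply.

  \<^item> Solutions with right-hand side in \<open>V\<close> are dense (\<open>resolvent_approximation\<close>): the minimiser \<open>u\<close>
    of \<open>E(u, u) + \<kappa> \<parallel>u - \<psi>\<parallel>\<^sup>2\<close> has right-hand side \<open>\<kappa> (\<psi> - u)\<close> and tends to \<open>\<psi>\<close> as \<open>\<kappa>\<close> grows.

  \<^item> Solutions depend continuously on the right-hand side in \<open>L\<^sup>2\<close>
    (\<open>exterior_data_stability\<close>), because functions in \<open>V\<close> vanish on \<open>B\<close> and therefore satisfy a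
    Poincare inequality (\<open>poincare_inequality\<close>).

  Existence of solutions is the Riesz representation theorem in \<open>V\<close>, which is complete by the
  Poincare inequality and Fatou's lemma (\<open>energy_space_complete\<close>). Finally \<open>v\<close> has finite energy
  on the whole space, since \<open>U\<close> has positive distance to the complement of \<open>\<Omega>\<close>
  (\<open>energy_space_extend\<close>).\<close>

section \<open>Riesz representation for a complete quadratic form\<close>

text \<open>The minimiser of \<open>B(u, u) - 2 l(u)\<close> represents \<open>l\<close>. By the parallelogram law a minimising
  sequence at geometric rate is Cauchy at the same rate, so completeness is only asked for such
  sequences. The functional is assumed bounded below rather than \<open>l\<close> bounded: in the applications
  the lower bound comes from completing a square, with no Cauchy--Schwarz inequality.\<close>

lemma riesz_representation_of_complete_form:
  fixes V :: "('a \<Rightarrow> real) set" and B :: "('a \<Rightarrow> real) \<Rightarrow> ('a \<Rightarrow> real) \<Rightarrow> real"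
  assumes V0: "(\<lambda>_. 0) \<in> V"
    and V: "\<And>u v c d. u \<in> V \<Longrightarrow> v \<in> V \<Longrightarrow> (\<lambda>x. c * u x + d * v x) \<in> V"
    and sym: "\<And>u v. u \<in> V \<Longrightarrow> v \<in> V \<Longrightarrow> B u v = B v u"
    and lin: "\<And>u v w c d. u \<in> V \<Longrightarrow> v \<in> V \<Longrightarrow> w \<in> V \<Longrightarrow>
                B (\<lambda>x. c * u x + d * v x) w = c * B u w + d * B v w"
    and pos: "\<And>u. u \<in> V \<Longrightarrow> B u u \<ge> 0"
    and complete: "\<And>w. (\<And>k. w k \<in> V) \<Longrightarrow>
           (\<And>j k. j \<le> k \<Longrightarrow> B (\<lambda>x. w k x - w j x) (\<lambda>x. w k x - w j x) \<le> 4 * (1/8)^j) \<Longrightarrow>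
           \<exists>u\<in>V. \<exists>K. \<forall>j. B (\<lambda>x. u x - w j x) (\<lambda>x. u x - w j x) \<le> K * (1/8)^j"
    and l: "\<And>u v c d. u \<in> V \<Longrightarrow> v \<in> V \<Longrightarrow> l (\<lambda>x. c * u x + d * v x) = c * l u + d * l v"
    and bdd: "\<And>u. u \<in> V \<Longrightarrow> B u u - 2 * l u \<ge> M"
  shows "\<exists>u\<in>V. \<forall>h\<in>V. B u h = l h"
proof -
  define J where "J u = B u u - 2 * l u" for u
  have lin2: "B w (\<lambda>x. c * u x + d * v x) = c * B w u + d * B w v"
    if "u \<in> V" "v \<in> V" "w \<in> V" for u v w c d
    using lin[OF that] sym[OF that(3) V[OF that(1,2)]] sym[OF that(3,1)] sym[OF that(3,2)] by simp
  have quad: "B (\<lambda>x. c * u x + d * v x) (\<lambda>x. c * u x + d * v x)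
      = c\<^sup>2 * B u u + 2 * c * d * B u v + d\<^sup>2 * B v v" if "u \<in> V" "v \<in> V" for u v c d
    unfolding lin[OF that V[OF that]] lin2[OF that that(1)] lin2[OF that that(2)] sym[OF that(2,1)]
    by (simp add: power2_eq_square algebra_simps)
  have diff: "B (\<lambda>x. u x - v x) (\<lambda>x. u x - v x) = B u u - 2 * B u v + B v v"
    if "u \<in> V" "v \<in> V" for u v
    using quad[OF that, of 1 "-1"] by simp
  have Vdiff: "(\<lambda>x. u x - v x) \<in> V" if "u \<in> V" "v \<in> V" for u v
    using V[OF that, of 1 "-1"] by simp
  define m where "m = Inf (J ` V)"
  have bb: "bdd_below (J ` V)" using bdd unfolding J_def bdd_below_def by blast
  have m_le: "m \<le> J u" if "u \<in> V" for u
    unfolding m_def using bb that by (simp add: cINF_lower)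
  have "\<exists>w\<in>V. J w < m + (1/8)^k" for k :: nat
  proof -
    have "Inf (J ` V) < m + (1/8)^k" by (simp add: m_def)
    then show ?thesis using V0 bb by (subst (asm) cInf_less_iff) auto
  qed
  then obtain w where w: "\<And>k. w k \<in> V" "\<And>k. J (w k) < m + (1/8)^k" by metis
  have cauchy: "B (\<lambda>x. w k x - w j x) (\<lambda>x. w k x - w j x) \<le> 4 * (1/8)^j" if "j \<le> k" for j k
  proof -
    let ?h = "\<lambda>x. 1/2 * w k x + 1/2 * w j x"
    have "m \<le> J ?h" using m_le V w by blast
    also have "J ?h = (B (w k) (w k) + 2 * B (w k) (w j) + B (w j) (w j)) / 4 - l (w k) - l (w j)"
      unfolding J_def quad[OF w(1) w(1)] l[OF w(1) w(1)] by (simp add: power2_eq_square field_simps)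
    finally have "B (w k) (w k) - 2 * B (w k) (w j) + B (w j) (w j)
        \<le> 2 * J (w k) + 2 * J (w j) - 4 * m" unfolding J_def by (simp add: field_simps)
    moreover have "(1/8)^k \<le> (1/8::real)^j" using that by (intro power_decreasing) auto
    ultimately show ?thesis using w(2)[of k] w(2)[of j] unfolding diff[OF w(1) w(1)] by linarith
  qed
  obtain u C where u: "u \<in> V" "\<And>j. B (\<lambda>x. u x - w j x) (\<lambda>x. u x - w j x) \<le> C * (1/8)^j"
    using complete[OF w(1) cauchy] by blast
  have "B u h = l h" if h: "h \<in> V" for h
  proof -
    define K where "K = B h h + (1 + max C 0) / 2"
    have Cr: "B (\<lambda>x. u x - w j x) (\<lambda>x. u x - w j x) \<le> max C 0 * (1/8)^j" for j
      by (rule order_trans[OF u(2)]) (simp add: mult_right_mono)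
    have bound: "\<bar>B u h - l h\<bar> \<le> K * (1/2)^k" for k :: nat
    proof -
      \<comment> \<open>The step \<open>t = \<plusminus>r\<close> balances \<open>t\<^sup>2\<close> against the error \<open>r\<^sup>3 = (1/8)\<^sup>k\<close>; dividing by \<open>r\<close> leaves \<open>O(r)\<close>.\<close>
      define r where "r = (1/2::real)^k"
      have r: "r > 0" "(1/8::real)^k = r * r\<^sup>2"
        by (auto simp: r_def power2_eq_square power_mult_distrib[symmetric])
      have 1: "-(r * r\<^sup>2) \<le> t\<^sup>2 * B h h + 2 * t * (B (w k) h - l h)" for t
      proof -
        \<comment> \<open>\<open>w k\<close> is minimal up to \<open>(1/8)\<^sup>k\<close>, so its first variation in direction \<open>h\<close> is small.\<close>
        have "m \<le> J (\<lambda>x. 1 * w k x + t * h x)" using m_le V w h by blast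
        also have "\<dots> = J (w k) + t\<^sup>2 * B h h + 2 * t * (B (w k) h - l h)"
          unfolding J_def quad[OF w(1) h] l[OF w(1) h] by (simp add: algebra_simps)
        finally show ?thesis using w(2)[of k] r by linarith
      qed
      have 2: "0 \<le> t\<^sup>2 * B h h + 2 * t * (B u h - B (w k) h) + max C 0 * (r * r\<^sup>2)" for t
      proof -
        let ?d = "\<lambda>x. u x - w k x"
        have d: "B ?d h = B u h - B (w k) h" using lin[OF u(1) w(1) h, of 1 "-1"] by simp
        have "0 \<le> B (\<lambda>x. 1 * ?d x + t * h x) (\<lambda>x. 1 * ?d x + t * h x)"
          by (intro pos V Vdiff u w h)
        then show ?thesis using Cr[of k] unfolding r(2) quad[OF Vdiff[OF u(1) w(1)] h] d
          by simp
      qed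
      have "2 * r * \<bar>B u h - l h\<bar> \<le> 2 * r * (K * r)"
      proof -
        have "r * r\<^sup>2 \<le> r\<^sup>2" using r by (simp add: r_def mult_left_le_one_le power_le_one)
        then have "\<bar>2 * r * (B (w k) h - l h)\<bar> \<le> r\<^sup>2 * B h h + r\<^sup>2"
          "\<bar>2 * r * (B u h - B (w k) h)\<bar> \<le> r\<^sup>2 * B h h + max C 0 * r\<^sup>2"
          using 1[of r] 1[of "-r"] 2[of r] 2[of "-r"] mult_left_mono[of "r * r\<^sup>2" "r\<^sup>2" "max C 0"]
          by auto
        moreover have "2 * r * (B u h - l h) = 2 * r * (B (w k) h - l h) + 2 * r * (B u h - B (w k) h)"
          by (simp add: algebra_simps)
        moreover have "0 \<le> r\<^sup>2" by simp
        ultimately have "\<bar>2 * r * (B u h - l h)\<bar> \<le> 2 * (r\<^sup>2 * B h h) + (r\<^sup>2 + max C 0 * r\<^sup>2)"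
          by linarith
        moreover have "\<bar>2 * r * (B u h - l h)\<bar> = 2 * r * \<bar>B u h - l h\<bar>"
          using r by (simp add: abs_mult)
        ultimately show ?thesis unfolding K_def by (simp add: power2_eq_square algebra_simps add_divide_distrib)
      qed
      then show ?thesis using r by (simp add: r_def)
    qed
    have "(\<lambda>k. K * (1/2)^k) \<longlonglongrightarrow> K * 0" by (intro tendsto_intros) auto
    then have "\<bar>B u h - l h\<bar> \<le> K * 0" using bound by (intro LIMSEQ_le_const) auto
    then show ?thesis by simp
  qed
  then show ?thesis using u(1) by blast
qed

section \<open>Integrability of the singular kernel\<close>

text \<open>A substitute for polar coordinates: a sum over balls of geometric size needs only the
  scaling of their volume.\<close>

lemma nn_integral_less_top_if_dominated_on_balls:
  fixes g :: "'a::euclidean_space \<Rightarrow> ennreal" and c R :: "nat \<Rightarrow> real"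
  assumes dom: "\<And>x. g x \<noteq> 0 \<Longrightarrow> \<exists>k. norm x < R k \<and> g x \<le> ennreal (c k)"
    and R: "\<And>k. R k \<ge> 0" and c: "\<And>k. c k \<ge> 0"
    and le: "\<And>k. c k * R k ^ DIM('a) \<le> K * q ^ k" and q: "0 \<le> q" "q < 1"
  shows "(\<integral>\<^sup>+x. g x \<partial>lborel) < \<infinity>"
proof -
  let ?v = "unit_ball_vol (real DIM('a))"
  have v: "?v \<ge> 0" by (simp add: unit_ball_vol_nonneg)
  have "(\<integral>\<^sup>+x. g x \<partial>lborel) \<le> (\<integral>\<^sup>+x. (\<Sum>k. ennreal (c k) * indicator (ball (0::'a) (R k)) x) \<partial>lborel)"
  proof (intro nn_integral_mono)
    fix x :: 'a
    show "g x \<le> (\<Sum>k. ennreal (c k) * indicator (ball 0 (R k)) x)"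
    proof (cases "g x = 0")
      case False
      then obtain k where k: "norm x < R k" "g x \<le> ennreal (c k)" using dom by blast
      have "g x \<le> (\<Sum>i\<in>{k}. ennreal (c i) * indicator (ball 0 (R i)) x)" using k by simp
      also have "\<dots> \<le> (\<Sum>k. ennreal (c k) * indicator (ball 0 (R k)) x)" by (rule sum_le_suminf) auto
      finally show ?thesis .
    qed auto
  qed
  also have "\<dots> = (\<Sum>k. \<integral>\<^sup>+x. ennreal (c k) * indicator (ball (0::'a) (R k)) x \<partial>lborel)"
    by (intro nn_integral_suminf borel_measurable_times_ennreal borel_measurable_const
        borel_measurable_indicator) simp
  also have "\<dots> = (\<Sum>k. ennreal (c k) * ennreal (?v * R k ^ DIM('a)))"
    using R by (subst nn_integral_cmult_indicator) (auto simp: emeasure_ball)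
  also have "\<dots> \<le> (\<Sum>k. ennreal (K * ?v * q ^ k))"
  proof (intro suminf_le)
    fix k
    have "c k * (?v * R k ^ DIM('a)) \<le> K * ?v * q ^ k"
      using mult_left_mono[OF le[of k] v] by (simp add: mult_ac)
    then show "ennreal (c k) * ennreal (?v * R k ^ DIM('a)) \<le> ennreal (K * ?v * q ^ k)"
      using c by (subst ennreal_mult'[symmetric]) (auto intro: ennreal_leI)
  qed auto
  also have "\<dots> < \<infinity>"
  proof -
    have "0 \<le> K"
    proof -
      have "0 \<le> c 0 * R 0 ^ DIM('a)" using c R by simp
      also have "\<dots> \<le> K" using le[of 0] by simp
      finally show ?thesis .
    qed
    moreover have "summable (\<lambda>k. K * ?v * q ^ k)" using q by (intro summable_mult) auto
    ultimately show ?thesis using v q by (subst suminf_ennreal2) auto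
  qed
  finally show ?thesis .
qed

text \<open>Near the origin \<open>\<bar>z\<bar> powr (2 - s)\<close> is integrable because \<open>a < 1\<close>, and far away
  \<open>\<bar>z\<bar> powr (- s)\<close> is integrable because \<open>a > 0\<close>; here \<open>s = n + 2 a\<close>. The finiteness of all energies on
  the whole space reduces to this single integral.\<close>

lemma nn_integral_levy_kernel:
  fixes a :: real
  assumes "0 < a" "a < 1"
  shows "(\<integral>\<^sup>+z. ennreal (min 1 ((norm z)\<^sup>2) / norm z powr (real DIM('a) + 2 * a)) \<partial>(lborel :: 'a::euclidean_space measure)) < \<infinity>"
proof -
  let ?s = "real DIM('a) + 2 * a"
  let ?g = "\<lambda>z::'a. ennreal (min 1 ((norm z)\<^sup>2) / norm z powr ?s)"
  let ?n = "DIM('a)"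
  have pw: "(2 powr x) ^ k = 2 powr (real k * x)" for x :: real and k
    by (simp add: powr_power)
  have pd: "2 powr A / 2 powr B * 2 powr C = 2 powr (A - B + C)"
    and pd2: "1 / 2 powr B * 2 powr C = 2 powr (C - B)" for A B C :: real
    by (simp_all add: powr_add powr_diff)
  have "(\<integral>\<^sup>+z. ?g z * indicator (ball 0 1) z \<partial>lborel) < \<infinity>"
  proof (rule nn_integral_less_top_if_dominated_on_balls)
    fix z :: 'a
    assume "?g z * indicator (ball 0 1) z \<noteq> 0"
    then have z: "0 < norm z" "norm z < 1" by (auto simp: indicator_def split: if_splits)
    define k where "k = nat (\<lceil>- log 2 (norm z)\<rceil> - 1)"
    have "log 2 (norm z) < 0" using z by simp
    then have "real k < - log 2 (norm z)" "- log 2 (norm z) \<le> real k + 1"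
      unfolding k_def by linarith+
    then have "log 2 (norm z) < - real k" "- real k - 1 \<le> log 2 (norm z)" by linarith+
    then have k: "norm z < 2 powr (- real k)" "2 powr (- real k - 1) \<le> norm z"
      using z log_less_iff[of 2 "norm z"] le_log_iff[of 2 "norm z"] by auto
    have "min 1 ((norm z)\<^sup>2) / norm z powr ?s \<le> (2 powr (- real k))\<^sup>2 / (2 powr (- real k - 1)) powr ?s"
    proof (intro frac_le powr_mono2)
      have "(norm z)\<^sup>2 \<le> (2 powr (- real k))\<^sup>2" using k by (intro power_mono) auto
      then show "min 1 ((norm z)\<^sup>2) \<le> (2 powr (- real k))\<^sup>2" by linarith
    qed (use k z assms in auto)
    then show "\<exists>k. norm z < 2 powr (- real k) \<and> ?g z * indicator (ball 0 1) z \<le>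
        ennreal ((2 powr (- real k))\<^sup>2 / (2 powr (- real k - 1)) powr ?s)"
      using k z by (intro exI[of _ k]) (auto intro: ennreal_leI)
  next
    fix k
    show "(2 powr (- real k))\<^sup>2 / (2 powr (- real k - 1)) powr ?s * (2 powr (- real k)) ^ DIM('a)
      \<le> 2 powr ?s * (2 powr (2 * a - 2)) ^ k"
    proof -
      have "(2 powr (- real k))\<^sup>2 / (2 powr (- real k - 1)) powr ?s * (2 powr (- real k)) ^ ?n
        = 2 powr (real 2 * (- real k) - (- real k - 1) * ?s + ?n * (- real k))"
        unfolding powr_powr pw pd ..
      also have "real 2 * (- real k) - (- real k - 1) * ?s + ?n * (- real k) = ?s + real k * (2 * a - 2)"
        by (simp add: algebra_simps)
      also have "2 powr (?s + real k * (2 * a - 2)) = 2 powr ?s * (2 powr (2 * a - 2)) ^ k"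
        unfolding pw powr_add by simp
      finally show ?thesis by simp
    qed
    show "2 powr (2 * a - 2) < 1" using assms powr_less_mono[of "2*a-2" 0 "2::real"] by simp
  qed auto
  moreover have "(\<integral>\<^sup>+z. ?g z * indicator (- ball 0 1) z \<partial>lborel) < \<infinity>"
  proof (rule nn_integral_less_top_if_dominated_on_balls)
    fix z :: 'a
    assume "?g z * indicator (- ball 0 1) z \<noteq> 0"
    then have z: "1 \<le> norm z" "z \<noteq> 0" by (auto simp: indicator_def split: if_splits)
    define k where "k = nat \<lfloor>log 2 (norm z)\<rfloor>"
    have "log 2 (norm z) \<ge> 0" using z by (subst zero_le_log_cancel_iff) auto
    then have "real k \<le> log 2 (norm z)" "log 2 (norm z) < real k + 1"
      unfolding k_def by linarith+
    then have k: "norm z < 2 powr (real k + 1)" "2 powr (real k) \<le> norm z"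
      using z log_less_iff[of 2 "norm z"] le_log_iff[of 2 "norm z"] by auto
    have "min 1 ((norm z)\<^sup>2) / norm z powr ?s \<le> 1 / (2 powr real k) powr ?s"
      using k z assms by (intro frac_le powr_mono2) simp_all
    then show "\<exists>k. norm z < 2 powr (real k + 1) \<and> ?g z * indicator (- ball 0 1) z \<le>
        ennreal (1 / (2 powr real k) powr ?s)"
      using k z by (intro exI[of _ k]) (auto intro: ennreal_leI)
  next
    fix k
    show "1 / (2 powr real k) powr ?s * (2 powr (real k + 1)) ^ DIM('a)
      \<le> 2 powr (DIM('a)) * (2 powr (- 2 * a)) ^ k"
    proof -
      have "1 / (2 powr real k) powr ?s * (2 powr (real k + 1)) ^ ?n
        = 2 powr (?n * (real k + 1) - real k * ?s)"
        unfolding powr_powr pw pd2 ..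
      also have "?n * (real k + 1) - real k * ?s = ?n + real k * (- 2 * a)"
        by (simp add: algebra_simps)
      also have "2 powr (?n + real k * (- 2 * a)) = 2 powr ?n * (2 powr (- 2 * a)) ^ k"
        unfolding pw powr_add by simp
      finally show ?thesis by simp
    qed
    show "2 powr (- 2 * a) < 1" using assms powr_less_mono[of "-2*a" 0 "2::real"] by simp
  qed auto
  moreover have "(\<integral>\<^sup>+z. ?g z \<partial>lborel) = (\<integral>\<^sup>+z. ?g z * indicator (ball 0 1) z \<partial>lborel)
      + (\<integral>\<^sup>+z. ?g z * indicator (- ball 0 1) z \<partial>lborel)"
    by (subst nn_integral_add[symmetric]) (auto intro!: nn_integral_cong simp: indicator_def)
  ultimately show ?thesis by (simp add: ennreal_add_eq_top less_top[symmetric])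
qed

section \<open>The energy form\<close>

definition kern :: "real \<Rightarrow> 'a::euclidean_space \<Rightarrow> real" where
  "kern a z = 1 / norm z powr (real DIM('a) + 2 * a)"

text \<open>The energy is the \<open>L\<^sup>2\<close> inner product of increments with respect to this measure, so that
  bilinearity, integrability of products and Fatou's lemma come from general measure theory.\<close>

definition gagliardo_measure :: "real \<Rightarrow> 'a::euclidean_space set \<Rightarrow> ('a \<times> 'a) measure" where
  "gagliardo_measure a \<Omega> = density (lborel \<Otimes>\<^sub>M lborel)
     (\<lambda>(x, y). ennreal (indicator \<Omega> x * indicator \<Omega> y * kern a (x - y)))"

definition increment :: "('a \<Rightarrow> real) \<Rightarrow> 'a \<times> 'a \<Rightarrow> real" where
  "increment u = (\<lambda>(x, y). u x - u y)"

definition energy :: "real \<Rightarrow> 'a::euclidean_space set \<Rightarrow> ('a \<Rightarrow> real) \<Rightarrow> ('a \<Rightarrow> real) \<Rightarrow> real" where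
  "energy a \<Omega> u v = (LINT z|gagliardo_measure a \<Omega>. increment u z * increment v z)"

definition energy_space :: "real \<Rightarrow> 'a::euclidean_space set \<Rightarrow> 'a set \<Rightarrow> ('a \<Rightarrow> real) set" where
  "energy_space a \<Omega> U = {u \<in> borel_measurable borel. (\<forall>x. x \<notin> U \<longrightarrow> u x = 0) \<and>
     integrable (gagliardo_measure a \<Omega>) (\<lambda>z. (increment u z)\<^sup>2)}"

lemma kern_nonneg [simp]: "kern a z \<ge> 0"
  by (simp add: kern_def)

lemma kern_commute: "kern a (x - y) = kern a (y - x)"
  by (simp add: kern_def norm_minus_commute)

lemma kern_measurable [measurable]: "kern a \<in> borel_measurable borel"
  unfolding kern_def[abs_def] by measurable

lemma increment_measurable [measurable]:
  assumes [measurable]: "u \<in> borel_measurable borel"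
  shows "increment u \<in> borel_measurable (borel \<Otimes>\<^sub>M borel)"
  unfolding increment_def by measurable

lemma sets_gagliardo_measure [measurable_cong, simp]:
  "sets (gagliardo_measure a \<Omega>) = sets (borel \<Otimes>\<^sub>M borel)"
  unfolding gagliardo_measure_def by (simp add: sets_pair_measure_cong[OF sets_lborel sets_lborel])

lemma nn_integral_gagliardo_measure:
  assumes [measurable]: "\<Omega> \<in> sets borel" "f \<in> borel_measurable (borel \<Otimes>\<^sub>M borel)"
  shows "(\<integral>\<^sup>+z. f z \<partial>gagliardo_measure a \<Omega>) =
    (\<integral>\<^sup>+x. \<integral>\<^sup>+y. ennreal (indicator \<Omega> x * indicator \<Omega> y * kern a (x - y)) * f (x, y) \<partial>lborel \<partial>lborel)"
  unfolding gagliardo_measure_def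
  by (subst nn_integral_density, simp, simp, subst lborel.nn_integral_fst[symmetric]) simp_all

lemma integrable_mult_of_squares:
  fixes f g :: "'a \<Rightarrow> real"
  assumes "f \<in> borel_measurable M" "g \<in> borel_measurable M"
    and "integrable M (\<lambda>x. (f x)\<^sup>2)" "integrable M (\<lambda>x. (g x)\<^sup>2)"
  shows "integrable M (\<lambda>x. f x * g x)"
proof (rule Bochner_Integration.integrable_bound)
  show "integrable M (\<lambda>x. (f x)\<^sup>2 + (g x)\<^sup>2)" using assms by simp
  have "\<bar>s * t\<bar> \<le> s\<^sup>2 + t\<^sup>2" for s t :: real
  proof -
    have "2 * (\<bar>s\<bar> * \<bar>t\<bar>) \<le> s\<^sup>2 + t\<^sup>2" using sum_squares_bound[of "\<bar>s\<bar>" "\<bar>t\<bar>"] by simp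
    moreover have "0 \<le> \<bar>s\<bar> * \<bar>t\<bar>" by simp
    ultimately show ?thesis unfolding abs_mult by linarith
  qed
  then show "AE x in M. norm (f x * g x) \<le> norm ((f x)\<^sup>2 + (g x)\<^sup>2)" by simp
qed (use assms in simp)

lemma energy_space_borel: "u \<in> energy_space a \<Omega> U \<Longrightarrow> u \<in> borel_measurable borel"
  by (simp add: energy_space_def)

lemma integrable_increment_mult:
  assumes "u \<in> energy_space a \<Omega> U" "v \<in> energy_space a \<Omega> W"
  shows "integrable (gagliardo_measure a \<Omega>) (\<lambda>z. increment u z * increment v z)"
proof (rule integrable_mult_of_squares)
  note [measurable] = assms[THEN energy_space_borel]
  show "increment u \<in> borel_measurable (gagliardo_measure a \<Omega>)"
    "increment v \<in> borel_measurable (gagliardo_measure a \<Omega>)" by measurable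
qed (use assms in \<open>auto simp: energy_space_def\<close>)

lemma energy_space_linear:
  assumes "u \<in> energy_space a \<Omega> U" "v \<in> energy_space a \<Omega> U"
  shows "(\<lambda>x. c * u x + d * v x) \<in> energy_space a \<Omega> U"
proof -
  note [measurable] = assms[THEN energy_space_borel]
  have "(increment (\<lambda>x. c * u x + d * v x) z)\<^sup>2 = c\<^sup>2 * (increment u z * increment u z)
     + 2 * c * d * (increment u z * increment v z) + d\<^sup>2 * (increment v z * increment v z)" for z
    by (simp add: increment_def split_beta power2_eq_square algebra_simps)
  then have "integrable (gagliardo_measure a \<Omega>) (\<lambda>z. (increment (\<lambda>x. c * u x + d * v x) z)\<^sup>2)"
    using assms by (simp add: integrable_increment_mult)
  then show ?thesis using assms by (simp add: energy_space_def)
qed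

lemma energy_space_diff:
  assumes "u \<in> energy_space a \<Omega> U" "v \<in> energy_space a \<Omega> U"
  shows "(\<lambda>x. u x - v x) \<in> energy_space a \<Omega> U"
  using energy_space_linear[OF assms, of 1 "-1"] by simp

lemma energy_space_zero: "(\<lambda>_. 0) \<in> energy_space a \<Omega> U"
  by (simp add: energy_space_def increment_def split_beta)

lemma energy_space_mono: "U \<subseteq> W \<Longrightarrow> energy_space a \<Omega> U \<subseteq> energy_space a \<Omega> W"
  by (auto simp: energy_space_def)

lemma energy_commute: "energy a \<Omega> u v = energy a \<Omega> v u"
  by (simp add: energy_def mult.commute)

lemma energy_nonneg: "energy a \<Omega> u u \<ge> 0"
  unfolding energy_def by (intro integral_nonneg_AE) simp

lemma energy_linear:
  assumes "u \<in> energy_space a \<Omega> U" "v \<in> energy_space a \<Omega> U" "w \<in> energy_space a \<Omega> W"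
  shows "energy a \<Omega> (\<lambda>x. c * u x + d * v x) w = c * energy a \<Omega> u w + d * energy a \<Omega> v w"
proof -
  have "increment (\<lambda>x. c * u x + d * v x) z * increment w z =
     c * (increment u z * increment w z) + d * (increment v z * increment w z)" for z
    by (simp add: increment_def split_beta algebra_simps)
  then show ?thesis unfolding energy_def
    using assms by (simp add: integrable_increment_mult)
qed

lemma nn_integral_energy:
  assumes "u \<in> energy_space a \<Omega> U"
  shows "(\<integral>\<^sup>+z. ennreal ((increment u z)\<^sup>2) \<partial>gagliardo_measure a \<Omega>) = ennreal (energy a \<Omega> u u)"
  using assms unfolding energy_def power2_eq_square[symmetric]
  by (intro nn_integral_eq_integral) (auto simp: energy_space_def)

lemma energy_spaceI:
  assumes [measurable]: "u \<in> borel_measurable borel"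
    and "\<And>x. x \<notin> U \<Longrightarrow> u x = 0"
    and "(\<integral>\<^sup>+z. ennreal ((increment u z)\<^sup>2) \<partial>gagliardo_measure a \<Omega>) < \<infinity>"
  shows "u \<in> energy_space a \<Omega> U"
  using assms by (auto simp: energy_space_def intro!: integrableI_nonneg)

lemma nn_integral_gagliardo_mono:
  assumes [measurable]: "\<Omega> \<in> sets borel" "\<Omega>' \<in> sets borel" "f \<in> borel_measurable (borel \<Otimes>\<^sub>M borel)" and "\<Omega> \<subseteq> \<Omega>'"
  shows "(\<integral>\<^sup>+z. f z \<partial>gagliardo_measure a \<Omega>) \<le> (\<integral>\<^sup>+z. f z \<partial>gagliardo_measure a \<Omega>')"
  unfolding nn_integral_gagliardo_measure[OF assms(1,3)] nn_integral_gagliardo_measure[OF assms(2,3)]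
  using assms(4) by (intro nn_integral_mono mult_right_mono) (auto simp: indicator_def)

lemma energy_space_subset:
  assumes "\<Omega> \<in> sets borel" "\<Omega>' \<in> sets borel" "\<Omega> \<subseteq> \<Omega>'" and u: "u \<in> energy_space a \<Omega>' U"
  shows "u \<in> energy_space a \<Omega> U"
proof (rule energy_spaceI)
  note [measurable] = energy_space_borel[OF u]
  show "u \<in> borel_measurable borel" by measurable
  have "(\<integral>\<^sup>+z. ennreal ((increment u z)\<^sup>2) \<partial>gagliardo_measure a \<Omega>)
     \<le> (\<integral>\<^sup>+z. ennreal ((increment u z)\<^sup>2) \<partial>gagliardo_measure a \<Omega>')"
    using assms by (intro nn_integral_gagliardo_mono) auto
  then show "(\<integral>\<^sup>+z. ennreal ((increment u z)\<^sup>2) \<partial>gagliardo_measure a \<Omega>) < \<infinity>"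
    using nn_integral_energy[OF u] by (simp add: le_less_trans)
qed (use u in \<open>auto simp: energy_space_def\<close>)

lemma nn_integral_lborel_reflect:
  fixes k :: "'a::euclidean_space \<Rightarrow> ennreal"
  assumes [measurable]: "k \<in> borel_measurable borel" and "\<And>z. k (- z) = k z"
  shows "(\<integral>\<^sup>+y. k (x - y) \<partial>lborel) = (\<integral>\<^sup>+z. k z \<partial>lborel)"
proof -
  have "(\<integral>\<^sup>+z. k z \<partial>lborel) = (\<integral>\<^sup>+z. k z \<partial>distr lborel borel ((+) (- x)))"
    by (simp add: lborel_distr_plus)
  also have "\<dots> = (\<integral>\<^sup>+y. k (- x + y) \<partial>lborel)" by (subst nn_integral_distr) auto
  also have "\<dots> = (\<integral>\<^sup>+y. k (x - y) \<partial>lborel)"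
  proof (intro nn_integral_cong)
    show "k (- x + y) = k (x - y)" for y using assms(2)[of "x - y"] by simp
  qed
  finally show ?thesis by simp
qed

lemma nn_integral_symmetrized_convolution:
  fixes f k :: "'a::euclidean_space \<Rightarrow> ennreal"
  assumes [measurable]: "f \<in> borel_measurable borel" "k \<in> borel_measurable borel"
    and even: "\<And>z. k (- z) = k z"
  shows "(\<integral>\<^sup>+x. \<integral>\<^sup>+y. (f x + f y) * k (x - y) \<partial>lborel \<partial>lborel) = 2 * (\<integral>\<^sup>+x. f x \<partial>lborel) * (\<integral>\<^sup>+z. k z \<partial>lborel)"
proof -
  have 1: "(\<integral>\<^sup>+x. \<integral>\<^sup>+y. f x * k (x - y) \<partial>lborel \<partial>lborel) = (\<integral>\<^sup>+x. f x \<partial>lborel) * (\<integral>\<^sup>+z. k z \<partial>lborel)"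
    by (simp add: nn_integral_cmult nn_integral_multc nn_integral_lborel_reflect even)
  have k: "k (y - x) = k (x - y)" for x y using even[of "x - y"] by simp
  have "(\<integral>\<^sup>+x. \<integral>\<^sup>+y. f y * k (x - y) \<partial>lborel \<partial>lborel) = (\<integral>\<^sup>+y. \<integral>\<^sup>+x. f y * k (x - y) \<partial>lborel \<partial>lborel)"
    by (rule lborel_pair.Fubini') measurable
  also have "\<dots> = (\<integral>\<^sup>+x. f x \<partial>lborel) * (\<integral>\<^sup>+z. k z \<partial>lborel)"
    unfolding 1[symmetric] by (intro nn_integral_cong) (simp add: k)
  finally have 2: "(\<integral>\<^sup>+x. \<integral>\<^sup>+y. f y * k (x - y) \<partial>lborel \<partial>lborel) = (\<integral>\<^sup>+x. f x \<partial>lborel) * (\<integral>\<^sup>+z. k z \<partial>lborel)" .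
  have "(\<integral>\<^sup>+x. \<integral>\<^sup>+y. (f x + f y) * k (x - y) \<partial>lborel \<partial>lborel) =
    (\<integral>\<^sup>+x. \<integral>\<^sup>+y. f x * k (x - y) \<partial>lborel \<partial>lborel) + (\<integral>\<^sup>+x. \<integral>\<^sup>+y. f y * k (x - y) \<partial>lborel \<partial>lborel)"
    by (simp add: distrib_right nn_integral_add)
  then show ?thesis unfolding 1 2 by (simp add: mult_2 distrib_right)
qed

lemma nn_integral_levy_kernel_finite:
  assumes "0 < a" "a < 1"
  shows "(\<integral>\<^sup>+z. ennreal (min 1 ((norm z)\<^sup>2) * kern a z) \<partial>(lborel :: 'a::euclidean_space measure)) < \<infinity>"
  using nn_integral_levy_kernel[OF assms, where 'a='a] by (simp add: kern_def)

section \<open>Functions of finite energy\<close>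

text \<open>To pass from the energy on \<open>\<Omega>\<close> to the energy on the whole space only the pairs outside
  \<open>\<Omega> \<times> \<Omega>\<close> have to be controlled. With \<open>\<Omega>\<close> empty this is a criterion for finite energy.\<close>

lemma finite_energy_if_dominated:
  fixes u f :: "'a::euclidean_space \<Rightarrow> real"
  assumes a: "0 < a" "a < 1"
    and [measurable]: "u \<in> borel_measurable borel" "f \<in> borel_measurable borel" "\<Omega> \<in> sets borel"
    and f0: "\<And>x. f x \<ge> 0" and f: "(\<integral>\<^sup>+x. ennreal (f x) \<partial>lborel) < \<infinity>"
    and E: "(\<integral>\<^sup>+z. ennreal ((increment u z)\<^sup>2) \<partial>gagliardo_measure a \<Omega>) < \<infinity>"
    and dom: "\<And>x y. \<not> (x \<in> \<Omega> \<and> y \<in> \<Omega>) \<Longrightarrow>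
        (u x - u y)\<^sup>2 \<le> (f x + f y) * min 1 ((norm (x - y))\<^sup>2)"
  shows "(\<integral>\<^sup>+z. ennreal ((increment u z)\<^sup>2) \<partial>gagliardo_measure a UNIV) < \<infinity>"
proof -
  let ?k = "\<lambda>z::'a. ennreal (min 1 ((norm z)\<^sup>2) * kern a z)"
  let ?g = "\<lambda>x y. ennreal (indicator \<Omega> x * indicator \<Omega> y * kern a (x - y)) * ennreal ((u x - u y)\<^sup>2)"
  have "(\<integral>\<^sup>+z. ennreal ((increment u z)\<^sup>2) \<partial>gagliardo_measure a UNIV)
    = (\<integral>\<^sup>+x. \<integral>\<^sup>+y. ennreal (kern a (x - y)) * ennreal ((u x - u y)\<^sup>2) \<partial>lborel \<partial>lborel)"
    by (subst nn_integral_gagliardo_measure) (simp_all add: increment_def)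
  also have "\<dots> \<le> (\<integral>\<^sup>+x. \<integral>\<^sup>+y. ?g x y + (ennreal (f x) + ennreal (f y)) * ?k (x - y) \<partial>lborel \<partial>lborel)"
  proof (intro nn_integral_mono)
    fix x y :: 'a
    show "ennreal (kern a (x - y)) * ennreal ((u x - u y)\<^sup>2) \<le> ?g x y + (ennreal (f x) + ennreal (f y)) * ?k (x - y)"
    proof (cases "x \<in> \<Omega> \<and> y \<in> \<Omega>")
      case False
      have "kern a (x - y) * (u x - u y)\<^sup>2 \<le> kern a (x - y) * ((f x + f y) * min 1 ((norm (x - y))\<^sup>2))"
        by (intro mult_left_mono dom False) simp
      then have "ennreal (kern a (x - y) * (u x - u y)\<^sup>2) \<le> ennreal ((f x + f y) * (min 1 ((norm (x - y))\<^sup>2) * kern a (x - y)))"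
        by (intro ennreal_leI) (simp add: mult_ac)
      also have "\<dots> = (ennreal (f x) + ennreal (f y)) * ?k (x - y)"
        using f0 by (subst ennreal_mult) (auto simp: ennreal_plus)
      finally show ?thesis by (simp add: ennreal_mult add_increasing)
    qed simp
  qed
  also have "\<dots> = (\<integral>\<^sup>+x. \<integral>\<^sup>+y. ?g x y \<partial>lborel \<partial>lborel)
      + (\<integral>\<^sup>+x. \<integral>\<^sup>+y. (ennreal (f x) + ennreal (f y)) * ?k (x - y) \<partial>lborel \<partial>lborel)"
    by (simp add: nn_integral_add)
  also have "(\<integral>\<^sup>+x. \<integral>\<^sup>+y. ?g x y \<partial>lborel \<partial>lborel) = (\<integral>\<^sup>+z. ennreal ((increment u z)\<^sup>2) \<partial>gagliardo_measure a \<Omega>)"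
    by (subst nn_integral_gagliardo_measure) (simp_all add: increment_def)
  also have "(\<integral>\<^sup>+x. \<integral>\<^sup>+y. (ennreal (f x) + ennreal (f y)) * ?k (x - y) \<partial>lborel \<partial>lborel)
     = 2 * (\<integral>\<^sup>+x. ennreal (f x) \<partial>lborel) * (\<integral>\<^sup>+z. ?k z \<partial>lborel)"
    by (rule nn_integral_symmetrized_convolution) (simp_all add: kern_def)
  also have "(\<integral>\<^sup>+z. ennreal ((increment u z)\<^sup>2) \<partial>gagliardo_measure a \<Omega>) + \<dots> < \<infinity>"
    using E f nn_integral_levy_kernel_finite[OF a, where 'a='a]
    by (auto simp: ennreal_mult_less_top ennreal_add_eq_top less_top[symmetric] ennreal_mult_eq_top_iff)
  finally show ?thesis .
qed

lemma lipschitz_bounded_if_bounded_support: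
  fixes u :: "'a::euclidean_space \<Rightarrow> real"
  assumes L: "L-lipschitz_on UNIV u" and S: "bounded S" and u: "\<And>x. x \<notin> S \<Longrightarrow> u x = 0"
  shows "\<exists>M. \<forall>x. \<bar>u x\<bar> \<le> M"
proof -
  obtain R where R: "R > 0" "\<And>x. x \<in> S \<Longrightarrow> norm x \<le> R" using S bounded_pos by metis
  obtain b :: 'a where b: "b \<in> Basis" using nonempty_Basis by blast
  define p where "p = (R + 1) *\<^sub>R b"
  have np: "norm p = R + 1" using b R by (simp add: p_def)
  then have up: "u p = 0" using R by (intro u) force
  have "\<bar>u x\<bar> \<le> L * (2 * R + 1)" for x
  proof (cases "x \<in> S")
    case True
    have "\<bar>u x\<bar> \<le> L * dist x p" using lipschitz_onD[OF L, of x p] up by (simp add: dist_real_def)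
    also have "\<dots> \<le> L * (2 * R + 1)"
      using norm_triangle_ineq4[of x p] R(2)[OF True] np lipschitz_on_nonneg[OF L]
      by (intro mult_left_mono) (auto simp: dist_norm)
    finally show ?thesis .
  next
    case False
    then show ?thesis using u R lipschitz_on_nonneg[OF L] by simp
  qed
  then show ?thesis by blast
qed

lemma lipschitz_borel_measurable:
  fixes u :: "'a::euclidean_space \<Rightarrow> real"
  assumes "L-lipschitz_on UNIV u" shows "u \<in> borel_measurable borel"
  using lipschitz_on_continuous_on[OF assms] by (rule borel_measurable_continuous_onI)

lemma lipschitz_in_energy_space:
  fixes u :: "'a::euclidean_space \<Rightarrow> real"
  assumes a: "0 < a" "a < 1"
    and L: "L-lipschitz_on UNIV u" and S: "bounded S" and u: "\<And>x. x \<notin> S \<Longrightarrow> u x = 0"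
  shows "u \<in> energy_space a UNIV S"
proof -
  note [measurable] = lipschitz_borel_measurable[OF L]
  obtain M where M: "\<And>x. \<bar>u x\<bar> \<le> M" using lipschitz_bounded_if_bounded_support[OF L S u] by auto
  define K where "K = max (L\<^sup>2) ((2 * M)\<^sup>2)"
  let ?B = "closure S"
  define f where "f x = K * indicator ?B x" for x
  have [measurable]: "?B \<in> sets borel" by simp
  have K: "K \<ge> 0" by (simp add: K_def le_max_iff_disj)
  have "(\<integral>\<^sup>+z. ennreal ((increment u z)\<^sup>2) \<partial>gagliardo_measure a UNIV) < \<infinity>"
  proof (rule finite_energy_if_dominated[OF a, where f = f and \<Omega> = "{}"])
    show "f \<in> borel_measurable borel" unfolding f_def[abs_def] by measurable
    have "emeasure lborel ?B < \<infinity>" using S by (intro emeasure_bounded_finite) (simp add: bounded_closure)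
    then show "(\<integral>\<^sup>+x. ennreal (f x) \<partial>lborel) < \<infinity>"
      using K by (simp add: f_def ennreal_mult nn_integral_cmult ennreal_indicator ennreal_mult_less_top)
    show "(\<integral>\<^sup>+z. ennreal ((increment u z)\<^sup>2) \<partial>gagliardo_measure a {}) < \<infinity>"
      by (subst nn_integral_gagliardo_measure) simp_all
    fix x y
    have *: "(u x - u y)\<^sup>2 \<le> K * min 1 ((norm (x - y))\<^sup>2)"
    proof -
      have "\<bar>u x - u y\<bar> \<le> L * norm (x - y)"
        using lipschitz_onD[OF L, of x y] by (simp add: dist_norm)
      then have "(u x - u y)\<^sup>2 \<le> L\<^sup>2 * (norm (x - y))\<^sup>2"
        by (metis abs_ge_zero power2_abs power_mono power_mult_distrib)
      also have "\<dots> \<le> K * (norm (x - y))\<^sup>2" unfolding K_def by (intro mult_right_mono) auto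
      finally have 1: "(u x - u y)\<^sup>2 \<le> K * (norm (x - y))\<^sup>2" .
      have "\<bar>u x - u y\<bar> \<le> 2 * M" using M[of x] M[of y] by linarith
      then have "(u x - u y)\<^sup>2 \<le> (2 * M)\<^sup>2" by (metis abs_ge_zero power2_abs power_mono)
      then have "(u x - u y)\<^sup>2 \<le> K" unfolding K_def by simp
      then show ?thesis using 1 by (simp add: min_def)
    qed
    show "(u x - u y)\<^sup>2 \<le> (f x + f y) * min 1 ((norm (x - y))\<^sup>2)"
    proof (cases "x \<in> S \<or> y \<in> S")
      case True
      then have "K \<le> f x + f y"
        using K closure_subset[of S] unfolding f_def indicator_def by auto
      then have "K * min 1 ((norm (x - y))\<^sup>2) \<le> (f x + f y) * min 1 ((norm (x - y))\<^sup>2)"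
        by (intro mult_right_mono) auto
      with * show ?thesis by (rule order_trans)
    next
      case False
      then have "(u x - u y)\<^sup>2 = 0" using u by simp
      moreover have "0 \<le> (f x + f y) * min 1 ((norm (x - y))\<^sup>2)"
        using K by (intro mult_nonneg_nonneg) (auto simp: f_def)
      ultimately show ?thesis by linarith
    qed
  qed (use K in \<open>auto simp: f_def\<close>)
  then show ?thesis using u by (intro energy_spaceI) auto
qed

text \<open>A function in the space vanishes on the ball, so the pairs \<open>(x, y)\<close> with \<open>y\<close> in the ball alone
  contribute a positive multiple of \<open>(w x)\<^sup>2\<close> to the energy, the kernel being bounded below on a
  bounded set.\<close>

lemma poincare_inequality:
  fixes \<Omega> U :: "'a::euclidean_space set"
  assumes [measurable]: "\<Omega> \<in> sets borel" and bd: "bounded \<Omega>" and "U \<subseteq> \<Omega>" and "0 < a"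
    and r: "r > 0" "ball b r \<subseteq> \<Omega> - U"
  shows "\<exists>P>0. \<forall>w\<in>energy_space a \<Omega> U. integrable lborel (\<lambda>x. (w x)\<^sup>2) \<and>
           (LINT x|lborel. (w x)\<^sup>2) \<le> P * energy a \<Omega> w w"
proof -
  let ?B = "ball b r" and ?s = "real DIM('a) + 2 * a"
  obtain R where R: "R > 0" "\<And>x. x \<in> \<Omega> \<Longrightarrow> norm x \<le> R" using bd bounded_pos by metis
  define c where "c = 1 / (2 * R) powr ?s"
  define m where "m = measure lborel ?B"
  have em: "emeasure lborel ?B = ennreal m" unfolding m_def
    using emeasure_bounded_finite[of ?B] by (intro emeasure_eq_ennreal_measure) simp
  have m: "m > 0" unfolding m_def using content_ball_pos[OF r(1)] by simp
  have c: "c > 0" using R by (simp add: c_def)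
  have [measurable]: "?B \<in> sets borel" by simp
  show ?thesis
  proof (intro exI[of _ "1 / (c * m)"] conjI ballI)
    fix w assume w: "w \<in> energy_space a \<Omega> U"
    note [measurable] = energy_space_borel[OF w]
    have w0: "\<And>x. x \<notin> U \<Longrightarrow> w x = 0" using w by (simp add: energy_space_def)
    have "(\<integral>\<^sup>+x. ennreal ((w x)\<^sup>2) \<partial>lborel) * ennreal (c * m)
      = (\<integral>\<^sup>+x. \<integral>\<^sup>+y. ennreal ((w x)\<^sup>2) * (ennreal c * indicator ?B y) \<partial>lborel \<partial>lborel)"
      using c m em by (simp add: nn_integral_cmult nn_integral_multc ennreal_mult)
    also have "\<dots> \<le> (\<integral>\<^sup>+x. \<integral>\<^sup>+y. ennreal (indicator \<Omega> x * indicator \<Omega> y * kern a (x - y)) * ennreal ((w x - w y)\<^sup>2) \<partial>lborel \<partial>lborel)"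
    proof (intro nn_integral_mono)
      fix x y :: 'a
      show "ennreal ((w x)\<^sup>2) * (ennreal c * indicator ?B y)
         \<le> ennreal (indicator \<Omega> x * indicator \<Omega> y * kern a (x - y)) * ennreal ((w x - w y)\<^sup>2)"
      proof (cases "x \<in> U \<and> y \<in> ?B")
        case True
        then have xy: "x \<in> \<Omega>" "y \<in> \<Omega>" "y \<notin> U" "x \<noteq> y" using assms by auto
        have "norm (x - y) \<le> 2 * R"
          using norm_triangle_ineq4[of x y] R(2)[OF xy(1)] R(2)[OF xy(2)] by linarith
        then have "c \<le> kern a (x - y)" unfolding c_def kern_def
          using xy \<open>0 < a\<close> R(1) by (intro divide_left_mono powr_mono2 mult_pos_pos) auto
        then show ?thesis using xy True w0[of y] c
          by (auto simp: mult.commute intro!: mult_mono ennreal_leI)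
      qed (use w0 in auto)
    qed
    also have "\<dots> = (\<integral>\<^sup>+z. ennreal ((increment w z)\<^sup>2) \<partial>gagliardo_measure a \<Omega>)"
      by (subst nn_integral_gagliardo_measure) (simp_all add: increment_def)
    also have "\<dots> = ennreal (energy a \<Omega> w w)" by (rule nn_integral_energy[OF w])
    finally have le: "(\<integral>\<^sup>+x. ennreal ((w x)\<^sup>2) \<partial>lborel) * ennreal (c * m) \<le> ennreal (energy a \<Omega> w w)" .
    have "(\<integral>\<^sup>+x. ennreal ((w x)\<^sup>2) \<partial>lborel) < \<infinity>"
      using le c m by (cases "(\<integral>\<^sup>+x. ennreal ((w x)\<^sup>2) \<partial>lborel) = \<infinity>")
        (auto simp: ennreal_top_mult less_top top_unique)
    then show int: "integrable lborel (\<lambda>x. (w x)\<^sup>2)" by (intro integrableI_nonneg) auto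
    have nn: "(\<integral>\<^sup>+x. ennreal ((w x)\<^sup>2) \<partial>lborel) = ennreal (LINT x|lborel. (w x)\<^sup>2)"
      using int by (intro nn_integral_eq_integral) auto
    have "ennreal ((LINT x|lborel. (w x)\<^sup>2) * (c * m)) \<le> ennreal (energy a \<Omega> w w)"
      using le c m unfolding nn by (subst ennreal_mult'') auto
    then have "(LINT x|lborel. (w x)\<^sup>2) * (c * m) \<le> energy a \<Omega> w w"
      using energy_nonneg[of a \<Omega> w] by (simp add: ennreal_le_iff)
    then show "(LINT x|lborel. (w x)\<^sup>2) \<le> 1 / (c * m) * energy a \<Omega> w w"
      using c m by (simp add: field_simps)
  qed (use c m in simp)
qed

text \<open>For \<open>x \<in> U\<close> and \<open>y \<notin> \<Omega>\<close> the increment is \<open>w x\<close> and \<open>\<bar>x - y\<bar> \<ge> \<delta>\<close>, so the missing pairs cost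
  at most a multiple of the \<open>L\<^sup>2\<close> norm.\<close>

lemma energy_space_extend:
  fixes \<Omega> U :: "'a::euclidean_space set"
  assumes a: "0 < a" "a < 1" and [measurable]: "\<Omega> \<in> sets borel"
    and sep: "\<delta> > 0" "\<And>x y. x \<in> U \<Longrightarrow> y \<notin> \<Omega> \<Longrightarrow> dist x y \<ge> \<delta>"
    and w: "w \<in> energy_space a \<Omega> U" and int: "integrable lborel (\<lambda>x. (w x)\<^sup>2)"
  shows "w \<in> energy_space a UNIV U"
proof -
  note [measurable] = energy_space_borel[OF w]
  have w0: "\<And>x. x \<notin> U \<Longrightarrow> w x = 0" using w by (simp add: energy_space_def)
  define q where "q = min 1 (\<delta>\<^sup>2)"
  have q: "q > 0" using sep by (simp add: q_def)
  have "(\<integral>\<^sup>+z. ennreal ((increment w z)\<^sup>2) \<partial>gagliardo_measure a UNIV) < \<infinity>"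
  proof (rule finite_energy_if_dominated[OF a, where f = "\<lambda>x. (w x)\<^sup>2 / q" and \<Omega> = \<Omega>])
    have "integrable lborel (\<lambda>x. (w x)\<^sup>2 / q)" using int by simp
    then show "(\<integral>\<^sup>+x. ennreal ((w x)\<^sup>2 / q) \<partial>lborel) < \<infinity>"
      using q by (subst nn_integral_eq_integral) auto
    show "(\<integral>\<^sup>+z. ennreal ((increment w z)\<^sup>2) \<partial>gagliardo_measure a \<Omega>) < \<infinity>"
      by (subst nn_integral_energy[OF w]) simp
    fix x y assume xy: "\<not> (x \<in> \<Omega> \<and> y \<in> \<Omega>)"
    have U: "U \<subseteq> \<Omega>" using sep by (metis dist_self linorder_not_less subsetI)
    show "(w x - w y)\<^sup>2 \<le> ((w x)\<^sup>2 / q + (w y)\<^sup>2 / q) * min 1 ((norm (x - y))\<^sup>2)"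
    proof (cases "x \<in> U \<or> y \<in> U")
      case True
      then have "\<delta> \<le> norm (x - y)" using xy U sep(2)[of x y] sep(2)[of y x]
        by (auto simp: dist_norm norm_minus_commute)
      then have "\<delta>\<^sup>2 \<le> (norm (x - y))\<^sup>2" using sep by (intro power_mono) auto
      then have q': "q \<le> min 1 ((norm (x - y))\<^sup>2)" unfolding q_def by linarith
      have "w x = 0 \<or> w y = 0" using True xy U w0 by blast
      then have "(w x - w y)\<^sup>2 = ((w x)\<^sup>2 / q + (w y)\<^sup>2 / q) * q" using q by (auto simp: field_simps)
      also have "\<dots> \<le> ((w x)\<^sup>2 / q + (w y)\<^sup>2 / q) * min 1 ((norm (x - y))\<^sup>2)"
        using q q' by (intro mult_left_mono) auto
      finally show ?thesis .
    qed (simp add: w0)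
  qed (use q in auto)
  then show ?thesis using w0 by (intro energy_spaceI) auto
qed

section \<open>Completeness and existence of weak solutions\<close>

text \<open>On a set of finite measure a geometric rate in \<open>L\<^sup>2\<close> gives one in \<open>L\<^sup>1\<close>, and then the
  increments are summable almost everywhere by monotone convergence.\<close>

lemma AE_convergent_if_L2_increments_summable:
  fixes w :: "nat \<Rightarrow> 'a::euclidean_space \<Rightarrow> real"
  assumes [measurable]: "\<And>k. w k \<in> borel_measurable borel" "U \<in> sets borel"
    and U: "emeasure lborel U < \<infinity>" and w0: "\<And>k x. x \<notin> U \<Longrightarrow> w k x = 0"
    and int: "\<And>k. integrable lborel (\<lambda>x. (w (Suc k) x - w k x)\<^sup>2)"
    and le: "\<And>k. (LINT x|lborel. (w (Suc k) x - w k x)\<^sup>2) \<le> K * (1/8)^k"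
  shows "AE x in lborel. convergent (\<lambda>k. w k x)"
proof -
  define d where "d k x = w (Suc k) x - w k x" for k x
  have [measurable]: "d k \<in> borel_measurable borel" for k unfolding d_def[abs_def] by measurable
  define m where "m = measure lborel U"
  have iU: "integrable lborel (indicator U :: 'a \<Rightarrow> real)" using U by (simp add: integrable_indicator_iff)
  have mU: "(LINT x|lborel. indicator U x) = m" by (simp add: m_def)
  have bound: "(\<integral>\<^sup>+x. ennreal \<bar>d k x\<bar> \<partial>lborel) \<le> ennreal ((K + m) * (1/2)^k)" for k
  proof -
    have pt: "\<bar>d k x\<bar> \<le> 2^k * (d k x)\<^sup>2 + (1/2)^k * indicator U x" for x
    proof (cases "x \<in> U")
      case True
      \<comment> \<open>The weight \<open>2\<^sup>k\<close> in the arithmetic-geometric mean inequality keeps both terms summable in \<open>k\<close>.\<close>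
      define t where "t = (2::real)^k"
      have t: "t > 0" "(1/2)^k = 1/t" by (simp_all add: t_def power_one_over)
      have "0 \<le> (t * \<bar>d k x\<bar> - 1)\<^sup>2" by simp
      then have "t * (2 * \<bar>d k x\<bar>) \<le> t * (t * (d k x)\<^sup>2 + 1/t)" using t
        by (simp add: power2_eq_square algebra_simps)
      then have "2 * \<bar>d k x\<bar> \<le> t * (d k x)\<^sup>2 + 1/t" using t(1) by simp
      then show ?thesis using True t(2) unfolding t_def by (simp)
    qed (simp add: d_def w0)
    have int': "integrable lborel (\<lambda>x. 2^k * (d k x)\<^sup>2 + (1/2)^k * indicator U x)"
      using int iU unfolding d_def by (intro Bochner_Integration.integrable_add integrable_mult_right) auto
    have "(\<integral>\<^sup>+x. ennreal \<bar>d k x\<bar> \<partial>lborel) \<le> (\<integral>\<^sup>+x. ennreal (2^k * (d k x)\<^sup>2 + (1/2)^k * indicator U x) \<partial>lborel)"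
      by (intro nn_integral_mono ennreal_leI pt)
    also have "\<dots> = ennreal (LINT x|lborel. 2^k * (d k x)\<^sup>2 + (1/2)^k * indicator U x)"
      using int' by (intro nn_integral_eq_integral) auto
    also have "(LINT x|lborel. 2^k * (d k x)\<^sup>2 + (1/2)^k * indicator U x)
        = 2^k * (LINT x|lborel. (d k x)\<^sup>2) + (1/2)^k * m"
      using int iU unfolding d_def
      by (subst Bochner_Integration.integral_add) (auto simp: m_def)
    also have "\<dots> \<le> 2^k * (K * (1/8)^k) + (1/2)^k * m"
      using le[of k] unfolding d_def by (intro add_mono mult_left_mono) auto
    also have "\<dots> = K * (1/4)^k + (1/2)^k * m"
      by (simp add: power_mult_distrib[symmetric])
    also have "\<dots> \<le> (K + m) * (1/2)^k"
    proof -
      have "0 \<le> (LINT x|lborel. (w (Suc 0) x - w 0 x)\<^sup>2)" by (intro integral_nonneg_AE) simp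
      also have "\<dots> \<le> K" using le[of 0] by simp
      finally have "0 \<le> K" .
      moreover have "(1/4)^k \<le> (1/2::real)^k" by (intro power_mono) auto
      ultimately have "K * (1/4)^k \<le> K * (1/2)^k" by (intro mult_left_mono)
      then show ?thesis by (simp add: algebra_simps)
    qed
    finally show ?thesis by (simp add: ennreal_leI)
  qed
  have "(\<integral>\<^sup>+x. (\<Sum>k. ennreal \<bar>d k x\<bar>) \<partial>lborel) = (\<Sum>k. \<integral>\<^sup>+x. ennreal \<bar>d k x\<bar> \<partial>lborel)"
    by (intro nn_integral_suminf) measurable
  also have "\<dots> \<le> (\<Sum>k. ennreal ((K + m) * (1/2)^k))" by (intro suminf_le bound) auto
  also have "\<dots> < \<infinity>"
  proof -
    have "0 \<le> (LINT x|lborel. (w (Suc 0) x - w 0 x)\<^sup>2)" by (intro integral_nonneg_AE) simp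
    also have "\<dots> \<le> K" using le[of 0] by simp
    finally have "0 \<le> K" .
    then have "0 \<le> K + m" by (simp add: m_def)
    moreover have "summable (\<lambda>k. (K + m) * (1/2)^k)" by (intro summable_mult) simp
    ultimately show ?thesis by (subst suminf_ennreal2) auto
  qed
  finally have "(\<integral>\<^sup>+x. (\<Sum>k. ennreal \<bar>d k x\<bar>) \<partial>lborel) \<noteq> \<infinity>" by simp
  then have "AE x in lborel. (\<Sum>k. ennreal \<bar>d k x\<bar>) \<noteq> \<infinity>"
    by (intro nn_integral_PInf_AE) measurable
  then show ?thesis
  proof eventually_elim
    fix x assume "(\<Sum>k. ennreal \<bar>d k x\<bar>) \<noteq> \<infinity>"
    then have "summable (\<lambda>k. \<bar>d k x\<bar>)" by (intro summable_suminf_not_top) auto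
    then have "summable (\<lambda>k. d k x)" by (rule summable_rabs_cancel)
    then have "convergent (\<lambda>n. (\<Sum>k<n. d k x) + w 0 x)"
      unfolding summable_iff_convergent by (intro convergent_add convergent_const)
    moreover have "(\<Sum>k<n. d k x) + w 0 x = w n x" for n
      unfolding d_def by (subst sum_lessThan_telescope) simp
    ultimately show "convergent (\<lambda>k. w k x)" by simp
  qed
qed

text \<open>If \<open>N\<close> is a null set, so are \<open>N \<times> UNIV\<close> and \<open>UNIV \<times> N\<close>.\<close>

lemma AE_gagliardo_measure:
  assumes [measurable]: "\<Omega> \<in> sets borel" and "AE x in lborel. Q x"
  shows "AE z in gagliardo_measure a \<Omega>. Q (fst z) \<and> Q (snd z)"
proof -
  obtain N where N: "N \<in> null_sets lborel" "{x. \<not> Q x} \<subseteq> N"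
    using assms(2) unfolding eventually_ae_filter by auto
  have [measurable]: "N \<in> sets borel" using N by auto
  have notin: "AE x in lborel. x \<notin> N" using N by (rule_tac AE_not_in)
  have "AE z in lborel \<Otimes>\<^sub>M lborel. fst z \<notin> N \<and> snd z \<notin> N"
  proof (rule lborel_pair.AE_pair_measure)
    have "Measurable.pred (lborel \<Otimes>\<^sub>M lborel) (\<lambda>x. fst x \<notin> N \<and> snd x \<notin> N)" by measurable
    then show "{x \<in> space (lborel \<Otimes>\<^sub>M lborel). fst x \<notin> N \<and> snd x \<notin> N} \<in> sets (lborel \<Otimes>\<^sub>M lborel)"
      by (rule predE)
    show "AE x in lborel. AE y in lborel. fst (x, y) \<notin> N \<and> snd (x, y) \<notin> N"
      using notin
    proof eventually_elim
      fix x assume "x \<notin> N"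
      then show "AE y in lborel. fst (x, y) \<notin> N \<and> snd (x, y) \<notin> N" using notin by simp
    qed
  qed
  then have "AE z in lborel \<Otimes>\<^sub>M lborel. Q (fst z) \<and> Q (snd z)"
    by (rule AE_mp) (use N in auto)
  then show ?thesis unfolding gagliardo_measure_def
    by (subst AE_density) auto
qed

text \<open>The pointwise limit is the limit in energy: the energy is lower semicontinuous under
  almost everywhere convergence by Fatou's lemma.\<close>

lemma energy_space_complete:
  fixes w :: "nat \<Rightarrow> 'a::euclidean_space \<Rightarrow> real"
  assumes [measurable]: "\<Omega> \<in> sets borel" "U \<in> sets borel" and U: "emeasure lborel U < \<infinity>"
    and P: "P \<ge> 0" "\<And>w. w \<in> energy_space a \<Omega> U \<Longrightarrow> integrable lborel (\<lambda>x. (w x)\<^sup>2) \<and>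
             (LINT x|lborel. (w x)\<^sup>2) \<le> P * energy a \<Omega> w w"
    and w: "\<And>k. w k \<in> energy_space a \<Omega> U"
    and cauchy: "\<And>j k. j \<le> k \<Longrightarrow> energy a \<Omega> (\<lambda>x. w k x - w j x) (\<lambda>x. w k x - w j x) \<le> K * (1/8)^j"
  shows "\<exists>u\<in>energy_space a \<Omega> U. \<forall>j. energy a \<Omega> (\<lambda>x. u x - w j x) (\<lambda>x. u x - w j x) \<le> K * (1/8)^j"
proof -
  note [measurable] = w[THEN energy_space_borel]
  have w0: "\<And>k x. x \<notin> U \<Longrightarrow> w k x = 0" using w by (simp add: energy_space_def)
  have conv: "AE x in lborel. convergent (\<lambda>k. w k x)"
  proof (rule AE_convergent_if_L2_increments_summable[OF _ _ U w0])
    fix k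
    have d: "(\<lambda>x. w (Suc k) x - w k x) \<in> energy_space a \<Omega> U" by (intro energy_space_diff w)
    show "integrable lborel (\<lambda>x. (w (Suc k) x - w k x)\<^sup>2)" using P(2)[OF d] by blast
    have "(LINT x|lborel. (w (Suc k) x - w k x)\<^sup>2) \<le> P * (K * (1/8)^k)"
      using P(2)[OF d] mult_left_mono[OF cauchy[of k "Suc k"] P(1)] by simp
    then show "(LINT x|lborel. (w (Suc k) x - w k x)\<^sup>2) \<le> (P * K) * (1/8)^k" by (simp add: mult_ac)
  qed auto
  \<comment> \<open>Where the sequence diverges, \<open>lim\<close> has an unspecified value; this happens only on a null subset of \<open>U\<close>.\<close>
  define u where "u x = lim (\<lambda>k. w k x)" for x
  have [measurable]: "u \<in> borel_measurable borel" unfolding u_def[abs_def] by measurable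
  have u0: "u x = 0" if "x \<notin> U" for x using w0[OF that] by (simp add: u_def)
  have AE: "AE z in gagliardo_measure a \<Omega>. convergent (\<lambda>k. w k (fst z)) \<and> convergent (\<lambda>k. w k (snd z))"
    by (rule AE_gagliardo_measure[OF _ conv]) simp
  have fatou: "(\<integral>\<^sup>+z. ennreal ((increment (\<lambda>x. u x - w j x) z)\<^sup>2) \<partial>gagliardo_measure a \<Omega>) \<le> ennreal (K * (1/8)^j)" for j
  proof -
    let ?f = "\<lambda>k z. ennreal ((increment (\<lambda>x. w (k + j) x - w j x) z)\<^sup>2)"
    have "(\<integral>\<^sup>+z. ennreal ((increment (\<lambda>x. u x - w j x) z)\<^sup>2) \<partial>gagliardo_measure a \<Omega>)
       = (\<integral>\<^sup>+z. liminf (\<lambda>k. ?f k z) \<partial>gagliardo_measure a \<Omega>)"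
    proof (rule nn_integral_cong_AE, use AE in eventually_elim)
      fix z assume c: "convergent (\<lambda>k. w k (fst z)) \<and> convergent (\<lambda>k. w k (snd z))"
      have "(\<lambda>k. w (k + j) (fst z)) \<longlonglongrightarrow> u (fst z)" "(\<lambda>k. w (k + j) (snd z)) \<longlonglongrightarrow> u (snd z)"
        using c unfolding u_def by (auto intro!: LIMSEQ_ignore_initial_segment simp: convergent_LIMSEQ_iff)
      then have "(\<lambda>k. ?f k z) \<longlonglongrightarrow> ennreal ((increment (\<lambda>x. u x - w j x) z)\<^sup>2)"
        unfolding increment_def split_beta by (intro tendsto_intros)
      then show "ennreal ((increment (\<lambda>x. u x - w j x) z)\<^sup>2) = liminf (\<lambda>k. ?f k z)"
        by (intro lim_imp_Liminf[symmetric]) auto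
    qed
    also have "\<dots> \<le> liminf (\<lambda>k. \<integral>\<^sup>+z. ?f k z \<partial>gagliardo_measure a \<Omega>)"
      by (rule nn_integral_liminf) measurable
    also have "\<dots> \<le> liminf (\<lambda>k::nat. ennreal (K * (1/8)^j))"
    proof (intro Liminf_mono always_eventually allI)
      fix k
      show "(\<integral>\<^sup>+z. ?f k z \<partial>gagliardo_measure a \<Omega>) \<le> ennreal (K * (1/8)^j)"
        by (subst nn_integral_energy[OF energy_space_diff[OF w w]]) (intro ennreal_leI cauchy, simp)
    qed
    also have "\<dots> = ennreal (K * (1/8)^j)" by (simp add: Liminf_const)
    finally show ?thesis .
  qed
  have diff: "(\<lambda>x. u x - w j x) \<in> energy_space a \<Omega> U" for j
  proof (rule energy_spaceI)
    show "(\<integral>\<^sup>+z. ennreal ((increment (\<lambda>x. u x - w j x) z)\<^sup>2) \<partial>gagliardo_measure a \<Omega>) < \<infinity>"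
      using fatou[of j] by (rule le_less_trans) simp
  qed (auto simp: u0 w0)
  have "u \<in> energy_space a \<Omega> U" using energy_space_linear[OF diff w, of 1 0 1 0] by simp
  moreover have "energy a \<Omega> (\<lambda>x. u x - w j x) (\<lambda>x. u x - w j x) \<le> K * (1/8)^j" for j
  proof -
    have "0 \<le> energy a \<Omega> (\<lambda>x. w j x - w j x) (\<lambda>x. w j x - w j x)" by (rule energy_nonneg)
    also have "\<dots> \<le> K * (1/8)^j" by (rule cauchy) simp
    finally show ?thesis using fatou[of j] unfolding nn_integral_energy[OF diff] by simp
  qed
  ultimately show ?thesis by blast
qed

text \<open>The case \<open>\<kappa> = 0\<close> is the problem with exterior datum \<open>\<phi>\<close>; the case \<open>\<phi> = 0\<close> is the resolvent
  equation with datum \<open>\<psi>\<close>. The lower bound of the functional is that of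
  \<open>E(u + \<phi>, u + \<phi>) + \<kappa> \<parallel>u - \<psi>\<parallel>\<^sup>2 \<ge> 0\<close>.\<close>

lemma variational_solution_exists:
  assumes \<Omega> [measurable]: "\<Omega> \<in> sets borel" "U \<in> sets borel" and U: "emeasure lborel U < \<infinity>"
    and P: "P \<ge> 0" "\<And>w. w \<in> energy_space a \<Omega> U \<Longrightarrow> integrable lborel (\<lambda>x. (w x)\<^sup>2) \<and>
             (LINT x|lborel. (w x)\<^sup>2) \<le> P * energy a \<Omega> w w"
    and "\<kappa> \<ge> 0" and \<phi>: "\<phi> \<in> energy_space a \<Omega> UNIV" and \<psi>: "\<psi> \<in> energy_space a \<Omega> U"
  shows "\<exists>u\<in>energy_space a \<Omega> U. \<forall>h\<in>energy_space a \<Omega> U.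
    energy a \<Omega> u h + \<kappa> * (LINT x|lborel. u x * h x) = \<kappa> * (LINT x|lborel. \<psi> x * h x) - energy a \<Omega> \<phi> h"
proof -
  let ?V = "energy_space a \<Omega> U"
  have V': "u \<in> energy_space a \<Omega> UNIV" if "u \<in> ?V" for u using that energy_space_mono by blast
  have int: "integrable lborel (\<lambda>x. u x * v x)" if "u \<in> ?V" "v \<in> ?V" for u v
    using that P(2) by (intro integrable_mult_of_squares) (auto dest: energy_space_borel)
  define ip where "ip u v = (LINT x|lborel. u x * v x)" for u v :: "'a \<Rightarrow> real"
  have ip_lin: "ip (\<lambda>x. c * u x + d * v x) h = c * ip u h + d * ip v h"
    if "u \<in> ?V" "v \<in> ?V" "h \<in> ?V" for u v h c d
  proof -
    have "(\<lambda>x. (c * u x + d * v x) * h x) = (\<lambda>x. c * (u x * h x) + d * (v x * h x))"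
      by (simp add: algebra_simps)
    then show ?thesis unfolding ip_def using that by (simp add: int)
  qed
  have ip_commute: "ip u v = ip v u" for u v by (simp add: ip_def mult.commute)
  have ip_nonneg: "ip u u \<ge> 0" for u unfolding ip_def by (intro integral_nonneg_AE) simp
  let ?B = "\<lambda>u h. energy a \<Omega> u h + \<kappa> * ip u h"
  let ?l = "\<lambda>h. \<kappa> * ip \<psi> h - energy a \<Omega> \<phi> h"
  have "\<exists>u\<in>?V. \<forall>h\<in>?V. ?B u h = ?l h"
  proof (rule riesz_representation_of_complete_form[where M = "- energy a \<Omega> \<phi> \<phi> - \<kappa> * ip \<psi> \<psi>"])
    show "(\<lambda>_. 0) \<in> ?V" by (rule energy_space_zero)
    show "(\<lambda>x. c * u x + d * v x) \<in> ?V" if "u \<in> ?V" "v \<in> ?V" for u v c d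
      using that by (rule energy_space_linear)
    show "?B u v = ?B v u" for u v
      unfolding energy_commute[of _ _ u v] ip_commute[of u v] ..
    show "?B (\<lambda>x. c * u x + d * v x) h = c * ?B u h + d * ?B v h"
      if "u \<in> ?V" "v \<in> ?V" "h \<in> ?V" for u v h c d
      unfolding energy_linear[OF that] ip_lin[OF that] by (simp add: algebra_simps)
    show "?B u u \<ge> 0" for u
      by (intro add_nonneg_nonneg mult_nonneg_nonneg energy_nonneg ip_nonneg \<open>\<kappa> \<ge> 0\<close>)
    show "?l (\<lambda>x. c * u x + d * v x) = c * ?l u + d * ?l v" if "u \<in> ?V" "v \<in> ?V" for u v c d
      unfolding ip_commute[of \<psi>] energy_commute[of a \<Omega> \<phi>] energy_linear[OF that \<phi>] ip_lin[OF that \<psi>]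
      by (simp add: algebra_simps)
  next
    fix u assume u: "u \<in> ?V"
    let ?s = "\<lambda>x. 1 * u x + 1 * \<phi> x" and ?t = "\<lambda>x. 1 * u x + (-1) * \<psi> x"
    have s: "?s \<in> energy_space a \<Omega> UNIV" by (rule energy_space_linear[OF V'[OF u] \<phi>])
    have t: "?t \<in> ?V" by (rule energy_space_linear[OF u \<psi>])
    have "0 \<le> energy a \<Omega> ?s ?s" by (rule energy_nonneg)
    also have "\<dots> = energy a \<Omega> u u + 2 * energy a \<Omega> \<phi> u + energy a \<Omega> \<phi> \<phi>"
      unfolding energy_linear[OF V'[OF u] \<phi> s] energy_commute[of a \<Omega> u ?s] energy_commute[of a \<Omega> \<phi> ?s]
        energy_linear[OF V'[OF u] \<phi> V'[OF u]] energy_linear[OF V'[OF u] \<phi> \<phi>] energy_commute[of a \<Omega> u \<phi>]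
      by simp
    finally have 1: "0 \<le> energy a \<Omega> u u + 2 * energy a \<Omega> \<phi> u + energy a \<Omega> \<phi> \<phi>" .
    have "0 \<le> ip ?t ?t" by (rule ip_nonneg)
    also have "\<dots> = ip u u - 2 * ip \<psi> u + ip \<psi> \<psi>"
      unfolding ip_lin[OF u \<psi> t] ip_commute[of u ?t] ip_commute[of \<psi> ?t]
        ip_lin[OF u \<psi> u] ip_lin[OF u \<psi> \<psi>] ip_commute[of u \<psi>]
      by simp
    finally have "0 \<le> \<kappa> * (ip u u - 2 * ip \<psi> u + ip \<psi> \<psi>)" using \<open>\<kappa> \<ge> 0\<close> by simp
    then show "- energy a \<Omega> \<phi> \<phi> - \<kappa> * ip \<psi> \<psi> \<le> ?B u u - 2 * ?l u" using 1
      by (simp add: algebra_simps)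
  next
    fix w :: "nat \<Rightarrow> 'a \<Rightarrow> real"
    let ?d = "\<lambda>u v x. u x - v x"
    assume w: "\<And>k. w k \<in> ?V" and
      c: "\<And>j k. j \<le> k \<Longrightarrow> ?B (?d (w k) (w j)) (?d (w k) (w j)) \<le> 4 * (1/8)^j"
    have c': "energy a \<Omega> (?d (w k) (w j)) (?d (w k) (w j)) \<le> 4 * (1/8)^j" if "j \<le> k" for j k
      using c[OF that] ip_nonneg[of "?d (w k) (w j)"] \<open>\<kappa> \<ge> 0\<close>
        mult_nonneg_nonneg[of \<kappa> "ip (?d (w k) (w j)) (?d (w k) (w j))"] by linarith
    then obtain u where u: "u \<in> ?V"
      and le: "\<And>j. energy a \<Omega> (?d u (w j)) (?d u (w j)) \<le> 4 * (1/8)^j"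
      using energy_space_complete[OF \<Omega> U P w c'] by blast
    have "?B (?d u (w j)) (?d u (w j)) \<le> ((1 + \<kappa> * P) * 4) * (1/8)^j" for j
    proof -
      have "ip (?d u (w j)) (?d u (w j)) \<le> P * energy a \<Omega> (?d u (w j)) (?d u (w j))"
        using P(2)[OF energy_space_diff[OF u w]] by (simp add: ip_def power2_eq_square)
      also have "\<dots> \<le> P * (4 * (1/8)^j)" by (intro mult_left_mono le P)
      finally have "\<kappa> * ip (?d u (w j)) (?d u (w j)) \<le> \<kappa> * (P * (4 * (1/8)^j))"
        using \<open>\<kappa> \<ge> 0\<close> by (rule mult_left_mono)
      then show ?thesis using le[of j] by (simp add: algebra_simps)
    qed
    then show "\<exists>u\<in>?V. \<exists>K. \<forall>j. ?B (?d u (w j)) (?d u (w j)) \<le> K * (1/8)^j" using u by blast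
  qed
  then show ?thesis unfolding ip_def .
qed

section \<open>Uniform density of exterior potentials\<close>

text \<open>Powers of \<open>z \<bullet> z\<close> are easier to differentiate than powers of the norm.\<close>

lemma kern_eq_powr: "z \<noteq> 0 \<Longrightarrow> kern a (z::'a::euclidean_space) = (z \<bullet> z) powr (- (real DIM('a) / 2 + a))"
proof -
  have "norm z = (z \<bullet> z) powr (1/2)" by (simp add: norm_eq_sqrt_inner powr_half_sqrt)
  then have "kern a z = 1 / (z \<bullet> z) powr (real DIM('a) / 2 + a)"
    by (simp add: kern_def powr_powr add_divide_distrib)
  then show ?thesis by (simp only: powr_minus_divide)
qed

lemma continuous_on_kern: "continuous_on (- {0}) (kern a)"
  unfolding kern_def[abs_def] by (intro continuous_intros) auto

definition potential :: "real \<Rightarrow> ('a::euclidean_space \<Rightarrow> real) \<Rightarrow> 'a \<Rightarrow> real" where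
  "potential a \<phi> x = (LINT y|lborel. \<phi> y * kern a (x - y))"

definition lipschitz_supported :: "'a::euclidean_space set \<Rightarrow> ('a \<Rightarrow> real) set" where
  "lipschitz_supported S = {\<phi>. (\<exists>L. L-lipschitz_on UNIV \<phi>) \<and> (\<forall>x. x \<notin> S \<longrightarrow> \<phi> x = 0)}"

lemma lipschitz_supported_linear:
  assumes "\<phi> \<in> lipschitz_supported S" "\<xi> \<in> lipschitz_supported S"
  shows "(\<lambda>x. c * \<phi> x + d * \<xi> x) \<in> lipschitz_supported S"
proof -
  obtain L M where L: "L-lipschitz_on UNIV \<phi>" "M-lipschitz_on UNIV \<xi>"
    using assms by (auto simp: lipschitz_supported_def)
  have "(\<bar>c\<bar> * L + \<bar>d\<bar> * M)-lipschitz_on UNIV (\<lambda>x. c * \<phi> x + d * \<xi> x)"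
    by (intro lipschitz_on_add lipschitz_on_cmult_real L)
  then show ?thesis using assms by (auto simp: lipschitz_supported_def)
qed

lemma lipschitz_supported_zero: "(\<lambda>_. 0) \<in> lipschitz_supported S"
  by (auto simp: lipschitz_supported_def intro!: exI[of _ 0] lipschitz_onI)

text \<open>The potentials are generated on the open ball and approximate on \<open>K\<close>; the closed ball avoids
  \<open>K\<close>, so that the kernel is uniformly continuous on all differences that occur.\<close>

locale exterior_ball =
  fixes a :: real and K :: "'a::euclidean_space set" and b :: 'a and r :: real
  assumes a_pos: "0 < a" and compact_K: "compact K" and r_pos: "0 < r"
    and disjoint: "K \<inter> cball b r = {}"
begin

definition approximable :: "('a \<Rightarrow> real) \<Rightarrow> bool" where
  "approximable f \<longleftrightarrow> (\<forall>\<epsilon>>0. \<exists>\<phi>\<in>lipschitz_supported (ball b r). \<forall>x\<in>K. \<bar>f x - potential a \<phi> x\<bar> < \<epsilon>)"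

lemma diff_nonzero: "x \<in> K \<Longrightarrow> y \<in> ball b r \<Longrightarrow> x - y \<noteq> 0"
  using disjoint by auto

lemma compact_differences: "compact ((\<lambda>(x, y). x - y) ` (K \<times> cball b r))"
  by (intro compact_continuous_image compact_Times compact_K compact_cball)
     (auto simp: split_beta intro!: continuous_intros)

lemma differences_nonzero: "(\<lambda>(x, y). x - y) ` (K \<times> cball b r) \<subseteq> - {0}"
  using disjoint by auto

lemma integrable_potential:
  assumes \<phi>: "\<phi> \<in> lipschitz_supported (ball b r)" and x: "x \<in> K"
  shows "integrable lborel (\<lambda>y. \<phi> y * kern a (x - y))"
proof -
  obtain L where L: "L-lipschitz_on UNIV \<phi>" using \<phi> by (auto simp: lipschitz_supported_def)
  have 0: "\<And>y. y \<notin> ball b r \<Longrightarrow> \<phi> y = 0" using \<phi> by (simp add: lipschitz_supported_def)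
  note [measurable] = lipschitz_borel_measurable[OF L]
  obtain M where M: "\<And>y. \<bar>\<phi> y\<bar> \<le> M"
    using lipschitz_bounded_if_bounded_support[OF L bounded_ball 0] by blast
  have "compact (kern a ` ((\<lambda>(x, y). x - y) ` (K \<times> cball b r)))"
    by (intro compact_continuous_image compact_differences continuous_on_subset[OF continuous_on_kern differences_nonzero])
  then obtain N where "\<forall>v\<in>kern a ` ((\<lambda>(x, y). x - y) ` (K \<times> cball b r)). norm v \<le> N"
    using compact_imp_bounded bounded_iff by metis
  then have N: "\<bar>kern a (x - y)\<bar> \<le> N" if "x \<in> K" "y \<in> cball b r" for x y
    using that by force
  show ?thesis
  proof (rule Bochner_Integration.integrable_bound)
    have "emeasure lborel (ball b r) < \<infinity>" by (intro emeasure_bounded_finite) simp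
    then have "integrable lborel (indicator (ball b r) :: 'a \<Rightarrow> real)" by (simp add: integrable_indicator_iff)
    then show "integrable lborel (\<lambda>y. (M * N) * indicator (ball b r) y)" by simp
    have "\<bar>\<phi> y * kern a (x - y)\<bar> \<le> \<bar>(M * N) * indicator (ball b r) y\<bar>" for y
    proof (cases "y \<in> ball b r")
      case True
      then have "\<bar>\<phi> y\<bar> * \<bar>kern a (x - y)\<bar> \<le> M * N" using M[of y] N[OF x, of y] by (intro mult_mono) auto
      from order_trans[OF this abs_ge_self] show ?thesis using True by (simp add: abs_mult)
    qed (simp add: 0)
    then show "AE y in lborel. norm (\<phi> y * kern a (x - y)) \<le> norm ((M * N) * indicator (ball b r) y)" by simp
  qed measurable
qed

lemma potential_linear:
  assumes "\<phi> \<in> lipschitz_supported (ball b r)" "\<xi> \<in> lipschitz_supported (ball b r)" "x \<in> K"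
  shows "potential a (\<lambda>y. c * \<phi> y + d * \<xi> y) x = c * potential a \<phi> x + d * potential a \<xi> x"
proof -
  have "(\<lambda>y. (c * \<phi> y + d * \<xi> y) * kern a (x - y)) = (\<lambda>y. c * (\<phi> y * kern a (x - y)) + d * (\<xi> y * kern a (x - y)))"
    by (simp add: algebra_simps)
  then show ?thesis unfolding potential_def using assms by (simp add: integrable_potential)
qed

lemma approximable_linear:
  assumes "approximable f" "approximable g"
  shows "approximable (\<lambda>x. c * f x + d * g x)"
  unfolding approximable_def
proof (intro allI impI)
  fix \<epsilon> :: real assume "\<epsilon> > 0"
  define \<delta> where "\<delta> = \<epsilon> / (\<bar>c\<bar> + \<bar>d\<bar> + 1)"
  have "\<bar>c\<bar> + \<bar>d\<bar> + 1 > 0" by linarith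
  then have \<delta>: "\<delta> > 0" "(\<bar>c\<bar> + \<bar>d\<bar> + 1) * \<delta> = \<epsilon>" using \<open>\<epsilon> > 0\<close> by (auto simp: \<delta>_def)
  obtain \<phi> \<xi> where \<phi>: "\<phi> \<in> lipschitz_supported (ball b r)" "\<And>x. x \<in> K \<Longrightarrow> \<bar>f x - potential a \<phi> x\<bar> < \<delta>"
    and \<xi>: "\<xi> \<in> lipschitz_supported (ball b r)" "\<And>x. x \<in> K \<Longrightarrow> \<bar>g x - potential a \<xi> x\<bar> < \<delta>"
    using assms \<delta>(1) unfolding approximable_def by metis
  show "\<exists>\<phi>\<in>lipschitz_supported (ball b r). \<forall>x\<in>K. \<bar>c * f x + d * g x - potential a \<phi> x\<bar> < \<epsilon>"
  proof (intro bexI ballI)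
    show "(\<lambda>y. c * \<phi> y + d * \<xi> y) \<in> lipschitz_supported (ball b r)"
      by (intro lipschitz_supported_linear \<phi> \<xi>)
    fix x assume x: "x \<in> K"
    have "\<bar>c * f x + d * g x - potential a (\<lambda>y. c * \<phi> y + d * \<xi> y) x\<bar>
      = \<bar>c * (f x - potential a \<phi> x) + d * (g x - potential a \<xi> x)\<bar>"
      unfolding potential_linear[OF \<phi>(1) \<xi>(1) x] by (simp add: algebra_simps)
    also have "\<dots> \<le> \<bar>c\<bar> * \<bar>f x - potential a \<phi> x\<bar> + \<bar>d\<bar> * \<bar>g x - potential a \<xi> x\<bar>"
      by (metis abs_mult abs_triangle_ineq)
    also have "\<dots> \<le> \<bar>c\<bar> * \<delta> + \<bar>d\<bar> * \<delta>"
      using \<phi>(2)[OF x] \<xi>(2)[OF x] by (intro add_mono mult_left_mono) auto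
    also have "\<dots> < \<epsilon>" using \<delta> by (simp add: distrib_right)
    finally show "\<bar>c * f x + d * g x - potential a (\<lambda>y. c * \<phi> y + d * \<xi> y) x\<bar> < \<epsilon>" .
  qed
qed

lemma approximable_limit:
  assumes "\<And>\<epsilon>. \<epsilon> > 0 \<Longrightarrow> \<exists>g. approximable g \<and> (\<forall>x\<in>K. \<bar>f x - g x\<bar> \<le> \<epsilon>)"
  shows "approximable f"
  unfolding approximable_def
proof (intro allI impI)
  fix \<epsilon> :: real assume "\<epsilon> > 0"
  then obtain g where g: "approximable g" "\<And>x. x \<in> K \<Longrightarrow> \<bar>f x - g x\<bar> \<le> \<epsilon> / 2"
    using assms[of "\<epsilon> / 2"] by auto
  obtain \<phi> where \<phi>: "\<phi> \<in> lipschitz_supported (ball b r)" "\<And>x. x \<in> K \<Longrightarrow> \<bar>g x - potential a \<phi> x\<bar> < \<epsilon> / 2"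
    using g(1) \<open>\<epsilon> > 0\<close> unfolding approximable_def by (meson half_gt_zero)
  show "\<exists>\<phi>\<in>lipschitz_supported (ball b r). \<forall>x\<in>K. \<bar>f x - potential a \<phi> x\<bar> < \<epsilon>"
  proof (intro bexI[OF _ \<phi>(1)] ballI)
    fix x assume "x \<in> K"
    from g(2)[OF this] \<phi>(2)[OF this] show "\<bar>f x - potential a \<phi> x\<bar> < \<epsilon>" by linarith
  qed
qed

lemma approximable_cong: "approximable g \<Longrightarrow> (\<And>x. x \<in> K \<Longrightarrow> f x = g x) \<Longrightarrow> approximable f"
  by (rule approximable_limit) auto

lemma approximable_zero: "approximable (\<lambda>_. 0)"
proof -
  have "potential a (\<lambda>_. 0) x = 0" for x :: 'a by (simp add: potential_def)
  then show ?thesis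
    unfolding approximable_def by (intro allI impI bexI[OF _ lipschitz_supported_zero]) simp
qed

lemma approximable_add: "approximable f \<Longrightarrow> approximable g \<Longrightarrow> approximable (\<lambda>x. f x + g x)"
  using approximable_linear[of f g 1 1] by simp

lemma approximable_cmult: "approximable f \<Longrightarrow> approximable (\<lambda>x. c * f x)"
  using approximable_linear[of f f c 0] by simp

lemma approximable_sum: "(\<And>i. i \<in> I \<Longrightarrow> approximable (f i)) \<Longrightarrow> approximable (\<lambda>x. \<Sum>i\<in>I. f i x)"
  by (induction I rule: infinite_finite_induct) (auto intro: approximable_zero approximable_add)

text \<open>A point mass at \<open>y\<close> is replaced by a normalised Lipschitz bump of small support.\<close>

lemma approximable_kern:
  assumes y: "y \<in> ball b r"
  shows "approximable (\<lambda>x. kern a (x - y))"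
  unfolding approximable_def
proof (intro allI impI)
  fix \<epsilon> :: real assume \<epsilon>: "\<epsilon> > 0"
  have "uniformly_continuous_on ((\<lambda>(x, y). x - y) ` (K \<times> cball b r)) (kern a)"
    by (intro compact_uniformly_continuous compact_differences continuous_on_subset[OF continuous_on_kern differences_nonzero])
  then obtain \<delta> where \<delta>: "\<delta> > 0" and uc: "\<And>z z'. z \<in> (\<lambda>(x, y). x - y) ` (K \<times> cball b r) \<Longrightarrow>
      z' \<in> (\<lambda>(x, y). x - y) ` (K \<times> cball b r) \<Longrightarrow> dist z' z < \<delta> \<Longrightarrow> dist (kern a z') (kern a z) < \<epsilon> / 2"
    using \<epsilon> unfolding uniformly_continuous_on_def by (meson half_gt_zero)
  obtain t where t: "t > 0" "ball y t \<subseteq> ball b r" using y by (meson open_ball openE)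
  define \<eta> where "\<eta> = min \<delta> t"
  have \<eta>: "\<eta> > 0" using \<delta> t by (simp add: \<eta>_def)
  define f where "f x = max 0 (\<eta> - dist x y)" for x
  have f0: "f x = 0" if "x \<notin> ball y \<eta>" for x using that by (simp add: f_def dist_commute)
  have f_nonneg: "f x \<ge> 0" for x by (simp add: f_def)
  have fL: "1-lipschitz_on UNIV f"
  proof (rule lipschitz_onI)
    fix x x' :: 'a
    have "\<bar>dist x y - dist x' y\<bar> \<le> dist x x'"
      using dist_triangle[of x y x'] dist_triangle[of x' y x] dist_commute[of x x'] by linarith
    then show "dist (f x) (f x') \<le> 1 * dist x x'" unfolding f_def dist_real_def by linarith
  qed simp
  note [measurable] = lipschitz_borel_measurable[OF fL]
  have f_le: "f x \<le> \<eta> * indicator (ball y \<eta>) x" for x using f0[of x] \<eta> by (auto simp: f_def indicator_def)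
  have ib: "integrable lborel (indicator (ball y t) :: 'a \<Rightarrow> real)" for t
    using emeasure_bounded_finite[of "ball y t"] by (simp add: integrable_indicator_iff)
  have int: "integrable lborel f"
  proof (rule Bochner_Integration.integrable_bound)
    show "integrable lborel (\<lambda>x. \<eta> * indicator (ball y \<eta>) x)" using ib by simp
    show "AE x in lborel. norm (f x) \<le> norm (\<eta> * indicator (ball y \<eta>) x)"
      using f_le f_nonneg \<eta> by (auto simp: abs_mult)
  qed measurable
  define m where "m = (LINT x|lborel. f x)"
  have "m > 0"
  proof -
    have "0 < \<eta> / 2 * measure lborel (ball y (\<eta> / 2))" using content_ball_pos[of "\<eta> / 2" y] \<eta> by simp
    also have "\<dots> = (LINT x|lborel. \<eta> / 2 * indicator (ball y (\<eta> / 2)) x)" by simp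
    also have "\<dots> \<le> m" unfolding m_def
    proof (intro integral_mono int)
      show "integrable lborel (\<lambda>x. \<eta> / 2 * indicator (ball y (\<eta> / 2)) x)" using ib by simp
      show "\<eta> / 2 * indicator (ball y (\<eta> / 2)) x \<le> f x" for x
        by (auto simp: f_def indicator_def dist_commute max_def)
    qed
    finally show ?thesis .
  qed
  define \<phi> where "\<phi> x = f x / m" for x
  have "f \<in> lipschitz_supported (ball b r)"
    using fL f0 t(2) unfolding lipschitz_supported_def \<eta>_def by (auto simp: subset_iff)
  then have \<phi>: "\<phi> \<in> lipschitz_supported (ball b r)"
    using lipschitz_supported_linear[of f "ball b r" f "1 / m" 0] by (simp add: \<phi>_def[abs_def])
  have int\<phi>: "integrable lborel \<phi>" "(LINT x|lborel. \<phi> x) = 1"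
    using int \<open>m > 0\<close> by (simp_all add: \<phi>_def[abs_def] m_def)
  show "\<exists>\<phi>\<in>lipschitz_supported (ball b r). \<forall>x\<in>K. \<bar>kern a (x - y) - potential a \<phi> x\<bar> < \<epsilon>"
  proof (intro bexI[OF _ \<phi>] ballI)
    fix x assume x: "x \<in> K"
    have eq: "kern a (x - y) - potential a \<phi> x = (LINT z|lborel. \<phi> z * kern a (x - y) - \<phi> z * kern a (x - z))"
      unfolding potential_def using int\<phi> integrable_potential[OF \<phi> x] by simp
    have "\<bar>kern a (x - y) - potential a \<phi> x\<bar> \<le> (LINT z|lborel. \<epsilon> / 2 * \<phi> z)"
      unfolding eq
    proof (rule Bochner_Integration.integral_abs_bound_integral)
      show "integrable lborel (\<lambda>z. \<phi> z * kern a (x - y) - \<phi> z * kern a (x - z))"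
        using int\<phi> integrable_potential[OF \<phi> x] by simp
      show "integrable lborel (\<lambda>z. \<epsilon> / 2 * \<phi> z)" using int\<phi> by simp
      fix z
      show "\<bar>\<phi> z * kern a (x - y) - \<phi> z * kern a (x - z)\<bar> \<le> \<epsilon> / 2 * \<phi> z"
      proof (cases "z \<in> ball y \<eta>")
        case True
        then have "z \<in> ball b r" using t(2) by (auto simp: \<eta>_def)
        then have "dist (kern a (x - y)) (kern a (x - z)) < \<epsilon> / 2"
          using True x y by (intro uc) (auto simp: \<eta>_def dist_norm norm_minus_commute)
        then have "\<bar>kern a (x - y) - kern a (x - z)\<bar> \<le> \<epsilon> / 2" by (simp add: dist_real_def)
        moreover have "0 \<le> \<phi> z" using f_nonneg \<open>m > 0\<close> by (simp add: \<phi>_def)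
        ultimately show ?thesis
          by (metis abs_mult abs_of_nonneg mult.commute mult_left_mono real_norm_def right_diff_distrib)
      qed (simp add: \<phi>_def f0)
    qed
    also have "\<dots> = \<epsilon> / 2" using int\<phi> by simp
    also have "\<dots> < \<epsilon>" using \<epsilon> by simp
    finally show "\<bar>kern a (x - y) - potential a \<phi> x\<bar> < \<epsilon>" .
  qed
qed

text \<open>Derivatives with respect to the pole \<open>y\<close> become derivatives of \<open>h\<close> when a family is written
  as \<open>h (x - y)\<close>.\<close>

definition translates_approximable :: "('a \<Rightarrow> real) \<Rightarrow> bool" where
  "translates_approximable h \<longleftrightarrow> (\<forall>y\<in>ball b r. approximable (\<lambda>x. h (x - y)))"

text \<open>Difference quotients in \<open>y\<close> stay in the closure, and by the mean value theorem and uniform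
  continuity of \<open>h'\<close> on a compact set they converge uniformly on \<open>K\<close>.\<close>

lemma translates_approximable_derivative:
  assumes h: "translates_approximable h"
    and deriv: "\<And>z. z \<noteq> 0 \<Longrightarrow> (h has_derivative h' z) (at z)"
    and cont: "continuous_on (- {0}) (\<lambda>z. h' z v)"
  shows "translates_approximable (\<lambda>z. h' z v)"
  unfolding translates_approximable_def
proof (intro ballI approximable_limit)
  fix y and \<epsilon> :: real assume y: "y \<in> ball b r" and \<epsilon>: "\<epsilon> > 0"
  obtain t where t: "t > 0" "ball y t \<subseteq> ball b r" using y by (meson open_ball openE)
  define T where "T = t / (norm v + 1)"
  have T: "T > 0" using t by (simp add: T_def add_nonneg_pos)
  have in_ball: "y + \<tau> *\<^sub>R v \<in> ball b r" if "\<bar>\<tau>\<bar> < T" for \<tau>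
  proof -
    have "\<bar>\<tau>\<bar> * norm v \<le> \<bar>\<tau>\<bar> * (norm v + 1)" by (simp add: mult_left_mono)
    also have "\<dots> < t" using that unfolding T_def by (simp add: pos_less_divide_eq add_nonneg_pos)
    finally show ?thesis using t(2) by (intro subsetD[OF t(2)]) (simp add: dist_norm)
  qed
  \<comment> \<open>All points at which the mean value theorem may evaluate the derivative.\<close>
  define C where "C = (\<lambda>(x, \<tau>). x - (y + \<tau> *\<^sub>R v)) ` (K \<times> {0..T/2})"
  have "compact C" unfolding C_def
    by (intro compact_continuous_image compact_Times compact_K) (auto simp: split_beta intro!: continuous_intros)
  moreover have "C \<subseteq> - {0}"
    using diff_nonzero[OF _ in_ball] T unfolding C_def by (auto simp del: right_minus_eq)
  ultimately have "uniformly_continuous_on C (\<lambda>z. h' z v)"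
    using cont by (intro compact_uniformly_continuous) (auto intro: continuous_on_subset)
  then obtain \<delta> where \<delta>: "\<delta> > 0"
    and uc: "\<And>z z'. z \<in> C \<Longrightarrow> z' \<in> C \<Longrightarrow> dist z' z < \<delta> \<Longrightarrow> dist (h' z' v) (h' z v) < \<epsilon>"
    using \<epsilon> unfolding uniformly_continuous_on_def by meson
  define \<tau> where "\<tau> = min (T / 2) (\<delta> / (norm v + 1))"
  have \<tau>: "\<tau> > 0" "\<tau> \<le> T / 2" using T \<delta>
    by (simp add: \<tau>_def add_nonneg_pos) (simp only: \<tau>_def min.cobounded1)
  have \<tau>\<delta>: "s * norm v < \<delta>" if "0 \<le> s" "s < \<tau>" for s
  proof -
    have "s * norm v \<le> s * (norm v + 1)" using that by (simp add: mult_left_mono)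
    also have "\<dots> < \<delta>" using that unfolding \<tau>_def by (simp add: pos_less_divide_eq add_nonneg_pos)
    finally show ?thesis .
  qed
  define g where "g x = 1/\<tau> * h (x - y) + (- (1/\<tau>)) * h (x - (y + \<tau> *\<^sub>R v))" for x
  have "approximable g" unfolding g_def[abs_def]
    using h y in_ball[of \<tau>] \<tau> T unfolding translates_approximable_def
    by (intro approximable_linear) auto
  moreover have "\<bar>h' (x - y) v - g x\<bar> \<le> \<epsilon>" if x: "x \<in> K" for x
  proof -
    let ?p = "\<lambda>s. x - (y + s *\<^sub>R v)"
    have "\<exists>s>0. s < \<tau> \<and> h (?p \<tau>) - h (?p 0) = (\<tau> - 0) * (- h' (?p s) v)"
    proof (rule MVT2[OF \<tau>(1)])
      fix s assume s: "0 \<le> s" "s \<le> \<tau>"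
      have "?p s \<noteq> 0" using diff_nonzero[OF x in_ball] s \<tau> T by auto
      then have d: "(h has_derivative h' (?p s)) (at (?p s))" by (rule deriv)
      then have lin: "linear (h' (?p s))" by (rule has_derivative_linear)
      have "((\<lambda>s. h (?p s)) has_derivative (\<lambda>q. h' (?p s) (- (q *\<^sub>R v)))) (at s)"
        by (rule has_derivative_compose[where f = "\<lambda>s. x - (y + s *\<^sub>R v)" and g = h, OF _ d])
           (auto intro!: derivative_eq_intros)
      moreover have "(\<lambda>q. h' (?p s) (- (q *\<^sub>R v))) = (*) (- h' (?p s) v)"
        using lin by (auto simp: fun_eq_iff linear_neg linear_scale)
      ultimately show "((\<lambda>s. h (?p s)) has_real_derivative - h' (?p s) v) (at s)"
        unfolding has_field_derivative_def by (simp only:)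
    qed
    then obtain s where s: "0 < s" "s < \<tau>" "h (?p \<tau>) - h (?p 0) = \<tau> * (- h' (?p s) v)" by auto
    have "g x = h' (?p s) v" using s(3) \<tau>(1) unfolding g_def by (simp add: field_simps)
    moreover have "dist (h' (?p 0) v) (h' (?p s) v) < \<epsilon>"
    proof (rule uc)
      show "?p 0 \<in> C" "?p s \<in> C" using x s \<tau> T unfolding C_def
        by (auto intro!: image_eqI[where x = "(x, _)"])
      show "dist (?p 0) (?p s) < \<delta>" using \<tau>\<delta>[of s] s by (simp add: dist_norm)
    qed
    ultimately show ?thesis by (simp add: dist_real_def)
  qed
  ultimately show "\<exists>g. approximable g \<and> (\<forall>x\<in>K. \<bar>h' (x - y) v - g x\<bar> \<le> \<epsilon>)" by blast
qed

end

lemma has_derivative_inner_powr: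
  fixes z :: "'a::euclidean_space"
  assumes "z \<noteq> 0"
  shows "((\<lambda>z. (z \<bullet> z) powr t) has_derivative (\<lambda>v. 2 * t * (z \<bullet> v) * (z \<bullet> z) powr (t - 1))) (at z)"
proof -
  have "((\<lambda>z. z \<bullet> z) has_derivative (\<lambda>v. z \<bullet> v + v \<bullet> z)) (at z)"
    by (auto intro!: derivative_eq_intros)
  moreover have "((\<lambda>x. x powr t) has_real_derivative t * (z \<bullet> z) powr (t - 1)) (at (z \<bullet> z))"
    using assms by (intro has_real_derivative_powr) simp
  ultimately have "((\<lambda>z. (z \<bullet> z) powr t) has_derivative (\<lambda>v. (z \<bullet> v + v \<bullet> z) * (t * (z \<bullet> z) powr (t - 1)))) (at z)"
    by (rule DERIV_compose_FDERIV[rotated])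
  moreover have "(z \<bullet> v + v \<bullet> z) * (t * (z \<bullet> z) powr (t - 1)) = 2 * t * (z \<bullet> v) * (z \<bullet> z) powr (t - 1)" for v
    by (simp add: inner_commute algebra_simps)
  ultimately show ?thesis by simp
qed

lemma continuous_on_inner_powr:
  "continuous_on (- {0}) (\<lambda>z::'a::euclidean_space. (z \<bullet> z) powr t)"
  by (intro continuous_intros) auto

context exterior_ball
begin

text \<open>The Laplacian of \<open>(z \<bullet> z)\<^sup>t\<close> is \<open>2 t (n + 2 (t - 1)) (z \<bullet> z)\<^sup>t\<^sup>-\<^sup>1\<close>; the coefficient vanishes only for the
  constant function and for the fundamental solution.\<close>

lemma translates_approximable_powr_step:
  assumes t: "t < 0" and h: "translates_approximable (\<lambda>z. (z \<bullet> z) powr t)"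
    and ne: "real DIM('a) + 2 * (t - 1) \<noteq> 0"
  shows "translates_approximable (\<lambda>z. (z \<bullet> z) powr (t - 1))"
proof -
  \<comment> \<open>The derivative in direction \<open>u\<close> of the derivative of \<open>(z \<bullet> z)\<^sup>t\<close> in direction \<open>v\<close>.\<close>
  let ?h2 = "\<lambda>v z u. (2 * t) * ((u \<bullet> v) * (z \<bullet> z) powr (t - 1) + (z \<bullet> v) * (2 * (t - 1) * (z \<bullet> u) * (z \<bullet> z) powr (t - 1 - 1)))"
  have 1: "translates_approximable (\<lambda>z. 2 * t * (z \<bullet> v) * (z \<bullet> z) powr (t - 1))" for v
    by (rule translates_approximable_derivative[OF h has_derivative_inner_powr])
       (auto intro!: continuous_intros continuous_on_inner_powr)
  have 2: "translates_approximable (\<lambda>z. ?h2 v z v)" for v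
  proof (rule translates_approximable_derivative[where h' = "?h2 v" and v = v, OF 1[of v]])
    fix z :: 'a assume z: "z \<noteq> 0"
    have "((\<lambda>z. (2 * t) * ((z \<bullet> v) * (z \<bullet> z) powr (t - 1))) has_derivative ?h2 v z) (at z)"
      by (rule derivative_eq_intros has_derivative_inner_powr[OF z] refl)+ (auto simp: algebra_simps)
    then show "((\<lambda>z. 2 * t * (z \<bullet> v) * (z \<bullet> z) powr (t - 1)) has_derivative ?h2 v z) (at z)"
      by (simp add: mult.assoc)
  next
    show "continuous_on (- {0}) (\<lambda>z. ?h2 v z v)"
      by (intro continuous_intros continuous_on_inner_powr)
  qed
  define c where "c = 2 * t * (real DIM('a) + 2 * (t - 1))"
  have c: "c \<noteq> 0" using t ne by (simp add: c_def)
  have lap: "(\<Sum>v\<in>Basis. ?h2 v z v) = c * (z \<bullet> z) powr (t - 1)" if z: "z \<noteq> 0" for z :: 'a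
  proof -
    have "(z \<bullet> z) * (z \<bullet> z) powr (t - 1 - 1) = (z \<bullet> z) powr (t - 1)"
      using z powr_add[of "z \<bullet> z" 1 "t - 1 - 1"] by simp
    moreover have "(\<Sum>v\<in>Basis. ?h2 v z v) = (\<Sum>v\<in>Basis. 2 * t * (z \<bullet> z) powr (t - 1)
        + 4 * t * (t - 1) * (z \<bullet> z) powr (t - 1 - 1) * ((z \<bullet> v) * (z \<bullet> v)))"
      by (rule sum.cong) (simp_all add: algebra_simps)
    moreover have "\<dots> = 2 * t * real DIM('a) * (z \<bullet> z) powr (t - 1)
        + 4 * t * (t - 1) * ((z \<bullet> z) * (z \<bullet> z) powr (t - 1 - 1))"
      unfolding sum.distrib sum_distrib_left[symmetric] euclidean_inner[of z z, symmetric] by simp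
    ultimately show ?thesis by (simp add: c_def algebra_simps)
  qed
  show ?thesis unfolding translates_approximable_def
  proof
    fix y assume y: "y \<in> ball b r"
    have "approximable (\<lambda>x. ?h2 v (x - y) v)" for v
      using 2[of v] y unfolding translates_approximable_def by (rule bspec)
    then have "approximable (\<lambda>x. (1 / c) * (\<Sum>v\<in>Basis. ?h2 v (x - y) v))"
      by (rule approximable_cmult[OF approximable_sum])
    then show "approximable (\<lambda>x. ((x - y) \<bullet> (x - y)) powr (t - 1))"
      by (rule approximable_cong) (use lap diff_nonzero[OF _ y] c in simp)
  qed
qed

lemma translates_approximable_powr:
  "translates_approximable (\<lambda>z. (z \<bullet> z) powr (- (real DIM('a) / 2 + a) - real k))"
proof (induction k)
  case 0
  show ?case unfolding translates_approximable_def
  proof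
    fix y assume y: "y \<in> ball b r"
    show "approximable (\<lambda>x. ((x - y) \<bullet> (x - y)) powr (- (real DIM('a) / 2 + a) - real 0))"
      by (rule approximable_cong[OF approximable_kern[OF y]])
         (use kern_eq_powr[OF diff_nonzero[OF _ y]] in simp)
  qed
next
  case (Suc k)
  have "translates_approximable (\<lambda>z. (z \<bullet> z) powr (- (real DIM('a) / 2 + a) - real k - 1))"
    using a_pos by (intro translates_approximable_powr_step Suc.IH) (auto simp: field_simps)
  then show ?case by (simp add: algebra_simps)
qed

text \<open>With \<open>w = \<bar>x - y\<bar>\<^sup>2\<close>, the available functions of \<open>w\<close> are \<open>w powr (- s)\<close> times polynomials in \<open>1 / w\<close>.
  Since \<open>w\<close> ranges over a compact subset of the positive reals, these approximate every
  continuous function of \<open>w\<close>. Here \<open>s\<close> is half the exponent of the kernel.\<close>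

lemma approximable_gaussian:
  assumes y: "y \<in> ball b r"
  shows "approximable (\<lambda>x. exp (- l * ((x - y) \<bullet> (x - y))))"
proof (cases "K = {}")
  case True
  then show ?thesis using approximable_zero by (rule_tac approximable_cong) auto
next
  case K: False
  define s where "s = real DIM('a) / 2 + a"
  have s: "s > 0" using a_pos by (simp add: s_def add_nonneg_pos)
  define W where "W = (\<lambda>x. (x - y) \<bullet> (x - y)) ` K"
  have W: "compact W" unfolding W_def by (intro compact_continuous_image compact_K continuous_intros)
  have W_pos: "w > 0" if "w \<in> W" for w using that diff_nonzero[OF _ y] unfolding W_def by auto
  obtain t0 where t0: "t0 \<in> W" "\<And>w. w \<in> W \<Longrightarrow> t0 \<le> w"
    using compact_attains_inf[OF W] K by (auto simp: W_def)
  have t0_pos: "t0 > 0" using t0 W_pos by blast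
  define V where "V = (\<lambda>w. 1 / w) ` W"
  have V: "compact V" unfolding V_def
    using W_pos by (intro compact_continuous_image W continuous_intros) auto
  have V0: "u \<noteq> 0" if "u \<in> V" for u using that W_pos by (force simp: V_def)
  have cont: "continuous_on V (\<lambda>u. exp (- l / u) * u powr (- s))"
    using V0 by (intro continuous_intros) auto
  show ?thesis
  proof (rule approximable_limit)
    fix \<epsilon> :: real assume \<epsilon>: "\<epsilon> > 0"
    define e where "e = \<epsilon> * t0 powr s"
    have e: "e > 0" using \<epsilon> t0_pos by (simp add: e_def)
    obtain p where "real_polynomial_function p"
      and p: "\<And>u. u \<in> V \<Longrightarrow> \<bar>exp (- l / u) * u powr (- s) - p u\<bar> < e"
      using Stone_Weierstrass_real_polynomial_function[OF V cont e] by blast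
    then obtain A n where A: "p = (\<lambda>u. \<Sum>i\<le>n. A i * u ^ i)"
      using real_polynomial_function_iff_sum by blast
    define g where "g x = (\<Sum>i\<le>n. A i * ((x - y) \<bullet> (x - y)) powr (- s - real i))" for x
    have "approximable g" unfolding g_def[abs_def] s_def
      using translates_approximable_powr y unfolding translates_approximable_def
      by (intro approximable_sum approximable_cmult) auto
    moreover have "\<bar>exp (- l * ((x - y) \<bullet> (x - y))) - g x\<bar> \<le> \<epsilon>" if x: "x \<in> K" for x
    proof -
      define w where "w = (x - y) \<bullet> (x - y)"
      have w: "w \<in> W" using x by (simp add: W_def w_def)
      have wp: "w > 0" using W_pos[OF w] .
      have "g x = w powr (- s) * p (1 / w)"
        unfolding g_def A w_def[symmetric] sum_distrib_left
        using wp by (intro sum.cong refl) (simp add: powr_diff powr_realpow power_one_over field_simps)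
      moreover have "exp (- l * w) = w powr (- s) * (exp (- l / (1 / w)) * (1 / w) powr (- s))"
        using wp by (simp add: powr_divide powr_minus field_simps)
      ultimately have "exp (- l * w) - g x = w powr (- s) * (exp (- l / (1 / w)) * (1 / w) powr (- s) - p (1 / w))"
        by (simp only: right_diff_distrib)
      then have "\<bar>exp (- l * w) - g x\<bar> = w powr (- s) * \<bar>exp (- l / (1 / w)) * (1 / w) powr (- s) - p (1 / w)\<bar>"
        by (simp only: abs_mult abs_of_nonneg[OF powr_ge_zero])
      also have "\<dots> \<le> w powr (- s) * e"
        using p[of "1 / w"] w by (intro mult_left_mono) (auto simp: V_def)
      also have "\<dots> \<le> t0 powr (- s) * e"
        using t0(2)[OF w] t0_pos s e by (intro mult_right_mono powr_mono2') auto
      also have "\<dots> = \<epsilon>" using t0_pos by (simp add: e_def powr_minus)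
      finally show ?thesis unfolding w_def .
    qed
    ultimately show "\<exists>g. approximable g \<and> (\<forall>x\<in>K. \<bar>exp (- l * ((x - y) \<bullet> (x - y))) - g x\<bar> \<le> \<epsilon>)"
      by blast
  qed
qed

text \<open>The linear span of the Gaussians with centre in the ball. The value \<open>l = 0\<close> supplies the
  constants.\<close>

inductive gaussian_sum :: "('a \<Rightarrow> real) \<Rightarrow> bool" where
  single: "y \<in> ball b r \<Longrightarrow> l \<ge> 0 \<Longrightarrow> gaussian_sum (\<lambda>x. c * exp (- l * ((x - y) \<bullet> (x - y))))"
| add: "gaussian_sum f \<Longrightarrow> gaussian_sum g \<Longrightarrow> gaussian_sum (\<lambda>x. f x + g x)"

lemma approximable_gaussian_sum: "gaussian_sum f \<Longrightarrow> approximable f"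
proof (induction rule: gaussian_sum.induct)
  case (single y l c)
  show ?case by (rule approximable_cmult[OF approximable_gaussian[OF single(1)]])
next
  case (add f g)
  show ?case by (rule approximable_add[OF add.IH])
qed

text \<open>Completing the square: the product of two Gaussians is centred at the weighted mean of
  their centres, which lies in the ball by convexity.\<close>

lemma gaussian_sum_single_mult:
  assumes y: "y \<in> ball b r" "l \<ge> 0" and y': "y' \<in> ball b r" "l' \<ge> 0"
  shows "gaussian_sum (\<lambda>x. c * exp (- l * ((x - y) \<bullet> (x - y))) * (c' * exp (- l' * ((x - y') \<bullet> (x - y')))))"
proof (cases "l + l' = 0")
  case True
  then have "l = 0" "l' = 0" using y y' by auto
  then show ?thesis using gaussian_sum.single[of y 0 "c * c'"] y by simp
next
  case False
  then have pos: "l + l' > 0" using y y' by linarith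
  define m where "m = (l / (l + l')) *\<^sub>R y + (l' / (l + l')) *\<^sub>R y'"
  have m: "m \<in> ball b r" unfolding m_def
    using y y' pos by (intro convexD[OF convex_ball]) (auto simp: add_divide_distrib[symmetric])
  have lm: "(l + l') *\<^sub>R m = l *\<^sub>R y + l' *\<^sub>R y'" using pos by (simp add: m_def scaleR_add_right)
  define d where "d = l * (y \<bullet> y) + l' * (y' \<bullet> y') - (l + l') * (m \<bullet> m)"
  have eq: "l * ((x - y) \<bullet> (x - y)) + l' * ((x - y') \<bullet> (x - y')) = (l + l') * ((x - m) \<bullet> (x - m)) + d" for x
  proof -
    have "(l + l') * (x \<bullet> m) = l * (x \<bullet> y) + l' * (x \<bullet> y')"
      using arg_cong[OF lm, of "\<lambda>v. x \<bullet> v"] by (simp add: inner_add_right)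
    then show ?thesis unfolding d_def by (simp add: inner_diff inner_commute algebra_simps)
  qed
  have prod: "c * exp (- l * ((x - y) \<bullet> (x - y))) * (c' * exp (- l' * ((x - y') \<bullet> (x - y'))))
      = c * c' * exp (- d) * exp (- (l + l') * ((x - m) \<bullet> (x - m)))" for x
  proof -
    have "exp (- l * ((x - y) \<bullet> (x - y))) * exp (- l' * ((x - y') \<bullet> (x - y'))) =
      exp (- (l * ((x - y) \<bullet> (x - y)) + l' * ((x - y') \<bullet> (x - y'))))"
      by (simp add: exp_add[symmetric])
    also have "\<dots> = exp (- d) * exp (- (l + l') * ((x - m) \<bullet> (x - m)))"
      unfolding eq by (simp add: exp_add[symmetric] algebra_simps)
    finally show ?thesis by simp
  qed
  show ?thesis unfolding prod using pos by (intro gaussian_sum.single m) simp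
qed

lemma gaussian_sum_mult:
  assumes "gaussian_sum f" "gaussian_sum g"
  shows "gaussian_sum (\<lambda>x. f x * g x)"
  using assms(1)
proof (induction rule: gaussian_sum.induct)
  case (single y l c)
  from assms(2) show ?case
  proof (induction rule: gaussian_sum.induct)
    case (single y' l' c')
    then show ?case using gaussian_sum_single_mult[OF \<open>y \<in> ball b r\<close> \<open>l \<ge> 0\<close>] by blast
  next
    case (add f g)
    then show ?case using gaussian_sum.add by (simp add: distrib_left)
  qed
next
  case (add f f')
  then show ?case using gaussian_sum.add[OF add.IH] by (simp add: distrib_right)
qed

text \<open>Stone--Weierstrass for the algebra of Gaussian sums. Points are separated because a point is
  determined by its distances to the points of an open set.\<close>

theorem potentials_uniformly_dense:
  assumes f: "continuous_on K f"
  shows "approximable f"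
proof (rule approximable_limit)
  fix \<epsilon> :: real assume \<epsilon>: "\<epsilon> > 0"
  have "\<exists>g. gaussian_sum g \<and> (\<forall>x\<in>K. \<bar>f x - g x\<bar> < \<epsilon>)"
  proof (rule Stone_Weierstrass_HOL[OF compact_K])
    show "gaussian_sum (\<lambda>x. c)" for c using gaussian_sum.single[of b 0 c] r_pos by simp
    show "continuous_on K g" if "gaussian_sum g" for g
      using that by induction (auto intro!: continuous_intros)
    show "gaussian_sum (\<lambda>x. f x + g x)" if "gaussian_sum f \<and> gaussian_sum g" for f g
      using that gaussian_sum.add by blast
    show "gaussian_sum (\<lambda>x. f x * g x)" if "gaussian_sum f \<and> gaussian_sum g" for f g
      using that gaussian_sum_mult by blast
    fix x x' assume xx: "x \<in> K \<and> x' \<in> K \<and> x \<noteq> x'"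
    have "\<exists>y\<in>ball b r. (x - y) \<bullet> (x - y) \<noteq> (x' - y) \<bullet> (x' - y)"
    proof (cases "(x - b) \<bullet> (x - b) = (x' - b) \<bullet> (x' - b)")
      case True
      \<comment> \<open>If the centre is equidistant from both points, moving along \<open>x - x'\<close> breaks the tie.\<close>
      define \<tau> where "\<tau> = r / (2 * norm (x - x'))"
      have \<tau>: "\<tau> > 0" using r_pos xx by (simp add: \<tau>_def)
      define y where "y = b + \<tau> *\<^sub>R (x - x')"
      have "\<tau> * norm (x - x') = r / 2" using xx by (simp add: \<tau>_def)
      then have "y \<in> ball b r" using \<tau> r_pos by (simp add: y_def dist_norm)
      moreover have "(x - y) \<bullet> (x - y) - (x' - y) \<bullet> (x' - y)
          = (x - b) \<bullet> (x - b) - (x' - b) \<bullet> (x' - b) - 2 * \<tau> * ((x - x') \<bullet> (x - x'))"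
        by (simp add: y_def inner_diff inner_add inner_commute algebra_simps)
      moreover have "2 * \<tau> * ((x - x') \<bullet> (x - x')) \<noteq> 0" using \<tau> xx by simp
      ultimately show ?thesis using True by (intro bexI[of _ y]) auto
    qed (use r_pos in auto)
    then obtain y where y: "y \<in> ball b r" "(x - y) \<bullet> (x - y) \<noteq> (x' - y) \<bullet> (x' - y)" by blast
    show "\<exists>f. gaussian_sum f \<and> f x \<noteq> f x'"
      using gaussian_sum.single[OF y(1), of 1 1] y(2)
      by (intro exI[of _ "\<lambda>x. 1 * exp (- 1 * ((x - y) \<bullet> (x - y)))"]) simp
  qed (use f \<epsilon> in auto)
  then show "\<exists>g. approximable g \<and> (\<forall>x\<in>K. \<bar>f x - g x\<bar> \<le> \<epsilon>)"
    using approximable_gaussian_sum less_imp_le by blast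
qed

end

section \<open>Lipschitz functions and test functions\<close>

lemma power2_sum_le: "(s + t)\<^sup>2 \<le> 2 * s\<^sup>2 + 2 * t\<^sup>2" for s t :: real
  using sum_squares_bound[of s t] by (simp add: power2_sum)

lemma nn_integral_square_add_le:
  fixes f g :: "'a \<Rightarrow> real"
  assumes [measurable]: "f \<in> borel_measurable M" "g \<in> borel_measurable M"
    and "(\<integral>\<^sup>+x. ennreal ((f x)\<^sup>2) \<partial>M) \<le> ennreal A" "(\<integral>\<^sup>+x. ennreal ((g x)\<^sup>2) \<partial>M) \<le> ennreal B"
    and "A \<ge> 0" "B \<ge> 0"
  shows "(\<integral>\<^sup>+x. ennreal ((f x + g x)\<^sup>2) \<partial>M) \<le> ennreal (2 * A + 2 * B)"
proof -
  have "(\<integral>\<^sup>+x. ennreal ((f x + g x)\<^sup>2) \<partial>M) \<le> (\<integral>\<^sup>+x. 2 * ennreal ((f x)\<^sup>2) + 2 * ennreal ((g x)\<^sup>2) \<partial>M)"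
  proof (intro nn_integral_mono)
    fix x
    have "ennreal ((f x + g x)\<^sup>2) \<le> ennreal (2 * (f x)\<^sup>2 + 2 * (g x)\<^sup>2)" by (intro ennreal_leI power2_sum_le)
    then show "ennreal ((f x + g x)\<^sup>2) \<le> 2 * ennreal ((f x)\<^sup>2) + 2 * ennreal ((g x)\<^sup>2)"
      by (simp add: ennreal_plus ennreal_mult)
  qed
  also have "\<dots> = 2 * (\<integral>\<^sup>+x. ennreal ((f x)\<^sup>2) \<partial>M) + 2 * (\<integral>\<^sup>+x. ennreal ((g x)\<^sup>2) \<partial>M)"
    by (simp add: nn_integral_add nn_integral_cmult)
  also have "\<dots> \<le> 2 * ennreal A + 2 * ennreal B" using assms by (intro add_mono mult_left_mono) auto
  also have "\<dots> = ennreal (2 * A + 2 * B)" using assms by (simp add: ennreal_plus ennreal_mult)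
  finally show ?thesis .
qed

lemma lipschitz_supported_borel: "\<phi> \<in> lipschitz_supported S \<Longrightarrow> \<phi> \<in> borel_measurable borel"
  by (auto simp: lipschitz_supported_def intro: lipschitz_borel_measurable)

definition L2_lipschitz_limit :: "'a::euclidean_space set \<Rightarrow> ('a \<Rightarrow> real) \<Rightarrow> bool" where
  "L2_lipschitz_limit U f \<longleftrightarrow> f \<in> borel_measurable borel \<and> (\<forall>\<epsilon>>0. \<exists>\<phi>\<in>lipschitz_supported U.
     (\<integral>\<^sup>+x. ennreal ((f x - \<phi> x)\<^sup>2) \<partial>lborel) \<le> ennreal \<epsilon>)"

lemma L2_lipschitz_limit_limit:
  assumes [measurable]: "f \<in> borel_measurable borel"
    and ex: "\<And>\<epsilon>. \<epsilon> > 0 \<Longrightarrow> \<exists>g. L2_lipschitz_limit U g \<and> (\<integral>\<^sup>+x. ennreal ((f x - g x)\<^sup>2) \<partial>lborel) \<le> ennreal \<epsilon>"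
  shows "L2_lipschitz_limit U f"
  unfolding L2_lipschitz_limit_def
proof (intro conjI allI impI)
  fix \<epsilon> :: real assume \<epsilon>: "\<epsilon> > 0"
  obtain g where g: "L2_lipschitz_limit U g" "(\<integral>\<^sup>+x. ennreal ((f x - g x)\<^sup>2) \<partial>lborel) \<le> ennreal (\<epsilon>/4)"
    using ex[of "\<epsilon>/4"] \<epsilon> by auto
  have "\<epsilon>/4 > 0" using \<epsilon> by simp
  then obtain \<phi> where \<phi>: "\<phi> \<in> lipschitz_supported U" "(\<integral>\<^sup>+x. ennreal ((g x - \<phi> x)\<^sup>2) \<partial>lborel) \<le> ennreal (\<epsilon>/4)"
    using g(1) unfolding L2_lipschitz_limit_def by blast
  have [measurable]: "g \<in> borel_measurable borel" "\<phi> \<in> borel_measurable borel"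
    using g(1) lipschitz_supported_borel[OF \<phi>(1)] by (auto simp: L2_lipschitz_limit_def)
  have "(\<integral>\<^sup>+x. ennreal ((f x - g x + (g x - \<phi> x))\<^sup>2) \<partial>lborel) \<le> ennreal (2 * (\<epsilon>/4) + 2 * (\<epsilon>/4))"
    using \<epsilon> by (intro nn_integral_square_add_le g \<phi>) simp_all
  then show "\<exists>\<phi>\<in>lipschitz_supported U. (\<integral>\<^sup>+x. ennreal ((f x - \<phi> x)\<^sup>2) \<partial>lborel) \<le> ennreal \<epsilon>"
    using \<phi>(1) by (intro bexI[of _ \<phi>]) auto
qed (rule assms)

lemma L2_lipschitz_limit_add:
  assumes f: "L2_lipschitz_limit U f" and g: "L2_lipschitz_limit U g"
  shows "L2_lipschitz_limit U (\<lambda>x. f x + g x)"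
  unfolding L2_lipschitz_limit_def
proof (intro conjI allI impI)
  have [measurable]: "f \<in> borel_measurable borel" "g \<in> borel_measurable borel"
    using f g by (auto simp: L2_lipschitz_limit_def)
  show "(\<lambda>x. f x + g x) \<in> borel_measurable borel" by measurable
  fix \<epsilon> :: real assume \<epsilon>: "\<epsilon> > 0"
  then have "\<epsilon> / 4 > 0" by simp
  obtain \<phi> where \<phi>: "\<phi> \<in> lipschitz_supported U" "(\<integral>\<^sup>+x. ennreal ((f x - \<phi> x)\<^sup>2) \<partial>lborel) \<le> ennreal (\<epsilon>/4)"
    using f \<open>\<epsilon> / 4 > 0\<close> unfolding L2_lipschitz_limit_def by blast
  obtain \<xi> where \<xi>: "\<xi> \<in> lipschitz_supported U" "(\<integral>\<^sup>+x. ennreal ((g x - \<xi> x)\<^sup>2) \<partial>lborel) \<le> ennreal (\<epsilon>/4)"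
    using g \<open>\<epsilon> / 4 > 0\<close> unfolding L2_lipschitz_limit_def by blast
  note [measurable] = lipschitz_supported_borel[OF \<phi>(1)] lipschitz_supported_borel[OF \<xi>(1)]
  have "(\<integral>\<^sup>+x. ennreal ((f x - \<phi> x + (g x - \<xi> x))\<^sup>2) \<partial>lborel) \<le> ennreal (2 * (\<epsilon>/4) + 2 * (\<epsilon>/4))"
    using \<epsilon> by (intro nn_integral_square_add_le \<xi> \<phi>) simp_all
  then have "(\<integral>\<^sup>+x. ennreal ((f x + g x - (\<phi> x + \<xi> x))\<^sup>2) \<partial>lborel) \<le> ennreal \<epsilon>"
    by (simp add: algebra_simps)
  moreover have "(\<lambda>x. \<phi> x + \<xi> x) \<in> lipschitz_supported U"
    using lipschitz_supported_linear[OF \<phi>(1) \<xi>(1), of 1 1] by simp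
  ultimately show "\<exists>\<phi>\<in>lipschitz_supported U. (\<integral>\<^sup>+x. ennreal ((f x + g x - \<phi> x)\<^sup>2) \<partial>lborel) \<le> ennreal \<epsilon>"
    by (intro bexI[of _ "\<lambda>x. \<phi> x + \<xi> x"])
qed

lemma L2_lipschitz_limit_cmult:
  assumes f: "L2_lipschitz_limit U f"
  shows "L2_lipschitz_limit U (\<lambda>x. c * f x)"
  unfolding L2_lipschitz_limit_def
proof (intro conjI allI impI)
  have [measurable]: "f \<in> borel_measurable borel" using f by (auto simp: L2_lipschitz_limit_def)
  show "(\<lambda>x. c * f x) \<in> borel_measurable borel" by measurable
  fix \<epsilon> :: real assume \<epsilon>: "\<epsilon> > 0"
  define \<delta> where "\<delta> = \<epsilon> / (c\<^sup>2 + 1)"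
  have "c\<^sup>2 + 1 > 0" by (simp add: add_nonneg_pos)
  then have \<delta>: "\<delta> > 0" "(c\<^sup>2 + 1) * \<delta> = \<epsilon>" using \<epsilon> by (auto simp: \<delta>_def)
  obtain \<phi> where \<phi>: "\<phi> \<in> lipschitz_supported U" "(\<integral>\<^sup>+x. ennreal ((f x - \<phi> x)\<^sup>2) \<partial>lborel) \<le> ennreal \<delta>"
    using f \<delta>(1) unfolding L2_lipschitz_limit_def by blast
  note [measurable] = lipschitz_supported_borel[OF \<phi>(1)]
  have "(c * f x - c * \<phi> x)\<^sup>2 = c\<^sup>2 * (f x - \<phi> x)\<^sup>2" for x
    by (simp add: power_mult_distrib[symmetric] right_diff_distrib)
  then have "(\<integral>\<^sup>+x. ennreal ((c * f x - c * \<phi> x)\<^sup>2) \<partial>lborel) = ennreal (c\<^sup>2) * (\<integral>\<^sup>+x. ennreal ((f x - \<phi> x)\<^sup>2) \<partial>lborel)"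
    by (simp add: ennreal_mult nn_integral_cmult)
  also have "\<dots> \<le> ennreal (c\<^sup>2) * ennreal \<delta>" by (intro mult_left_mono \<phi>) simp
  also have "\<dots> \<le> ennreal \<epsilon>" using \<delta> by (simp add: ennreal_mult[symmetric] ennreal_leI distrib_right flip: \<delta>(2))
  finally have "(\<integral>\<^sup>+x. ennreal ((c * f x - c * \<phi> x)\<^sup>2) \<partial>lborel) \<le> ennreal \<epsilon>" .
  moreover have "(\<lambda>x. c * \<phi> x) \<in> lipschitz_supported U"
    using lipschitz_supported_linear[OF \<phi>(1) \<phi>(1), of c 0] by simp
  ultimately show "\<exists>\<phi>\<in>lipschitz_supported U. (\<integral>\<^sup>+x. ennreal ((c * f x - \<phi> x)\<^sup>2) \<partial>lborel) \<le> ennreal \<epsilon>"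
    by (intro bexI[of _ "\<lambda>x. c * \<phi> x"])
qed

lemma L2_lipschitz_limit_zero: "L2_lipschitz_limit U (\<lambda>_. 0)"
  unfolding L2_lipschitz_limit_def
  by (intro conjI allI impI bexI[OF _ lipschitz_supported_zero]) simp_all

lemma L2_lipschitz_limit_sum:
  "(\<And>i. i \<in> I \<Longrightarrow> L2_lipschitz_limit U (f i)) \<Longrightarrow> L2_lipschitz_limit U (\<lambda>x. \<Sum>i\<in>I. f i x)"
proof (induction I rule: infinite_finite_induct)
  case (insert i I)
  then show ?case by (simp add: L2_lipschitz_limit_add)
qed (simp_all add: L2_lipschitz_limit_zero)

text \<open>By regularity there are a compact \<open>T\<close> and an open \<open>V\<close> with \<open>T \<subseteq> A \<subseteq> V\<close> and \<open>V - T\<close> small; a truncated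
  distance to the complement of \<open>V\<close> interpolates between them.\<close>

lemma L2_lipschitz_limit_indicator:
  fixes U :: "'a::euclidean_space set"
  assumes U: "open U" "bounded U" and A: "A \<in> sets borel" "A \<subseteq> U"
  shows "L2_lipschitz_limit U (indicator A)"
  unfolding L2_lipschitz_limit_def
proof (intro conjI allI impI)
  show "indicator A \<in> borel_measurable borel" using A by simp
  fix \<epsilon> :: real assume \<epsilon>: "\<epsilon> > 0"
  then have \<epsilon>2: "\<epsilon> / 2 > 0" by simp
  have AL: "A \<in> sets lebesgue" using A by simp
  obtain T where T: "closed T" "T \<subseteq> A" "emeasure lebesgue (A - T) < ennreal (\<epsilon> / 2)"
    using sets_lebesgue_inner_closed[OF AL \<epsilon>2] by metis
  obtain V0 where V0: "open V0" "A \<subseteq> V0" "emeasure lebesgue (V0 - A) < ennreal (\<epsilon> / 2)"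
    using sets_lebesgue_outer_open[OF AL \<epsilon>2] by metis
  define V where "V = V0 \<inter> U"
  have V: "open V" "A \<subseteq> V" "V \<subseteq> U" using V0 U A by (auto simp: V_def)
  have "bounded T" using T(2) A(2) U(2) by (meson bounded_subset)
  then have "compact T" using T(1) compact_eq_bounded_closed by blast
  moreover have "closed (- V)" "T \<inter> - V = {}" using V T by auto
  ultimately obtain d where d: "d > 0" "\<And>x y. x \<in> T \<Longrightarrow> y \<in> - V \<Longrightarrow> d \<le> dist x y"
    using separate_compact_closed by metis
  have "V \<noteq> UNIV" using V(3) U(2) not_bounded_UNIV bounded_subset by metis
  then have ne: "- V \<noteq> {}" by auto
  define \<phi> where "\<phi> x = min 1 (setdist {x} (- V) / d)" for x
  have \<phi>_off: "\<phi> x = 0" if "x \<notin> V" for x using that d by (simp add: \<phi>_def setdist_sing_in_set)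
  have \<phi>_T: "\<phi> x = 1" if "x \<in> T" for x
  proof -
    have "d \<le> setdist {x} (- V)" using that d ne by (intro le_setdistI) auto
    then show ?thesis using d by (simp add: \<phi>_def)
  qed
  have \<phi>_range: "0 \<le> \<phi> x" "\<phi> x \<le> 1" for x using d setdist_pos_le[of "{x}" "- V"] by (auto simp: \<phi>_def)
  have "(1 / d)-lipschitz_on UNIV \<phi>"
  proof (rule lipschitz_onI)
    fix x y
    have "\<bar>setdist {x} (- V) / d - setdist {y} (- V) / d\<bar> = \<bar>setdist {x} (- V) - setdist {y} (- V)\<bar> / d"
      using d by (simp add: diff_divide_distrib[symmetric])
    also have "\<dots> \<le> dist x y / d" using d by (intro divide_right_mono setdist_Lipschitz) auto
    finally show "dist (\<phi> x) (\<phi> y) \<le> 1 / d * dist x y"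
      unfolding \<phi>_def dist_real_def by simp
  qed (use d in simp)
  then have \<phi>: "\<phi> \<in> lipschitz_supported U" using \<phi>_off V(3) by (auto simp: lipschitz_supported_def)
  have [measurable]: "T \<in> sets borel" "V \<in> sets borel" using T V by auto
  note A(1)[measurable]
  have "(\<integral>\<^sup>+x. ennreal ((indicator A x - \<phi> x)\<^sup>2) \<partial>lborel) \<le> (\<integral>\<^sup>+x. indicator (V - A) x + indicator (A - T) x \<partial>lborel)"
  proof (intro nn_integral_mono)
    fix x
    have "(indicator A x - \<phi> x)\<^sup>2 \<le> (1::real)"
    proof -
      have "\<bar>indicator A x - \<phi> x\<bar> \<le> 1" using \<phi>_range[of x] by (auto simp: indicator_def)
      then show ?thesis by (simp add: abs_square_le_1)
    qed
    then have 1: "ennreal ((indicator A x - \<phi> x)\<^sup>2) \<le> 1" by simp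
    have 0: "(indicator A x - \<phi> x)\<^sup>2 = (0::real)" if "x \<in> T \<or> x \<notin> V"
      using that T(2) V(2) \<phi>_off \<phi>_T by (auto simp: indicator_def)
    show "ennreal ((indicator A x - \<phi> x)\<^sup>2) \<le> indicator (V - A) x + indicator (A - T) x"
    proof (cases "x \<in> T \<or> x \<notin> V")
      case False
      then have "indicator (V - A) x + indicator (A - T) x = (1::ennreal)" by (auto simp: indicator_def)
      with 1 show ?thesis by simp
    qed (simp add: 0)
  qed
  also have "\<dots> = emeasure lborel (V - A) + emeasure lborel (A - T)" by (simp add: nn_integral_add)
  also have "\<dots> \<le> ennreal (\<epsilon> / 2) + ennreal (\<epsilon> / 2)"
  proof (rule add_mono)
    have "emeasure lborel (V - A) = emeasure lebesgue (V - A)" by simp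
    also have "\<dots> \<le> emeasure lebesgue (V0 - A)"
      using AL V0(1) by (intro emeasure_mono) (auto simp: V_def borel_open intro!: sets.Diff)
    finally show "emeasure lborel (V - A) \<le> ennreal (\<epsilon> / 2)" using V0(3) by simp
    have "emeasure lborel (A - T) = emeasure lebesgue (A - T)" by simp
    then show "emeasure lborel (A - T) \<le> ennreal (\<epsilon> / 2)" using T(3) by simp
  qed
  also have "\<dots> = ennreal \<epsilon>" using \<epsilon> by (simp add: ennreal_plus[symmetric])
  finally show "\<exists>\<phi>\<in>lipschitz_supported U. (\<integral>\<^sup>+x. ennreal ((indicator A x - \<phi> x)\<^sup>2) \<partial>lborel) \<le> ennreal \<epsilon>"
    using \<phi> by blast
qed

text \<open>Reduction to indicators: simple functions dominated by \<open>2 \<bar>f\<bar>\<close> converge to \<open>f\<close> in \<open>L\<^sup>2\<close>, and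
  they vanish outside \<open>U\<close> because \<open>f\<close> does.\<close>

lemma lipschitz_dense_in_L2:
  fixes U :: "'a::euclidean_space set" and f :: "'a \<Rightarrow> real"
  assumes U: "open U" "bounded U" and [measurable]: "f \<in> borel_measurable borel"
    and f0: "\<And>x. x \<notin> U \<Longrightarrow> f x = 0" and int: "integrable lborel (\<lambda>x. (f x)\<^sup>2)"
  shows "L2_lipschitz_limit U f"
proof (rule L2_lipschitz_limit_limit)
  fix \<epsilon> :: real assume \<epsilon>: "\<epsilon> > 0"
  have fm: "f \<in> borel_measurable lborel" by simp
  obtain F where F: "\<And>i. simple_function lborel (F i)" "\<And>x. (\<lambda>i. F i x) \<longlonglongrightarrow> f x"
    and bound: "\<And>i x. dist (F i x) 0 \<le> 2 * dist (f x) 0"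
    using borel_measurable_implies_sequence_metric[OF fm, of 0] by auto
  have [measurable]: "F i \<in> borel_measurable borel" for i
    using borel_measurable_simple_function[OF F(1)[of i]] by simp
  have dom: "(f x - F i x)\<^sup>2 \<le> 9 * (f x)\<^sup>2" for i x
  proof -
    have "\<bar>f x - F i x\<bar> \<le> 3 * \<bar>f x\<bar>" using bound[of i x] by simp
    then have "\<bar>f x - F i x\<bar>\<^sup>2 \<le> (3 * \<bar>f x\<bar>)\<^sup>2" by (intro power_mono) auto
    then show ?thesis by (simp add: power_mult_distrib)
  qed
  have "(\<lambda>i. LINT x|lborel. (f x - F i x)\<^sup>2) \<longlonglongrightarrow> (LINT x|(lborel::'a measure). 0)"
  proof (rule integral_dominated_convergence)
    show "integrable lborel (\<lambda>x. 9 * (f x)\<^sup>2)" using int by simp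
    have "(\<lambda>i. (f x - F i x)\<^sup>2) \<longlonglongrightarrow> (f x - f x)\<^sup>2" for x by (intro tendsto_intros F)
    then show "AE x in lborel. (\<lambda>i. (f x - F i x)\<^sup>2) \<longlonglongrightarrow> 0" by simp
    fix i
    show "AE x in lborel. norm ((f x - F i x)\<^sup>2) \<le> 9 * (f x)\<^sup>2" using dom by simp
  qed measurable
  then have "\<forall>\<^sub>F i in sequentially. (LINT x|lborel. (f x - F i x)\<^sup>2) < \<epsilon>"
    using \<epsilon> by (intro order_tendstoD) auto
  then obtain i where i: "(LINT x|lborel. (f x - F i x)\<^sup>2) < \<epsilon>" using eventually_happens'[OF sequentially_bot] by blast
  have int': "integrable lborel (\<lambda>x. (f x - F i x)\<^sup>2)"
  proof (rule Bochner_Integration.integrable_bound[of _ "\<lambda>x. 9 * (f x)\<^sup>2"])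
    show "integrable lborel (\<lambda>x. 9 * (f x)\<^sup>2)" using int by simp
    show "AE x in lborel. norm ((f x - F i x)\<^sup>2) \<le> norm (9 * (f x)\<^sup>2)" using dom by simp
  qed measurable
  have "L2_lipschitz_limit U (\<lambda>x. \<Sum>v\<in>F i ` UNIV - {0}. v * indicator (F i -` {v}) x)"
  proof (intro L2_lipschitz_limit_sum L2_lipschitz_limit_cmult L2_lipschitz_limit_indicator U)
    fix v assume v: "v \<in> F i ` UNIV - {0}"
    show "F i -` {v} \<in> sets borel" using measurable_sets[of "F i" borel borel "{v}"] by simp
    have "F i x = 0" if "x \<notin> U" for x using bound[of i x] f0[OF that] by simp
    then show "F i -` {v} \<subseteq> U" using v by blast
  qed
  moreover have "(\<Sum>v\<in>F i ` UNIV - {0}. v * indicator (F i -` {v}) x) = F i x" for x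
  proof -
    have fin: "finite (F i ` UNIV - {0})" using simple_functionD(1)[OF F(1)[of i]] by simp
    have "(\<Sum>v\<in>F i ` UNIV - {0}. v * indicator (F i -` {v}) x) = (\<Sum>v\<in>F i ` UNIV - {0}. if v = F i x then v else 0)"
      by (intro sum.cong) (auto simp: indicator_def)
    also have "\<dots> = F i x" using fin by (simp add: sum.delta)
    finally show ?thesis .
  qed
  ultimately have "L2_lipschitz_limit U (F i)" by simp
  moreover have "(\<integral>\<^sup>+x. ennreal ((f x - F i x)\<^sup>2) \<partial>lborel) \<le> ennreal \<epsilon>"
    using i int' by (subst nn_integral_eq_integral) (auto intro: ennreal_leI)
  ultimately show "\<exists>g. L2_lipschitz_limit U g \<and> (\<integral>\<^sup>+x. ennreal ((f x - g x)\<^sup>2) \<partial>lborel) \<le> ennreal \<epsilon>" by blast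
qed simp

text \<open>The derivative in each basis direction is continuous and vanishes outside a compact set,
  hence is bounded; this bounds the operator norm of the derivative.\<close>

lemma test_function_lipschitz_supported:
  assumes "\<psi> \<in> test_functions U"
  shows "\<psi> \<in> lipschitz_supported (U :: 'a::euclidean_space set)"
proof -
  let ?S = "closure {x. \<psi> x \<noteq> 0}"
  let ?D = "\<lambda>x. frechet_derivative \<psi> (at x)"
  have C: "C_k (Suc 0) \<psi>" and S: "compact ?S" "?S \<subseteq> U" using assms by (auto simp: test_functions_def)
  have d: "(\<psi> has_derivative ?D x) (at x)" for x
    using C by (simp add: frechet_derivative_works[symmetric])
  have cont: "continuous_on UNIV (\<lambda>x. ?D x v)" for v using C by simp
  have off: "?D x v = 0" if x: "x \<notin> ?S" for x v
  proof -
    have z: "((\<lambda>_. 0 :: real) has_derivative (\<lambda>_. 0)) (at x)" by simp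
    have o: "open (- ?S)" and xo: "x \<in> - ?S" using x by (simp_all add: open_Compl)
    have eq: "0 = \<psi> y" if "y \<in> - ?S" for y using that closure_subset[of "{x. \<psi> x \<noteq> 0}"] by auto
    have "(\<psi> has_derivative (\<lambda>_. 0)) (at x)"
      by (rule has_derivative_transform_within_open[OF z o xo eq])
    then have "?D x = (\<lambda>_. 0)" by (rule frechet_derivative_at[symmetric])
    then show ?thesis by simp
  qed
  have "\<exists>M. \<forall>x. \<bar>?D x v\<bar> \<le> M" for v
  proof -
    have "compact ((\<lambda>x. ?D x v) ` ?S)"
      by (intro compact_continuous_image S continuous_on_subset[OF cont]) simp
    then obtain M where "\<forall>t\<in>(\<lambda>x. ?D x v) ` ?S. norm t \<le> M"
      using compact_imp_bounded bounded_iff by metis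
    then have "\<bar>?D x v\<bar> \<le> max M 0" for x using off[of x v] by (cases "x \<in> ?S") force+
    then show ?thesis by blast
  qed
  then have "\<forall>v. \<exists>M. \<forall>x. \<bar>?D x v\<bar> \<le> M" by blast
  from choice[OF this] obtain M where M: "\<And>x v. \<bar>?D x v\<bar> \<le> M v" by blast
  define L where "L = (\<Sum>b\<in>Basis. M b)"
  have M0: "0 \<le> M v" for v using order_trans[OF abs_ge_zero M[of undefined v]] .
  have "\<bar>?D x v\<bar> \<le> L * norm v" for x v
  proof -
    have lin: "linear (?D x)" using d by (rule has_derivative_linear)
    have "?D x v = ?D x (\<Sum>b\<in>Basis. (v \<bullet> b) *\<^sub>R b)" by (simp add: euclidean_representation)
    also have "\<dots> = (\<Sum>b\<in>Basis. (v \<bullet> b) * ?D x b)"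
      using lin by (simp add: linear_sum linear_scale)
    finally have "\<bar>?D x v\<bar> \<le> (\<Sum>b\<in>Basis. \<bar>(v \<bullet> b) * ?D x b\<bar>)" by (simp add: sum_abs)
    also have "\<dots> \<le> (\<Sum>b\<in>Basis. norm v * M b)"
      unfolding abs_mult using M by (intro sum_mono mult_mono Basis_le_norm) auto
    finally show ?thesis by (simp add: L_def sum_distrib_left mult.commute)
  qed
  then have "onorm (?D x) \<le> L" for x
    by (intro onorm_bound) (auto simp: L_def intro!: sum_nonneg M0)
  then have "norm (\<psi> x - \<psi> y) \<le> L * norm (x - y)" for x y
    using d by (intro differentiable_bound[of UNIV]) auto
  then have "L-lipschitz_on UNIV \<psi>"
    by (intro lipschitz_onI) (auto simp: dist_norm L_def intro!: sum_nonneg M0)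
  moreover have "\<psi> x = 0" if "x \<notin> U" for x using that S(2) closure_subset[of "{x. \<psi> x \<noteq> 0}"] by auto
  ultimately show ?thesis by (auto simp: lipschitz_supported_def)
qed

section \<open>The energy and the regional pairing\<close>

lemma energy_eq_integral_pair:
  fixes u v :: "'a::euclidean_space \<Rightarrow> real"
  assumes \<Omega> [measurable]: "\<Omega> \<in> sets borel" and u: "u \<in> energy_space a \<Omega> U" and v: "v \<in> energy_space a \<Omega> W"
  defines "G \<equiv> \<lambda>x y. indicator \<Omega> x * indicator \<Omega> y * kern a (x - y) * ((u x - u y) * (v x - v y))"
  shows "integrable (lborel \<Otimes>\<^sub>M lborel) (case_prod G)"
    and "energy a \<Omega> u v = integral\<^sup>L (lborel \<Otimes>\<^sub>M lborel) (case_prod G)"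
proof -
  note [measurable] = energy_space_borel[OF u] energy_space_borel[OF v]
  let ?d = "\<lambda>(x, y). indicator \<Omega> x * indicator \<Omega> y * kern a (x - y)"
  have gm: "gagliardo_measure a \<Omega> = density (lborel \<Otimes>\<^sub>M lborel) (\<lambda>z. ennreal (?d z))"
    unfolding gagliardo_measure_def
    by (intro arg_cong[where f = "density _"] ext) (simp add: split_beta)
  have G: "?d z *\<^sub>R (increment u z * increment v z) = case_prod G z" for z
    by (simp add: G_def increment_def split_beta)
  have m: "(\<lambda>z. increment u z * increment v z) \<in> borel_measurable (lborel \<Otimes>\<^sub>M lborel)"
    "?d \<in> borel_measurable (lborel \<Otimes>\<^sub>M lborel)" by measurable
  have nn: "AE z in lborel \<Otimes>\<^sub>M lborel. 0 \<le> ?d z" by (simp add: split_beta)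
  show "integrable (lborel \<Otimes>\<^sub>M lborel) (case_prod G)"
    using integrable_increment_mult[OF u v] unfolding gm integrable_density[OF m nn] G .
  show "energy a \<Omega> u v = integral\<^sup>L (lborel \<Otimes>\<^sub>M lborel) (case_prod G)"
    unfolding energy_def gm integral_density[OF m nn] G ..
qed

lemma lborel_measurable_lebesgue: "f \<in> borel_measurable borel \<Longrightarrow> f \<in> borel_measurable lebesgue"
  by (intro measurable_completion) simp

text \<open>The iterated integrals of the pairing are taken with respect to completed measures, the
  energy with respect to a product of Borel measures; they agree for Borel functions by
  Fubini's theorem.\<close>

lemma regional_pairing_eq_energy:
  fixes u \<psi> :: "'a::euclidean_space \<Rightarrow> real"
  assumes [measurable]: "\<Omega> \<in> sets borel" and u: "u \<in> energy_space a \<Omega> U" and \<psi>: "\<psi> \<in> energy_space a \<Omega> W"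
  shows "regional_pairing C a \<Omega> (restrict u \<Omega>) \<psi> = C / 2 * energy a \<Omega> u \<psi>"
proof -
  note [measurable] = energy_space_borel[OF u] energy_space_borel[OF \<psi>]
  let ?s = "real DIM('a) + 2 * a"
  define G where "G x y = indicator \<Omega> x * indicator \<Omega> y * kern a (x - y) * ((u x - u y) * (\<psi> x - \<psi> y))" for x y
  have [measurable]: "case_prod G \<in> borel_measurable (borel \<Otimes>\<^sub>M borel)" unfolding G_def by measurable
  have \<Omega>: "\<Omega> \<inter> space lebesgue \<in> sets lebesgue" by simp
  have inner: "indicator \<Omega> x *\<^sub>R (LINT y|lebesgue_on \<Omega>. (restrict u \<Omega> x - restrict u \<Omega> y) * (\<psi> x - \<psi> y) / norm (x - y) powr ?s)
      = (LINT y|lborel. G x y)" for x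
  proof (cases "x \<in> \<Omega>")
    case True
    have "(LINT y|lebesgue_on \<Omega>. (restrict u \<Omega> x - restrict u \<Omega> y) * (\<psi> x - \<psi> y) / norm (x - y) powr ?s)
      = (LINT y|lebesgue. G x y)"
      unfolding integral_restrict_space[OF \<Omega>] using True
      by (intro Bochner_Integration.integral_cong) (auto simp: G_def kern_def indicator_def)
    also have "\<dots> = (LINT y|lborel. G x y)" by (intro integral_completion) measurable
    finally show ?thesis using True by simp
  qed (simp add: G_def)
  have "(LINT x|lebesgue_on \<Omega>. LINT y|lebesgue_on \<Omega>. (restrict u \<Omega> x - restrict u \<Omega> y) * (\<psi> x - \<psi> y) / norm (x - y) powr ?s)
     = (LINT x|lebesgue. LINT y|lborel. G x y)"
    unfolding integral_restrict_space[OF \<Omega>, where f = "\<lambda>x. LINT y|lebesgue_on \<Omega>. _ x y"] inner ..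
  also have "\<dots> = (LINT x|lborel. LINT y|lborel. G x y)" by (intro integral_completion) measurable
  also have "\<dots> = energy a \<Omega> u \<psi>"
    using lborel_pair.integral_fst'[OF energy_eq_integral_pair(1)[OF assms]]
    unfolding energy_eq_integral_pair(2)[OF assms] G_def by simp
  finally show ?thesis unfolding regional_pairing_def by simp
qed

text \<open>The supports are disjoint, so the integrand of the energy is
  \<open>- (\<phi> y h x + \<phi> x h y) \<bar>x - y\<bar>\<^sup>-\<^sup>s\<close>, and by symmetry both terms have the same integral.\<close>

lemma energy_exterior:
  fixes \<phi> h :: "'a::euclidean_space \<Rightarrow> real"
  assumes [measurable]: "\<Omega> \<in> sets borel" "U \<in> sets borel" and sub: "U \<subseteq> \<Omega>" "B \<subseteq> \<Omega>" "U \<inter> B = {}"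
    and \<phi>: "\<phi> \<in> energy_space a \<Omega> B" and h: "h \<in> energy_space a \<Omega> U"
  shows "integrable lborel (\<lambda>x. potential a \<phi> x * h x)"
    and "energy a \<Omega> \<phi> h = - 2 * (LINT x|lborel. potential a \<phi> x * h x)"
proof -
  note [measurable] = energy_space_borel[OF \<phi>] energy_space_borel[OF h]
  have \<phi>0: "\<phi> x = 0" if "x \<notin> B" for x using \<phi> that by (simp add: energy_space_def)
  have h0: "h x = 0" if "x \<notin> U" for x using h that by (simp add: energy_space_def)
  define G where "G x y = indicator \<Omega> x * indicator \<Omega> y * kern a (x - y) * ((\<phi> x - \<phi> y) * (h x - h y))" for x y
  define A where "A x y = \<phi> y * kern a (x - y) * h x" for x y
  have int: "integrable (lborel \<Otimes>\<^sub>M lborel) (case_prod G)"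
    and E: "energy a \<Omega> \<phi> h = integral\<^sup>L (lborel \<Otimes>\<^sub>M lborel) (case_prod G)"
    using energy_eq_integral_pair[OF assms(1) \<phi> h] unfolding G_def by simp_all
  have G_eq: "G x y = - A x y - A y x" for x y
  proof -
    have *: "\<phi> x * h x = 0" for x using \<phi>0[of x] h0[of x] sub by auto
    have "indicator \<Omega> x * indicator \<Omega> y * (\<phi> x * h y) = \<phi> x * h y" for x y
      using \<phi>0[of x] h0[of y] sub by (auto simp: indicator_def)
    note ** = this[of x y] this[of y x]
    have "G x y = kern a (x - y) * (indicator \<Omega> x * indicator \<Omega> y * (\<phi> x * h x + \<phi> y * h y)
        - indicator \<Omega> x * indicator \<Omega> y * (\<phi> x * h y) - indicator \<Omega> y * indicator \<Omega> x * (\<phi> y * h x))"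
      by (simp add: G_def algebra_simps)
    then show ?thesis unfolding * ** by (simp add: A_def kern_commute[of a y x] algebra_simps)
  qed
  \<comment> \<open>Up to sign each half is a restriction of \<open>G\<close>, which gives its integrability.\<close>
  have "A x y = - (G x y * indicator (U \<times> UNIV) (x, y))" for x y
  proof (cases "x \<in> U")
    case True
    then have "\<phi> x = 0" using \<phi>0 sub by auto
    then have "A y x = 0" by (simp add: A_def)
    then show ?thesis using True by (simp add: G_eq)
  qed (simp add: A_def h0)
  then have "case_prod A = (\<lambda>z. - (case_prod G z * indicator (U \<times> UNIV) z))" by (auto simp: fun_eq_iff)
  moreover have "U \<times> UNIV \<in> sets (lborel \<Otimes>\<^sub>M lborel)" by (intro pair_measureI) auto
  ultimately have intA: "integrable (lborel \<Otimes>\<^sub>M lborel) (case_prod A)"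
    using integrable_real_mult_indicator[OF _ int] by simp
  have intA': "integrable (lborel \<Otimes>\<^sub>M lborel) (\<lambda>(x, y). A y x)"
    using lborel_pair.integrable_product_swap[OF intA] by simp
  have inner: "(LINT y|lborel. A x y) = potential a \<phi> x * h x" for x
    unfolding A_def potential_def by simp
  show "integrable lborel (\<lambda>x. potential a \<phi> x * h x)"
    using lborel_pair.integrable_fst'[OF intA] by (simp add: inner)
  have IA: "integral\<^sup>L (lborel \<Otimes>\<^sub>M lborel) (case_prod A) = (LINT x|lborel. potential a \<phi> x * h x)"
    using lborel_pair.integral_fst'[OF intA] by (simp add: inner)
  have IA': "integral\<^sup>L (lborel \<Otimes>\<^sub>M lborel) (\<lambda>(x, y). A y x) = integral\<^sup>L (lborel \<Otimes>\<^sub>M lborel) (case_prod A)"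
    using lborel_pair.integral_product_swap[OF borel_measurable_integrable[OF intA]] by simp
  have "case_prod G = (\<lambda>z. - case_prod A z - (\<lambda>(x, y). A y x) z)" by (auto simp: fun_eq_iff G_eq)
  then have "energy a \<Omega> \<phi> h = - integral\<^sup>L (lborel \<Otimes>\<^sub>M lborel) (case_prod A)
      - integral\<^sup>L (lborel \<Otimes>\<^sub>M lborel) (\<lambda>(x, y). A y x)"
    unfolding E using intA intA' by simp
  then show "energy a \<Omega> \<phi> h = - 2 * (LINT x|lborel. potential a \<phi> x * h x)"
    unfolding IA' IA by simp
qed

lemma lipschitz_supported_energy_space:
  assumes "0 < a" "a < 1" "bounded S" "\<phi> \<in> lipschitz_supported S"
  shows "\<phi> \<in> energy_space a UNIV S"
proof -
  obtain L where "L-lipschitz_on UNIV \<phi>" using assms by (auto simp: lipschitz_supported_def)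
  then show ?thesis using assms by (intro lipschitz_in_energy_space) (auto simp: lipschitz_supported_def)
qed

lemma lipschitz_supported_square_integrable:
  fixes S :: "'a::euclidean_space set"
  assumes "bounded S" "\<phi> \<in> lipschitz_supported S"
  shows "integrable lborel (\<lambda>x. (\<phi> x)\<^sup>2)"
proof -
  obtain L where L: "L-lipschitz_on UNIV \<phi>" using assms by (auto simp: lipschitz_supported_def)
  have 0: "\<And>x. x \<notin> S \<Longrightarrow> \<phi> x = 0" using assms by (simp add: lipschitz_supported_def)
  note [measurable] = lipschitz_borel_measurable[OF L]
  obtain M where M: "\<And>x. \<bar>\<phi> x\<bar> \<le> M" using lipschitz_bounded_if_bounded_support[OF L assms(1) 0] by blast
  show ?thesis
  proof (rule Bochner_Integration.integrable_bound)
    have "emeasure lborel (closure S) < \<infinity>" using assms by (intro emeasure_bounded_finite) (simp add: bounded_closure)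
    then show "integrable lborel (\<lambda>x. M\<^sup>2 * indicator (closure S) x)" by (simp add: integrable_indicator_iff)
    have "(\<phi> x)\<^sup>2 \<le> M\<^sup>2 * indicator (closure S) x" for x
    proof (cases "x \<in> S")
      case True
      have "\<bar>\<phi> x\<bar>\<^sup>2 \<le> M\<^sup>2" using M[of x] by (intro power_mono) auto
      then show ?thesis using True closure_subset[of S] by (auto simp: indicator_def)
    qed (simp add: 0)
    then show "AE x in lborel. norm ((\<phi> x)\<^sup>2) \<le> norm (M\<^sup>2 * indicator (closure S) x)"
      by (auto simp: abs_mult)
  qed measurable
qed

lemma energy_space_sobolev:
  fixes u :: "'a::euclidean_space \<Rightarrow> real"
  assumes u: "u \<in> energy_space a UNIV W" and int: "integrable lborel (\<lambda>x. (u x)\<^sup>2)"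
  shows "u \<in> sobolev a"
proof -
  note [measurable] = energy_space_borel[OF u]
  have "u \<in> L2_on UNIV"
    unfolding L2_on_def lebesgue_on_UNIV_eq using int by (simp add: lborel_measurable_lebesgue integrable_completion)
  moreover have "(\<integral>\<^sup>+x. \<integral>\<^sup>+y. ennreal ((u x - u y)\<^sup>2 / norm (x - y) powr (real DIM('a) + 2 * a)) \<partial>lebesgue \<partial>lebesgue)
     = (\<integral>\<^sup>+z. ennreal ((increment u z)\<^sup>2) \<partial>gagliardo_measure a UNIV)"
    unfolding nn_integral_completion
    by (subst nn_integral_gagliardo_measure) (simp_all add: increment_def ennreal_mult[symmetric] kern_def)
  ultimately show ?thesis unfolding sobolev_def using nn_integral_energy[OF u] by simp
qed

lemma restrict_sobolev_on_L2_on: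
  fixes v :: "'a::euclidean_space \<Rightarrow> real"
  assumes U: "U \<in> sets borel" "U \<subseteq> \<Omega>" and v: "v \<in> sobolev_on a \<Omega>"
  shows "restrict v U \<in> L2_on U"
proof -
  obtain u where u: "u \<in> sobolev a" "v = restrict u \<Omega>" using v by (auto simp: sobolev_on_def)
  have um: "u \<in> borel_measurable lebesgue" and ui: "integrable lebesgue (\<lambda>x. (u x)\<^sup>2)"
    using u(1) unfolding sobolev_def L2_on_def lebesgue_on_UNIV_eq by auto
  have UL: "U \<in> sets lebesgue" using U by simp
  have eq: "restrict v U x = u x" if "x \<in> U" for x using that U(2) u(2) by auto
  have "(\<lambda>x. indicator U x *\<^sub>R (restrict v U x)) = (\<lambda>x. indicator U x *\<^sub>R u x)"
    using eq by (auto simp: indicator_def fun_eq_iff)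
  then have "restrict v U \<in> borel_measurable (lebesgue_on U)"
    using um UL by (subst borel_measurable_restrict_space_iff) auto
  moreover have "(\<lambda>x. indicator U x *\<^sub>R (restrict v U x)\<^sup>2) = (\<lambda>x. indicator U x *\<^sub>R (u x)\<^sup>2)"
    using eq by (auto simp: indicator_def fun_eq_iff)
  then have "integrable (lebesgue_on U) (\<lambda>x. (restrict v U x)\<^sup>2)"
    using integrable_mult_indicator[OF UL ui] UL by (subst integrable_restrict_space) auto
  ultimately show ?thesis by (simp add: L2_on_def)
qed

text \<open>Passing to a Borel function on the whole space lets all approximations take place in Borel
  measure theory.\<close>

lemma L2_on_borel_representative:
  fixes f :: "'a::euclidean_space \<Rightarrow> real"
  assumes [measurable]: "U \<in> sets borel" and f: "f \<in> L2_on U"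
  shows "\<exists>g. g \<in> borel_measurable borel \<and> (\<forall>x. x \<notin> U \<longrightarrow> g x = 0) \<and> integrable lborel (\<lambda>x. (g x)\<^sup>2) \<and>
    (\<forall>w\<in>borel_measurable borel. (\<forall>x. x \<notin> U \<longrightarrow> w x = 0) \<longrightarrow>
      L2_norm_on U (\<lambda>x. f x - w x) = sqrt (LINT x|lborel. (g x - w x)\<^sup>2))"
proof -
  have UL [measurable]: "U \<in> sets lebesgue" using assms by simp
  have U': "U \<inter> space lebesgue \<in> sets lebesgue" using UL by simp
  define f' where "f' x = indicator U x * f x" for x
  have f'm [measurable]: "f' \<in> borel_measurable lebesgue"
    using f unfolding L2_on_def f'_def[abs_def] by (simp add: borel_measurable_restrict_space_iff)
  have "integrable lebesgue (\<lambda>x. indicator U x *\<^sub>R (f x)\<^sup>2)"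
    using f unfolding L2_on_def by (simp add: integrable_restrict_space)
  moreover have "indicator U x *\<^sub>R (f x)\<^sup>2 = (f' x)\<^sup>2" for x by (simp add: f'_def indicator_def)
  ultimately have f'i: "integrable lebesgue (\<lambda>x. (f' x)\<^sup>2)" by simp
  obtain g0 where g0 [measurable]: "g0 \<in> borel_measurable lborel" and ae: "AE x in lborel. f' x = g0 x"
    using completion_ex_borel_measurable_real[OF f'm] by blast
  define g where "g x = indicator U x * g0 x" for x
  have g [measurable]: "g \<in> borel_measurable borel" using g0 unfolding g_def[abs_def] by simp
  have gL [measurable]: "g \<in> borel_measurable lebesgue" by (rule lborel_measurable_lebesgue[OF g])
  have ae': "AE x in lebesgue. f' x = g x"
    using AE_completion[OF ae] by eventually_elim (auto simp: g_def f'_def indicator_def)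
  have "integrable lebesgue (\<lambda>x. (g x)\<^sup>2)"
    using f'i by (rule integrable_cong_AE_imp) (use ae' in auto)
  then have "integrable lborel (\<lambda>x. (g x)\<^sup>2)" by (subst (asm) integrable_completion) simp_all
  moreover have "L2_norm_on U (\<lambda>x. f x - w x) = sqrt (LINT x|lborel. (g x - w x)\<^sup>2)"
    if w [measurable]: "w \<in> borel_measurable borel" and w0: "\<forall>x. x \<notin> U \<longrightarrow> w x = 0" for w
  proof -
    have [measurable]: "w \<in> borel_measurable lebesgue" by (rule lborel_measurable_lebesgue[OF w])
    have "(LINT x|lebesgue_on U. (f x - w x)\<^sup>2) = (LINT x|lebesgue. (f' x - w x)\<^sup>2)"
      unfolding integral_restrict_space[OF U'] using w0
      by (intro Bochner_Integration.integral_cong) (auto simp: f'_def indicator_def)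
    also have "\<dots> = (LINT x|lebesgue. (g x - w x)\<^sup>2)"
      by (rule integral_cong_AE) (measurable, use ae' in auto)
    also have "\<dots> = (LINT x|lborel. (g x - w x)\<^sup>2)" by (rule integral_completion) measurable
    finally show ?thesis by (simp add: L2_norm_on_def)
  qed
  ultimately show ?thesis using g by (intro exI[of _ g]) (auto simp: g_def)
qed

text \<open>Otherwise \<open>\<Omega>\<close> would equal the closure of \<open>U\<close> and be open and closed, hence the whole space.\<close>

lemma exists_ball_outside:
  fixes \<Omega> U :: "'a::euclidean_space set"
  assumes "open \<Omega>" "\<Omega> \<noteq> {}" "bounded \<Omega>" "closure U \<subseteq> \<Omega>"
  shows "\<exists>b r. r > 0 \<and> cball b r \<subseteq> \<Omega> - closure U"
proof -
  have "\<Omega> \<noteq> closure U"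
  proof
    assume "\<Omega> = closure U"
    then have "closed \<Omega>" by simp
    then have "\<Omega> = UNIV" using clopen[of \<Omega>] assms by blast
    then show False using assms not_bounded_UNIV by blast
  qed
  then obtain b where "b \<in> \<Omega> - closure U" using assms(4) by blast
  moreover have "open (\<Omega> - closure U)" using assms by (intro open_Diff) auto
  ultimately show ?thesis using open_contains_cball by metis
qed

section \<open>Density of the solutions\<close>

lemma energy_add_left:
  assumes "u \<in> energy_space a \<Omega> U" "v \<in> energy_space a \<Omega> U" "w \<in> energy_space a \<Omega> W"
  shows "energy a \<Omega> (\<lambda>x. u x + v x) w = energy a \<Omega> u w + energy a \<Omega> v w"
    and "energy a \<Omega> (\<lambda>x. u x - v x) w = energy a \<Omega> u w - energy a \<Omega> v w"
  using energy_linear[OF assms, of 1 1] energy_linear[OF assms, of 1 "-1"] by simp_all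

text \<open>Here \<open>u\<close> solves \<open>E(u, h) = \<kappa> \<langle>\<psi> - u, h\<rangle>\<close>. Testing with \<open>u - \<psi>\<close> gives
  \<open>\<kappa> \<parallel>\<psi> - u\<parallel>\<^sup>2 \<le> E(\<psi>, \<psi>)\<close>, so a large \<open>\<kappa>\<close> makes the distance small.\<close>

lemma resolvent_approximation:
  assumes \<Omega>: "\<Omega> \<in> sets borel" "U \<in> sets borel" and U: "emeasure lborel U < \<infinity>"
    and P: "P \<ge> 0" "\<And>w. w \<in> energy_space a \<Omega> U \<Longrightarrow> integrable lborel (\<lambda>x. (w x)\<^sup>2) \<and>
             (LINT x|lborel. (w x)\<^sup>2) \<le> P * energy a \<Omega> w w"
    and \<psi>: "\<psi> \<in> energy_space a \<Omega> U" and \<tau>: "\<tau> > 0"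
  shows "\<exists>u\<in>energy_space a \<Omega> U. \<exists>F\<in>energy_space a \<Omega> U.
    (\<forall>h\<in>energy_space a \<Omega> U. energy a \<Omega> u h = (LINT x|lborel. F x * h x)) \<and>
    (LINT x|lborel. (\<psi> x - u x)\<^sup>2) \<le> \<tau>"
proof -
  let ?V = "energy_space a \<Omega> U"
  \<comment> \<open>The summand 1 keeps \<open>\<kappa>\<close> positive when \<open>\<psi>\<close> has no energy.\<close>
  define \<kappa> where "\<kappa> = (energy a \<Omega> \<psi> \<psi> + 1) / \<tau>"
  have \<kappa>: "\<kappa> > 0" using energy_nonneg[of a \<Omega> \<psi>] \<tau> by (simp add: \<kappa>_def add_nonneg_pos)
  have int: "integrable lborel (\<lambda>x. u x * v x)" if "u \<in> ?V" "v \<in> ?V" for u v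
    using that P(2) by (intro integrable_mult_of_squares) (auto dest: energy_space_borel)
  obtain u where u: "u \<in> ?V" and eq0: "\<And>h. h \<in> ?V \<Longrightarrow>
      energy a \<Omega> u h + \<kappa> * (LINT x|lborel. u x * h x) = \<kappa> * (LINT x|lborel. \<psi> x * h x) - energy a \<Omega> (\<lambda>_. 0) h"
    using variational_solution_exists[OF \<Omega> U P less_imp_le[OF \<kappa>] energy_space_zero \<psi>] by blast
  define F where "F x = \<kappa> * \<psi> x + (- \<kappa>) * u x" for x
  have F: "F \<in> ?V" unfolding F_def[abs_def] by (rule energy_space_linear[OF \<psi> u])
  have eq: "energy a \<Omega> u h = (LINT x|lborel. F x * h x)" if h: "h \<in> ?V" for h
  proof -
    have "(\<lambda>x. F x * h x) = (\<lambda>x. \<kappa> * (\<psi> x * h x) - \<kappa> * (u x * h x))" by (simp add: F_def algebra_simps)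
    moreover have "energy a \<Omega> (\<lambda>_. 0) h = 0" by (simp add: energy_def increment_def split_beta)
    ultimately show ?thesis using eq0[OF h] int[OF u h] int[OF \<psi> h] by simp
  qed
  have "(LINT x|lborel. (\<psi> x - u x)\<^sup>2) \<le> \<tau>"
  proof -
    let ?d = "\<lambda>x. u x - \<psi> x" and ?X = "LINT x|lborel. (\<psi> x - u x)\<^sup>2"
    have d: "?d \<in> ?V" by (rule energy_space_diff[OF u \<psi>])
    have "(\<lambda>x. F x * ?d x) = (\<lambda>x. (- \<kappa>) * (\<psi> x - u x)\<^sup>2)"
      by (simp add: F_def power2_eq_square algebra_simps)
    then have "energy a \<Omega> u ?d = - \<kappa> * ?X" using eq[OF d] by simp
    moreover have "energy a \<Omega> u ?d = energy a \<Omega> u u - energy a \<Omega> \<psi> u"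
      using energy_add_left(2)[OF u \<psi> u] by (simp add: energy_commute[of a \<Omega> u ?d])
    moreover have "0 \<le> energy a \<Omega> ?d ?d" by (rule energy_nonneg)
    moreover have "energy a \<Omega> ?d ?d = energy a \<Omega> u u - 2 * energy a \<Omega> \<psi> u + energy a \<Omega> \<psi> \<psi>"
      using energy_add_left(2)[OF u \<psi> d] energy_add_left(2)[OF u \<psi> u] energy_add_left(2)[OF u \<psi> \<psi>]
      by (simp add: energy_commute[of a \<Omega> u ?d] energy_commute[of a \<Omega> \<psi> ?d] energy_commute[of a \<Omega> u \<psi>])
    moreover have "0 \<le> energy a \<Omega> u u" by (rule energy_nonneg)
    ultimately have "\<kappa> * ?X \<le> energy a \<Omega> \<psi> \<psi> + 1" using energy_nonneg[of a \<Omega> \<psi>] by linarith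
    also have "\<dots> = \<kappa> * \<tau>" using \<tau> by (simp add: \<kappa>_def)
    finally show ?thesis using \<kappa> by simp
  qed
  then show ?thesis using u F eq by blast
qed

text \<open>The difference \<open>h = u - w\<close> has right-hand side \<open>F - 2 T\<phi> = (F - g) + (g - 2 T\<phi>)\<close>, whose first
  part is small in \<open>L\<^sup>2\<close> and whose second part is small uniformly. Testing the equation with \<open>h\<close> and
  absorbing \<open>\<parallel>h\<parallel>\<^sup>2\<close> with the Poincare inequality bounds \<open>h\<close>.\<close>

lemma exterior_data_stability:
  fixes U :: "'a::euclidean_space set"
  assumes \<Omega>: "\<Omega> \<in> sets borel" "U \<in> sets borel" and sub: "U \<subseteq> \<Omega>" "B \<subseteq> \<Omega>" "U \<inter> B = {}"
    and U: "emeasure lborel U < \<infinity>"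
    and P: "P > 0" "\<And>w. w \<in> energy_space a \<Omega> U \<Longrightarrow> integrable lborel (\<lambda>x. (w x)\<^sup>2) \<and>
             (LINT x|lborel. (w x)\<^sup>2) \<le> P * energy a \<Omega> w w"
    and \<phi>: "\<phi> \<in> energy_space a \<Omega> B" and F: "F \<in> energy_space a \<Omega> U" and g: "g \<in> energy_space a \<Omega> U"
    and u: "u \<in> energy_space a \<Omega> U" and w: "w \<in> energy_space a \<Omega> U"
    and eq_u: "\<And>h. h \<in> energy_space a \<Omega> U \<Longrightarrow> energy a \<Omega> u h = (LINT x|lborel. F x * h x)"
    and eq_w: "\<And>h. h \<in> energy_space a \<Omega> U \<Longrightarrow> energy a \<Omega> w h = - energy a \<Omega> \<phi> h"
    and close: "\<And>x. x \<in> U \<Longrightarrow> \<bar>g x - 2 * potential a \<phi> x\<bar> \<le> \<eta>"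
  shows "(LINT x|lborel. (u x - w x)\<^sup>2) \<le>
    3 * P\<^sup>2 * ((LINT x|lborel. (F x - g x)\<^sup>2) + \<eta>\<^sup>2 * measure lborel U)"
proof -
  let ?V = "energy_space a \<Omega> U"
  define h where "h x = u x - w x" for x
  define D where "D = (LINT x|lborel. (F x - g x)\<^sup>2)"
  define X where "X = (LINT x|lborel. (h x)\<^sup>2)"
  define m where "m = measure lborel U"
  have h: "h \<in> ?V" unfolding h_def[abs_def] by (rule energy_space_diff[OF u w])
  have h0: "h x = 0" if "x \<notin> U" for x using h that by (simp add: energy_space_def)
  have Fg: "(\<lambda>x. F x - g x) \<in> ?V" by (rule energy_space_diff[OF F g])
  have int_Fh: "integrable lborel (\<lambda>x. F x * h x)"
    using F h P(2) by (intro integrable_mult_of_squares) (auto dest: energy_space_borel)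
  note ext = energy_exterior[OF \<Omega> sub \<phi> h]
  have "energy a \<Omega> h h = energy a \<Omega> u h - energy a \<Omega> w h"
    unfolding h_def[abs_def] by (rule energy_add_left(2)[OF u w h[unfolded h_def[abs_def]]])
  also have "\<dots> = (LINT x|lborel. F x * h x) - 2 * (LINT x|lborel. potential a \<phi> x * h x)"
    unfolding eq_u[OF h] eq_w[OF h] ext(2) by simp
  also have "\<dots> = (LINT x|lborel. F x * h x - 2 * (potential a \<phi> x * h x))"
    using int_Fh ext(1) by simp
  also have "\<dots> \<le> (LINT x|lborel. 2 * P * (F x - g x)\<^sup>2 + 2 * P * \<eta>\<^sup>2 * indicator U x + (1 / (4 * P)) * (h x)\<^sup>2)"
  proof (rule integral_mono)
    show "integrable lborel (\<lambda>x. F x * h x - 2 * (potential a \<phi> x * h x))" using int_Fh ext(1) by simp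
    have "integrable lborel (indicator U :: 'a \<Rightarrow> real)" using U \<Omega> by (simp add: integrable_indicator_iff)
    then show "integrable lborel (\<lambda>x. 2 * P * (F x - g x)\<^sup>2 + 2 * P * \<eta>\<^sup>2 * indicator U x + (1 / (4 * P)) * (h x)\<^sup>2)"
      using P(2)[OF Fg] P(2)[OF h] by simp
    fix x
    show "F x * h x - 2 * (potential a \<phi> x * h x) \<le> 2 * P * (F x - g x)\<^sup>2 + 2 * P * \<eta>\<^sup>2 * indicator U x + (1 / (4 * P)) * (h x)\<^sup>2"
    proof (cases "x \<in> U")
      case True
      let ?e = "g x - 2 * potential a \<phi> x"
      define q where "q = F x - g x + ?e"
      \<comment> \<open>The weight \<open>1 / (4 * P)\<close> leaves only a quarter of \<open>\<parallel>h\<parallel>\<^sup>2\<close> to be absorbed after multiplying by \<open>P\<close>.\<close>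
      have "0 \<le> (2 * P * q - h x)\<^sup>2 / (4 * P)" using P(1) by simp
      also have "\<dots> = P * q\<^sup>2 - q * h x + (1 / (4 * P)) * (h x)\<^sup>2"
        using P(1) by (simp add: power2_eq_square field_simps)
      finally have 1: "q * h x \<le> P * q\<^sup>2 + (1 / (4 * P)) * (h x)\<^sup>2" by linarith
      have "q\<^sup>2 \<le> 2 * (F x - g x)\<^sup>2 + 2 * ?e\<^sup>2"
        unfolding q_def by (rule power2_sum_le)
      moreover have "?e\<^sup>2 \<le> \<eta>\<^sup>2"
        using close[OF True] by (metis abs_ge_zero power2_abs power_mono)
      ultimately have "q\<^sup>2 \<le> 2 * (F x - g x)\<^sup>2 + 2 * \<eta>\<^sup>2" by linarith
      then have "P * q\<^sup>2 \<le> P * (2 * (F x - g x)\<^sup>2 + 2 * \<eta>\<^sup>2)" using P(1) by (intro mult_left_mono) auto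
      with 1 show ?thesis using True unfolding q_def by (simp add: algebra_simps)
    qed (use P(1) h0 in simp)
  qed
  also have "\<dots> = 2 * P * D + 2 * P * \<eta>\<^sup>2 * m + (1 / (4 * P)) * X"
  proof -
    have "integrable lborel (indicator U :: 'a \<Rightarrow> real)" using U \<Omega> by (simp add: integrable_indicator_iff)
    then show ?thesis using P(2)[OF Fg] P(2)[OF h] by (simp add: D_def X_def m_def)
  qed
  finally have "energy a \<Omega> h h \<le> 2 * P * D + 2 * P * \<eta>\<^sup>2 * m + (1 / (4 * P)) * X" .
  then have "P * energy a \<Omega> h h \<le> P * (2 * P * D + 2 * P * \<eta>\<^sup>2 * m + (1 / (4 * P)) * X)"
    using P(1) by (intro mult_left_mono) auto
  also have "\<dots> = 2 * P\<^sup>2 * (D + \<eta>\<^sup>2 * m) + X / 4"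
    using P(1) by (simp add: power2_eq_square field_simps)
  finally have "X \<le> 2 * P\<^sup>2 * (D + \<eta>\<^sup>2 * m) + X / 4" using P(2)[OF h] unfolding X_def by linarith
  moreover have "0 \<le> P\<^sup>2 * (D + \<eta>\<^sup>2 * m)" unfolding D_def m_def
    by (intro mult_nonneg_nonneg add_nonneg_nonneg integral_nonneg_AE) auto
  ultimately have "X \<le> 3 * (P\<^sup>2 * (D + \<eta>\<^sup>2 * m))" by linarith
  then show ?thesis unfolding X_def D_def m_def h_def by (simp add: mult.assoc)
qed

lemma L2_lipschitz_limitD:
  assumes "L2_lipschitz_limit U f" "\<epsilon> > 0"
  shows "\<exists>\<phi>\<in>lipschitz_supported U. integrable lborel (\<lambda>x. (f x - \<phi> x)\<^sup>2) \<and> (LINT x|lborel. (f x - \<phi> x)\<^sup>2) \<le> \<epsilon>"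
proof -
  obtain \<phi> where \<phi>: "\<phi> \<in> lipschitz_supported U" and le: "(\<integral>\<^sup>+x. ennreal ((f x - \<phi> x)\<^sup>2) \<partial>lborel) \<le> ennreal \<epsilon>"
    using assms unfolding L2_lipschitz_limit_def by blast
  have [measurable]: "f \<in> borel_measurable borel" "\<phi> \<in> borel_measurable borel"
    using assms(1) lipschitz_supported_borel[OF \<phi>] by (auto simp: L2_lipschitz_limit_def)
  have int: "integrable lborel (\<lambda>x. (f x - \<phi> x)\<^sup>2)"
    using le by (intro integrableI_nonneg) (auto intro: le_less_trans)
  have nn: "ennreal (LINT x|lborel. (f x - \<phi> x)\<^sup>2) = (\<integral>\<^sup>+x. ennreal ((f x - \<phi> x)\<^sup>2) \<partial>lborel)"
    using int by (subst nn_integral_eq_integral) auto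
  have "(LINT x|lborel. (f x - \<phi> x)\<^sup>2) \<le> \<epsilon>"
    using le assms(2) unfolding nn[symmetric] by (simp add: ennreal_le_iff)
  with int \<phi> show ?thesis by blast
qed

lemma integral_square_triangle:
  fixes f g :: "'a \<Rightarrow> real"
  assumes "f \<in> borel_measurable M" "g \<in> borel_measurable M"
    and "integrable M (\<lambda>x. (f x)\<^sup>2)" "integrable M (\<lambda>x. (g x)\<^sup>2)"
  shows "integrable M (\<lambda>x. (f x + g x)\<^sup>2)"
    and "(LINT x|M. (f x + g x)\<^sup>2) \<le> 2 * (LINT x|M. (f x)\<^sup>2) + 2 * (LINT x|M. (g x)\<^sup>2)"
proof -
  have "(\<lambda>x. (f x + g x)\<^sup>2) = (\<lambda>x. (f x)\<^sup>2 + (g x)\<^sup>2 + 2 * (f x * g x))"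
    by (simp add: power2_sum algebra_simps)
  then show int: "integrable M (\<lambda>x. (f x + g x)\<^sup>2)"
    using assms integrable_mult_of_squares[OF assms] by simp
  have "(LINT x|M. (f x + g x)\<^sup>2) \<le> (LINT x|M. 2 * (f x)\<^sup>2 + 2 * (g x)\<^sup>2)"
  proof (rule integral_mono)
    show "(f x + g x)\<^sup>2 \<le> 2 * (f x)\<^sup>2 + 2 * (g x)\<^sup>2" for x
      by (rule power2_sum_le)
  qed (use int assms in auto)
  then show "(LINT x|M. (f x + g x)\<^sup>2) \<le> 2 * (LINT x|M. (f x)\<^sup>2) + 2 * (LINT x|M. (g x)\<^sup>2)"
    using assms by simp
qed

text \<open>The chain of approximations is \<open>g \<approx> \<psi> \<approx> u \<approx> w\<close>: a Lipschitz function \<open>\<psi>\<close>, the resolvent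
  approximation \<open>u\<close> of \<open>\<psi>\<close> with right-hand side \<open>F\<close>, and the solution \<open>w\<close> whose exterior datum \<open>\<phi>\<close> satisfies
  \<open>2 T\<phi> \<approx> \<xi> \<approx> F\<close> for a Lipschitz function \<open>\<xi>\<close>.\<close>

theorem regional_solutions_approximate:
  fixes \<Omega> U :: "'a::euclidean_space set" and g :: "'a \<Rightarrow> real"
  assumes \<Omega>: "open \<Omega>" "bounded \<Omega>" "\<Omega> \<noteq> {}" and U: "open U" "compact (closure U)" "closure U \<subseteq> \<Omega>"
    and a: "0 < a" "a < 1"
    and g [measurable]: "g \<in> borel_measurable borel" and g0: "\<And>x. x \<notin> U \<Longrightarrow> g x = 0"
    and gi: "integrable lborel (\<lambda>x. (g x)\<^sup>2)" and \<tau>: "\<tau> > 0"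
  shows "\<exists>u\<in>sobolev a. regional_harmonic_in C a \<Omega> U (restrict u \<Omega>) \<and>
    (\<exists>w\<in>borel_measurable borel. (\<forall>x\<in>U. w x = u x) \<and> (\<forall>x. x \<notin> U \<longrightarrow> w x = 0) \<and>
      (LINT x|lborel. (g x - w x)\<^sup>2) \<le> \<tau>)"
proof -
  let ?V = "energy_space a \<Omega> U"
  have sets: "\<Omega> \<in> sets borel" "U \<in> sets borel" using \<Omega> U by auto
  have bU: "bounded U" using U(2) by (meson bounded_subset closure_subset compact_imp_bounded)
  have fU: "emeasure lborel U < \<infinity>" using bU by (rule emeasure_bounded_finite)
  have sub: "U \<subseteq> \<Omega>" using U(3) closure_subset by blast
  obtain b r where r: "r > 0" and br: "cball b r \<subseteq> \<Omega> - closure U"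
    using exists_ball_outside[OF \<Omega>(1,3,2) U(3)] by blast
  have B: "ball b r \<subseteq> \<Omega>" "U \<inter> ball b r = {}" "ball b r \<subseteq> \<Omega> - U"
    using br closure_subset[of U] ball_subset_cball[of b r] by blast+
  interpret exterior_ball a "closure U" b r
    using a r br U(2) by unfold_locales auto
  obtain P where P: "P > 0" and poin: "\<And>w. w \<in> ?V \<Longrightarrow> integrable lborel (\<lambda>x. (w x)\<^sup>2) \<and>
      (LINT x|lborel. (w x)\<^sup>2) \<le> P * energy a \<Omega> w w"
    using poincare_inequality[OF sets(1) \<Omega>(2) sub a(1) r B(3)] by blast
  have "closed (- \<Omega>)" "closure U \<inter> - \<Omega> = {}" using \<Omega> U by auto
  then obtain \<delta> where \<delta>: "\<delta> > 0" "\<And>x y. x \<in> closure U \<Longrightarrow> y \<in> - \<Omega> \<Longrightarrow> \<delta> \<le> dist x y"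
    using separate_compact_closed[OF U(2)] by metis
  have extend: "w \<in> energy_space a UNIV U" if "w \<in> ?V" for w
    using that poin closure_subset[of U] \<delta>(2) by (intro energy_space_extend[OF a sets(1) \<delta>(1)]) auto
  have LV: "\<psi> \<in> ?V" if "\<psi> \<in> lipschitz_supported U" for \<psi>
    by (rule energy_space_subset[OF sets(1) _ _ lipschitz_supported_energy_space[OF a bU that]]) auto
  have borelV: "w \<in> borel_measurable borel" if "w \<in> ?V" for w using that by (rule energy_space_borel)
  obtain \<psi> where \<psi>: "\<psi> \<in> lipschitz_supported U" "integrable lborel (\<lambda>x. (g x - \<psi> x)\<^sup>2)"
      "(LINT x|lborel. (g x - \<psi> x)\<^sup>2) \<le> \<tau> / 12"
    using L2_lipschitz_limitD[OF lipschitz_dense_in_L2[OF U(1) bU g g0 gi], of "\<tau> / 12"] \<tau> by auto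
  have \<tau>6: "\<tau> / 12 > 0" using \<tau> by simp
  obtain u F where u: "u \<in> ?V" and F: "F \<in> ?V"
    and eq_u: "\<And>h. h \<in> ?V \<Longrightarrow> energy a \<Omega> u h = (LINT x|lborel. F x * h x)"
    and \<psi>u: "(LINT x|lborel. (\<psi> x - u x)\<^sup>2) \<le> \<tau> / 12"
    using resolvent_approximation[OF sets fU less_imp_le[OF P] poin LV[OF \<psi>(1)] \<tau>6] by blast
  define c where "c = 3 * P\<^sup>2"
  have c: "c > 0" using P by (simp add: c_def)
  define m where "m = measure lborel U"
  have F0: "\<And>x. x \<notin> U \<Longrightarrow> F x = 0" using F by (simp add: energy_space_def)
  have \<tau>c: "\<tau> / (24 * c) > 0" using \<tau> c by simp
  obtain \<xi> where \<xi>: "\<xi> \<in> lipschitz_supported U" "(LINT x|lborel. (F x - \<xi> x)\<^sup>2) \<le> \<tau> / (24 * c)"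
    using L2_lipschitz_limitD[OF lipschitz_dense_in_L2[OF U(1) bU borelV[OF F] F0 conjunct1[OF poin[OF F]]] \<tau>c] by blast
  \<comment> \<open>Chosen so that \<open>\<eta>\<^sup>2 * m \<le> \<tau> / (24 * c)\<close>; the summand 1 avoids a division by zero.\<close>
  define \<eta> where "\<eta> = sqrt (\<tau> / (24 * c * (m + 1)))"
  have m: "m \<ge> 0" by (simp add: m_def)
  have \<eta>: "\<eta> > 0" using \<tau> c m by (simp add: \<eta>_def)
  have \<eta>2: "\<eta>\<^sup>2 = \<tau> / (24 * c * (m + 1))" using \<tau> c m by (simp add: \<eta>_def)
  have "\<eta>\<^sup>2 * m \<le> \<eta>\<^sup>2 * (m + 1)" by (simp add: mult_left_mono)
  also have "\<dots> = \<tau> / (24 * c)" unfolding \<eta>2 using c m by simp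
  finally have \<eta>m: "\<eta>\<^sup>2 * m \<le> \<tau> / (24 * c)" .
  obtain L where "L-lipschitz_on UNIV \<xi>" using \<xi>(1) by (auto simp: lipschitz_supported_def)
  then have "continuous_on (closure U) \<xi>" by (meson continuous_on_subset lipschitz_on_continuous_on subset_UNIV)
  then have "approximable (\<lambda>x. \<xi> x / 2)" by (intro potentials_uniformly_dense continuous_intros) auto
  then obtain \<phi> where \<phi>: "\<phi> \<in> lipschitz_supported (ball b r)"
    and close: "\<And>x. x \<in> closure U \<Longrightarrow> \<bar>\<xi> x / 2 - potential a \<phi> x\<bar> < \<eta> / 2"
    using \<eta> unfolding approximable_def by (meson half_gt_zero)
  have \<phi>E: "\<phi> \<in> energy_space a UNIV (ball b r)"
    using lipschitz_supported_energy_space[OF a bounded_ball \<phi>] .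
  have \<phi>\<Omega>: "\<phi> \<in> energy_space a \<Omega> (ball b r)"
    by (rule energy_space_subset[OF sets(1) _ _ \<phi>E]) auto
  have \<phi>\<Omega>': "\<phi> \<in> energy_space a \<Omega> UNIV" using \<phi>\<Omega> energy_space_mono by blast
  obtain w where w: "w \<in> ?V" and eq_w: "\<And>h. h \<in> ?V \<Longrightarrow> energy a \<Omega> w h = - energy a \<Omega> \<phi> h"
    using variational_solution_exists[OF sets fU less_imp_le[OF P] poin order_refl \<phi>\<Omega>' energy_space_zero] by auto
  have w0: "w x = 0" if "x \<notin> U" for x using w that by (simp add: energy_space_def)
  have "(LINT x|lborel. (u x - w x)\<^sup>2) \<le> c * ((LINT x|lborel. (F x - \<xi> x)\<^sup>2) + \<eta>\<^sup>2 * m)"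
    unfolding c_def m_def
  proof (rule exterior_data_stability[OF sets sub B(1,2) fU P poin \<phi>\<Omega> F LV[OF \<xi>(1)] u w eq_u eq_w])
    fix x assume "x \<in> U"
    then have "x \<in> closure U" using closure_subset by blast
    from close[OF this] show "\<bar>\<xi> x - 2 * potential a \<phi> x\<bar> \<le> \<eta>" by linarith
  qed
  also have "\<dots> \<le> c * (\<tau> / (24 * c) + \<tau> / (24 * c))" using c \<xi>(2) \<eta>m by (intro mult_left_mono add_mono) auto
  also have "\<dots> = \<tau> / 12" using c by (simp add: field_simps)
  finally have uw: "(LINT x|lborel. (u x - w x)\<^sup>2) \<le> \<tau> / 12" .
  note [measurable] = borelV[OF LV[OF \<psi>(1)]] borelV[OF u] borelV[OF w]
  have i1: "integrable lborel (\<lambda>x. (\<psi> x - u x)\<^sup>2)" "integrable lborel (\<lambda>x. (u x - w x)\<^sup>2)"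
    using poin[OF energy_space_diff[OF LV[OF \<psi>(1)] u]] poin[OF energy_space_diff[OF u w]] by auto
  have t1: "integrable lborel (\<lambda>x. (\<psi> x - w x)\<^sup>2)" "(LINT x|lborel. (\<psi> x - w x)\<^sup>2) \<le> 4 * (\<tau> / 12)"
    using integral_square_triangle[of "\<lambda>x. \<psi> x - u x" lborel "\<lambda>x. u x - w x"] i1 \<psi>u uw by auto
  have gw: "(LINT x|lborel. (g x - w x)\<^sup>2) \<le> \<tau> * (10 / 12)"
    using integral_square_triangle[of "\<lambda>x. g x - \<psi> x" lborel "\<lambda>x. \<psi> x - w x"] \<psi> t1 by auto
  define v where "v x = w x + \<phi> x" for x
  have wE: "w \<in> energy_space a UNIV UNIV" "w \<in> energy_space a \<Omega> UNIV"
    using extend[OF w] w energy_space_mono[OF subset_UNIV] by blast+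
  have \<phi>E': "\<phi> \<in> energy_space a UNIV UNIV" using \<phi>E energy_space_mono[OF subset_UNIV] by blast
  have vE: "v \<in> energy_space a UNIV UNIV" "v \<in> energy_space a \<Omega> UNIV"
    using energy_space_linear[OF wE(1) \<phi>E', of 1 1] energy_space_linear[OF wE(2) \<phi>\<Omega>', of 1 1]
    by (simp_all add: v_def[abs_def])
  have "integrable lborel (\<lambda>x. (v x)\<^sup>2)" unfolding v_def
    using poin[OF w] lipschitz_supported_square_integrable[OF bounded_ball \<phi>] lipschitz_supported_borel[OF \<phi>]
    by (intro integral_square_triangle(1)) auto
  then have "v \<in> sobolev a" by (rule energy_space_sobolev[OF vE(1)])
  moreover have "regional_harmonic_in C a \<Omega> U (restrict v \<Omega>)"
    unfolding regional_harmonic_in_def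
  proof
    fix h assume "h \<in> test_functions U"
    then have h: "h \<in> ?V" by (intro LV test_function_lipschitz_supported)
    have "energy a \<Omega> v h = 0"
      unfolding v_def[abs_def] energy_add_left(1)[OF wE(2) \<phi>\<Omega>' h] eq_w[OF h] by simp
    then show "regional_pairing C a \<Omega> (restrict v \<Omega>) h = 0"
      unfolding regional_pairing_eq_energy[OF sets(1) vE(2) h] by simp
  qed
  moreover have "w x = v x" if "x \<in> U" for x
  proof -
    have "\<phi> x = 0" using \<phi> that B(2) unfolding lipschitz_supported_def by blast
    then show ?thesis by (simp add: v_def)
  qed
  ultimately show ?thesis using gw w0 \<tau> borelV[OF w] by (intro bexI[of _ v] conjI bexI[of _ w]) auto
qed

theorem lemma3p5:
  fixes \<Omega> U :: "(real ^ 'n) set" and a C :: real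
  assumes "bounded_lipschitz_domain \<Omega>"
    and "open U" and "U \<noteq> {}" and "lipschitz_boundary U" and "compactly_contained U \<Omega>"
    and "0 < a" and "a < 1"
    and "C > 0"
  shows "dense_in_L2_on U (regional_solution_restrictions C a \<Omega> U)"
  unfolding dense_in_L2_on_def
proof (intro conjI ballI allI impI)
  have \<Omega>: "open \<Omega>" "bounded \<Omega>" "\<Omega> \<noteq> {}" and U: "compact (closure U)" "closure U \<subseteq> \<Omega>"
    using assms by (auto simp: bounded_lipschitz_domain_def compactly_contained_def)
  have UB: "U \<in> sets borel" and sub: "U \<subseteq> \<Omega>" using \<open>open U\<close> U(2) closure_subset by auto
  show "regional_solution_restrictions C a \<Omega> U \<subseteq> L2_on U"
    unfolding regional_solution_restrictions_def using restrict_sobolev_on_L2_on[OF UB sub] by blast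
  fix f :: "real ^ 'n \<Rightarrow> real" and \<epsilon> :: real assume f: "f \<in> L2_on U" and \<epsilon>: "0 < \<epsilon>"
  obtain g where g: "g \<in> borel_measurable borel" "\<And>x. x \<notin> U \<Longrightarrow> g x = 0" "integrable lborel (\<lambda>x. (g x)\<^sup>2)"
    and norm: "\<And>w. w \<in> borel_measurable borel \<Longrightarrow> (\<And>x. x \<notin> U \<Longrightarrow> w x = 0) \<Longrightarrow>
      L2_norm_on U (\<lambda>x. f x - w x) = sqrt (LINT x|lborel. (g x - w x)\<^sup>2)"
    using L2_on_borel_representative[OF UB f] by blast
  have "(\<epsilon> / 2)\<^sup>2 > 0" using \<epsilon> by simp
  from regional_solutions_approximate[OF \<Omega> \<open>open U\<close> U \<open>0 < a\<close> \<open>a < 1\<close> g this, of C]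
  obtain u w where u: "u \<in> sobolev a" "regional_harmonic_in C a \<Omega> U (restrict u \<Omega>)"
    and w: "w \<in> borel_measurable borel" "\<And>x. x \<in> U \<Longrightarrow> w x = u x" "\<And>x. x \<notin> U \<Longrightarrow> w x = 0"
    and le: "(LINT x|lborel. (g x - w x)\<^sup>2) \<le> (\<epsilon> / 2)\<^sup>2"
    by blast
  let ?v = "restrict (restrict u \<Omega>) U"
  have "?v \<in> regional_solution_restrictions C a \<Omega> U"
    unfolding regional_solution_restrictions_def sobolev_on_def using u by blast
  moreover have "L2_norm_on U (\<lambda>x. f x - ?v x) = L2_norm_on U (\<lambda>x. f x - w x)"
    unfolding L2_norm_on_def using w(2) sub
    by (intro arg_cong[where f = sqrt] Bochner_Integration.integral_cong) (auto simp: subset_iff)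
  moreover have "L2_norm_on U (\<lambda>x. f x - w x) \<le> \<epsilon> / 2"
  proof -
    have "L2_norm_on U (\<lambda>x. f x - w x) = sqrt (LINT x|lborel. (g x - w x)\<^sup>2)" by (intro norm w)
    also have "\<dots> \<le> \<epsilon> / 2" using le \<epsilon> by (intro real_le_lsqrt) auto
    finally show ?thesis .
  qed
  ultimately show "\<exists>g\<in>regional_solution_restrictions C a \<Omega> U. L2_norm_on U (\<lambda>x. f x - g x) < \<epsilon>"
    using \<epsilon> by (intro bexI[of _ ?v]) auto
qed

end
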